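(* For all $m,n,d\in\mathbb{N}$, $$\det\mathsf{RSK}_{m,n,d}=\prod_{(\sigma,\pi)}(\det\mathsf{RSK}_{\sigma,\pi})^{N_{\sigma,\pi}(m,n,d)},$$ where the product is over nonzero reduced weight pairs $(\sigma,\pi)$ (satisfying the normalization in the context) of degree $d'\leq d$ and $$N_{\sigma,\pi}(m,n,d)=\begin{cases}A_{\sigma,\pi}(d)\left(\binom{m}{\ell(\sigma)}\binom{n}{\ell(\pi)}+\binom{m}{\ell(\pi)}\binom{n}{\ell(\sigma)}\right)&\text{if }\sigma\neq\pi,\\ A_{\sigma,\pi}(d)\binom{m}{\ell(\sigma)}\binom{n}{\ell(\pi)}&\text{if }\sigma=\pi.\end{cases}$$ Furthermore, when $m=n$ this formula simplifies to $$\det\mathsf{RSK}_{m,m,d}=\prod_{\sigma}\det\mathsf{RSK}_{\sigma,\sigma},$$ where the product is over nonzero $\sigma$ (with all entries nonzero) such that $(\sigma,\sigma)$ is reduced of degree $d'\leq d$ and $A_{\sigma,\sigma}(d)\binom{m}{\ell(\sigma)}$ is odd.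
   Context: $\mathbb{N}=\{0,1,2,\dots\}$. RSK. A semistandard Young tableau is a filling of a Young diagram (English notation) by positive integers, weakly increasing along rows and strictly increasing down columns. Row insertion $P\leftarrow p$: if no label in the first row of $P$ exceeds $p$, append $p$ to the end of the first row; otherwise replace the leftmost occurrence of the smallest label $p'>p$ of the first row by $p$, and insert $p'$ in the same way into the tableau formed by the remaining rows. Inserting a biletter $(p|q)$ into a pair $(P,Q)$ of tableaux of the same shape yields $(P\leftarrow p,Q^\uparrow)$, where $Q^\uparrow$ is $Q$ with a new box labelled $q$ placed where $P\leftarrow p$ has a new box. For an $m\times n$ matrix $\alpha$ with entries in $\mathbb{N}$, list biletters by reading the entries of $\alpha$ down columns, columns from left to right, recording $\alpha_{i,j}$ copies of $(i|j)$. $\mathrm{RSK}(\alpha)=(P,Q)$ is the result of inserting these biletters successively into $(\emptyset,\emptyset)$. Operator. Let $R_{m,n}=\mathbb{C}[z_{ij}]_{1\le i\le m,1\le j\le n}$, $Z=[z_{ij}]$, and $z^\alpha=\prod_{i,j} z_{ij}^{\alpha_{i,j}}$. For semistandard $P,Q$ of the same shape, $[P|Q]\in R_{m,n}$ is the product over column positions $c$ of the minors of $Z$ whose row indices are the entries of the $c$-th column of $P$ and whose column indices are the entries of the $c$-th column of $Q$. Let $\mathsf{RSK}:R_{m,n}\to R_{m,n}$ be the linear map with $z^\alpha\mapsto[P|Q]$ where $(P,Q)=\mathrm{RSK}(\alpha)$. It preserves degree, and $\mathsf{RSK}_{m,n,d}$ denotes its restriction to the span $R_{m,n,d}$ of degree-$d$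 monomials. Weight spaces. A weight pair of degree $d'$ is $(\sigma,\pi)$, a pair of tuples of nonnegative integers with $\sum_i\sigma_i=\sum_j\pi_j=d'$; $\ell(\sigma)$ is the number of entries of $\sigma$. $R_{\sigma,\pi}$ is the span of the monomials $z^\alpha$ in $R_{\ell(\sigma),\ell(\pi)}$ for which $\alpha$ has row sums $\sigma$ and column sums $\pi$; it is preserved by $\mathsf{RSK}$, and $\mathsf{RSK}_{\sigma,\pi}$ is the restriction. Normalization of the weight pairs indexing the product: all entries of $\sigma$ and $\pi$ are nonzero, $\ell(\sigma)\leq\ell(\pi)$, and if $\ell(\sigma)=\ell(\pi)$ then $\sigma=\pi$ or $\sigma_i>\pi_i$ for the least $i$ with $\sigma_i\neq\pi_i$. A weight pair of degree $d'$ is reduced if $\max_i\sigma_i+\max_j\pi_j\leq d'$. (Nonzero reduced pairs with nonzero entries have $\ell(\sigma),\ell(\pi)\ge2$.) The numbers $A_{\sigma,\pi}(d)$. For a reduced pair of degree $d'$ put $g_{\sigma,\pi}=|\{(k,l):\sigma_k+\pi_l=d'\}|$. For $d\geq d'$: if $\ell(\pi)\geq3$, then $A_{\sigma,\pi}(d)=\binom{(d-d')+(g_{\sigma,\pi}-1)}{g_{\sigma,\pi}-1}$ if $g_{\sigma,\pi}\geq1$, and $A_{\sigma,\pi}(d)=\delta_{d,d'}$ if $g_{\sigma,\pi}=0$; if $\ell(\sigma)=\ell(\pi)=2$, then $A_{\sigma,\pi}(d)=4(d-d')+\delta_{d,d'}$. Here $\delta$ is the Kronecker delta. *)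

theory Defs
  imports
    Complex_Main
    "HOL-Library.Poly_Mapping"
    "Jordan_Normal_Form.Determinant"
begin

section \<open>The RSK correspondence\<close>

text \<open>A tableau is the list of its rows, from top to bottom.\<close>

type_synonym tableau = "nat list list"

fun row_insert :: "tableau \<Rightarrow> nat \<Rightarrow> tableau" where
  "row_insert [] p = [[p]]"
| "row_insert (r # rs) p =
     (if \<forall>x\<in>set r. x \<le> p then (r @ [p]) # rs
      else let p' = Min {x \<in> set r. p < x};
               i = (LEAST i. i < length r \<and> r ! i = p')
           in r[i := p] # row_insert rs p')"

text \<open>\<open>add_box P' Q q\<close> adds to \<open>Q\<close> a box labelled \<open>q\<close> at the (unique) box of the shape of \<open>P'\<close>
  that is missing from the shape of \<open>Q\<close>.\<close>

fun add_box :: "tableau \<Rightarrow> tableau \<Rightarrow> nat \<Rightarrow> tableau" where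
  "add_box [] Q q = Q"
| "add_box (r # rs) [] q = [[q]]"
| "add_box (r # rs) (s # ss) q =
     (if length s < length r then (s @ [q]) # ss else s # add_box rs ss q)"

definition insert_biletter :: "tableau \<times> tableau \<Rightarrow> nat \<times> nat \<Rightarrow> tableau \<times> tableau" where
  "insert_biletter = (\<lambda>(P, Q) (p, q). let P' = row_insert P p in (P', add_box P' Q q))"

text \<open>Rows and columns of matrices are numbered from 1, so that an \<open>m \<times> n\<close> matrix over the natural
  numbers is a finitely supported function on pairs with support in \<open>{1..m} \<times> {1..n}\<close>.\<close>

type_synonym exponent = "(nat \<times> nat) \<Rightarrow>\<^sub>0 nat"

definition nat_matrices :: "nat \<Rightarrow> nat \<Rightarrow> exponent set" where
  "nat_matrices m n = {\<alpha>. Poly_Mapping.keys \<alpha> \<subseteq> {1..m} \<times> {1..n}}"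

definition biletters :: "nat \<Rightarrow> nat \<Rightarrow> exponent \<Rightarrow> (nat \<times> nat) list" where
  "biletters m n \<alpha> =
     concat (map (\<lambda>j. concat (map (\<lambda>i. replicate (Poly_Mapping.lookup \<alpha> (i, j)) (i, j))
       [1..<m + 1])) [1..<n + 1])"

definition rsk :: "nat \<Rightarrow> nat \<Rightarrow> exponent \<Rightarrow> tableau \<times> tableau" where
  "rsk m n \<alpha> = foldl insert_biletter ([], []) (biletters m n \<alpha>)"

section \<open>Polynomials in the variables $z_{ij}$\<close>

text \<open>All rings $R_{m,n}$ live in the one polynomial ring in the variables $z_{ij}$ indexed by pairs
  of natural numbers; a polynomial is the finitely supported function giving its coefficients.\<close>

type_synonym cpoly = "exponent \<Rightarrow>\<^sub>0 complex"

definition monomial :: "exponent \<Rightarrow> cpoly" where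
  "monomial \<alpha> = Poly_Mapping.single \<alpha> 1"

definition var :: "nat \<Rightarrow> nat \<Rightarrow> cpoly" where
  "var i j = monomial (Poly_Mapping.single (i, j) 1)"

definition cpoly_scale :: "complex \<Rightarrow> cpoly \<Rightarrow> cpoly" where
  "cpoly_scale c f = Poly_Mapping.single 0 c * f"

global_interpretation cpoly: vector_space cpoly_scale
  by unfold_locales
    (simp_all add: cpoly_scale_def distrib_left distrib_right single_add mult_single
      flip: mult.assoc)

definition minor :: "nat list \<Rightarrow> nat list \<Rightarrow> cpoly" where
  "minor rs cs = det (mat (length rs) (length cs) (\<lambda>(a, b). var (rs ! a) (cs ! b)))"

text \<open>\<^const>\<open>List.transpose\<close> turns the list of rows of a tableau into the list of its columns.\<close>

definition bitableau :: "tableau \<Rightarrow> tableau \<Rightarrow> cpoly" where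
  "bitableau P Q = prod_list (map2 minor (List.transpose P) (List.transpose Q))"

text \<open>The operator is the linear extension of $z^\alpha \mapsto [P|Q]$. Only its restriction to
  subspaces of $R_{m,n}$ is meaningful.\<close>

definition RSK_op :: "nat \<Rightarrow> nat \<Rightarrow> cpoly \<Rightarrow> cpoly" where
  "RSK_op m n f =
     (\<Sum>\<alpha>\<in>Poly_Mapping.keys f.
        cpoly_scale (Poly_Mapping.lookup f \<alpha>) (case rsk m n \<alpha> of (P, Q) \<Rightarrow> bitableau P Q))"

section \<open>Determinants of restrictions of the operator\<close>

text \<open>The determinant of the restriction of the linear endomorphism \<open>T\<close> to a finite-dimensional
  invariant subspace \<open>V\<close>. It does not depend on which basis is chosen, nor on its order.\<close>

definition restriction_matrix :: "cpoly list \<Rightarrow> (cpoly \<Rightarrow> cpoly) \<Rightarrow> complex mat" where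
  "restriction_matrix bs T =
     mat (length bs) (length bs) (\<lambda>(i, j). cpoly.representation (set bs) (T (bs ! j)) (bs ! i))"

definition is_basis_of :: "cpoly list \<Rightarrow> cpoly set \<Rightarrow> bool" where
  "is_basis_of bs V \<longleftrightarrow> distinct bs \<and> cpoly.independent (set bs) \<and> cpoly.span (set bs) = V"

definition restriction_det :: "cpoly set \<Rightarrow> (cpoly \<Rightarrow> cpoly) \<Rightarrow> complex" where
  "restriction_det V T = det (restriction_matrix (SOME bs. is_basis_of bs V) T)"

definition degree_space :: "nat \<Rightarrow> nat \<Rightarrow> nat \<Rightarrow> cpoly set" where
  "degree_space m n d =
     cpoly.span (monomial ` {\<alpha> \<in> nat_matrices m n.
       (\<Sum>i\<in>{1..m}. \<Sum>j\<in>{1..n}. Poly_Mapping.lookup \<alpha> (i, j)) = d})"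

definition det_RSK_degree :: "nat \<Rightarrow> nat \<Rightarrow> nat \<Rightarrow> complex" where
  "det_RSK_degree m n d = restriction_det (degree_space m n d) (RSK_op m n)"

text \<open>Tuples \<open>\<sigma>\<close> and \<open>\<pi>\<close> are lists, whose entries are numbered from 0.\<close>

definition weight_space :: "nat list \<Rightarrow> nat list \<Rightarrow> cpoly set" where
  "weight_space \<sigma> \<pi> =
     cpoly.span (monomial ` {\<alpha> \<in> nat_matrices (length \<sigma>) (length \<pi>).
       (\<forall>i\<in>{1..length \<sigma>}. (\<Sum>j\<in>{1..length \<pi>}. Poly_Mapping.lookup \<alpha> (i, j)) = \<sigma> ! (i - 1)) \<and>
       (\<forall>j\<in>{1..length \<pi>}. (\<Sum>i\<in>{1..length \<sigma>}. Poly_Mapping.lookup \<alpha> (i, j)) = \<pi> ! (j - 1))})"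

definition det_RSK_weight :: "nat list \<Rightarrow> nat list \<Rightarrow> complex" where
  "det_RSK_weight \<sigma> \<pi> = restriction_det (weight_space \<sigma> \<pi>) (RSK_op (length \<sigma>) (length \<pi>))"

section \<open>Weight pairs and exponents\<close>

definition weight_pair :: "nat \<Rightarrow> nat list \<Rightarrow> nat list \<Rightarrow> bool" where
  "weight_pair d' \<sigma> \<pi> \<longleftrightarrow> sum_list \<sigma> = d' \<and> sum_list \<pi> = d'"

definition normalized :: "nat list \<Rightarrow> nat list \<Rightarrow> bool" where
  "normalized \<sigma> \<pi> \<longleftrightarrow>
     0 \<notin> set \<sigma> \<and> 0 \<notin> set \<pi> \<and> length \<sigma> \<le> length \<pi> \<and>
     (length \<sigma> = length \<pi> \<longrightarrow>
        \<sigma> = \<pi> \<or> (\<exists>i<length \<sigma>. \<sigma> ! i > \<pi> ! i \<and> (\<forall>k<i. \<sigma> ! k = \<pi> ! k)))"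

text \<open>To be used for a nonzero pair only: the maximum of an empty tuple is unspecified.\<close>

definition reduced :: "nat list \<Rightarrow> nat list \<Rightarrow> bool" where
  "reduced \<sigma> \<pi> \<longleftrightarrow> Max (set \<sigma>) + Max (set \<pi>) \<le> sum_list \<sigma>"

definition gnum :: "nat list \<Rightarrow> nat list \<Rightarrow> nat" where
  "gnum \<sigma> \<pi> = card {(k, l). k < length \<sigma> \<and> l < length \<pi> \<and> \<sigma> ! k + \<pi> ! l = sum_list \<sigma>}"

text \<open>The degree \<open>d'\<close> of the pair is \<^term>\<open>sum_list \<sigma>\<close>. The last case does not occur for nonzero
  normalized reduced pairs.\<close>

definition A_num :: "nat list \<Rightarrow> nat list \<Rightarrow> nat \<Rightarrow> nat" where
  "A_num \<sigma> \<pi> d =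
     (let d' = sum_list \<sigma>; g = gnum \<sigma> \<pi> in
      if length \<pi> \<ge> 3 then
        (if g \<ge> 1 then ((d - d') + (g - 1)) choose (g - 1) else of_bool (d = d'))
      else if length \<sigma> = 2 \<and> length \<pi> = 2 then 4 * (d - d') + of_bool (d = d')
      else undefined)"

definition N_num :: "nat list \<Rightarrow> nat list \<Rightarrow> nat \<Rightarrow> nat \<Rightarrow> nat \<Rightarrow> nat" where
  "N_num \<sigma> \<pi> m n d =
     (if \<sigma> \<noteq> \<pi> then
        A_num \<sigma> \<pi> d * ((m choose length \<sigma>) * (n choose length \<pi>)
                       + (m choose length \<pi>) * (n choose length \<sigma>))
      else A_num \<sigma> \<pi> d * ((m choose length \<sigma>) * (n choose length \<pi>)))"

end

theory Submission
  imports Defs "HOL-Library.Product_Lexorder"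
begin

text \<open>A shape of an RSK tableau restricted to the top left block of a matrix is determined by Fomin's
  local rules, whose form is symmetric in rows and columns. Hence the recording tableau is governed by
  the same numbers as the insertion tableau, and every comparison of RSK for related matrices
  (transposition, deletion of a zero row, increase of a dominant entry) is an induction over these rules.

  The operator is block diagonal with respect to the weights of length \<open>m\<close> and \<open>n\<close>, zeros allowed. Zeros in
  a weight do not matter, and swapping the two weights transposes all matrices. If
  \<open>\<sigma>\<^sub>k + \<pi>\<^sub>l > d\<close>, then every exponent of weight \<open>(\<sigma>, \<pi>)\<close> has an entry at \<open>(k, l)\<close> that dominates the
  entries outside row \<open>k\<close> and column \<open>l\<close>; lowering it by one divides the bitableau by \<open>z\<^sub>k\<^sub>l\<close>, so the
  determinant is that of the weight \<open>(\<sigma> - e\<^sub>k, \<pi> - e\<^sub>l)\<close>. These reductions are confluent and end in reduced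
  pairs, and \<open>A\<close> counts the pairs of degree \<open>d\<close> that end in a given one.

  For the square case the determinants are shown to be \<open>\<plusminus>1\<close>. Substitute \<open>Z = A B\<close>: in a suitable lexicographic
  order the leading monomial of the bitableau of \<open>\<alpha>\<close> is the product of all \<open>A\<^sub>x\<^sub>s\<close>, \<open>B\<^sub>s\<^sub>y\<close> with \<open>x\<close>, \<open>y\<close> in row \<open>s\<close>
  of the two tableaux, with coefficient 1, and it determines \<open>\<alpha>\<close>. So an integer matrix times the
  matrix of the operator is unitriangular.\<close>

text \<open>Bumping treats the two tableaux very differently, which makes any symmetric statement
  hard to prove on the algorithm itself. It is therefore used only to find, for each row, the number
  of entries that are at most \<open>i\<close>; these counts obey a recursion in max, min and plus,
  and the later arguments know nothing else about RSK. A dominant entry can be divided out because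
  raising it lengthens only the first row of the shapes, and the new entries \<open>k\<close> and
  \<open>l\<close> can be placed in one common column of height one. The bitableau then gains a 1 by
  1 minor and no other minor changes. The two forms of \<open>A\<close> reflect the position of the
  corners of a reduced pair, where an entry of \<sigma> and one of \<pi> sum to the degree. If all
  corners lie in one line, the surplus of degree is distributed over them, which gives a binomial
  coefficient. For two rows and two columns all four positions are corners, and the pairs above the
  reduced one are the lattice points on the boundary of a square of side \<open>d - d'\<close>. The
  actual signs of the determinants are never computed; in the square case parity of the exponents is
  enough.\<close>

section \<open>Local rules for the shapes\<close>

text \<open>If a weakly increasing word with \<open>a i\<close> letters \<open>i\<close> is inserted into a row with \<open>x i\<close> entries that are at
  most \<open>i\<close>, then \<open>trop x a i\<close> is the number of such entries of the new row, and \<open>bump x a i\<close> is the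
  number of letters \<open>i\<close> that are bumped out. The value \<open>a 0\<close> is irrelevant, as letters start at 1.\<close>

fun trop :: "(nat \<Rightarrow> nat) \<Rightarrow> (nat \<Rightarrow> nat) \<Rightarrow> nat \<Rightarrow> nat" where
  "trop x a 0 = 0"
| "trop x a (Suc i) = max (trop x a i) (x (Suc i)) + a (Suc i)"

fun bump :: "(nat \<Rightarrow> nat) \<Rightarrow> (nat \<Rightarrow> nat) \<Rightarrow> nat \<Rightarrow> nat" where
  "bump x a 0 = 0"
| "bump x a (Suc i) = min (x (Suc i)) (trop x a i) - x i"

text \<open>\<open>carry x a k\<close> is the word that arrives in row \<open>k\<close>.\<close>

primrec carry :: "(nat \<Rightarrow> nat \<Rightarrow> nat) \<Rightarrow> (nat \<Rightarrow> nat) \<Rightarrow> nat \<Rightarrow> nat \<Rightarrow> nat" where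
  "carry x a 0 = a"
| "carry x a (Suc k) = bump (x k) (carry x a k)"

text \<open>State after insertion of the first \<open>j\<close> columns:
  \<open>growth a j k i\<close> counts the entries at most \<open>i\<close> in row \<open>k\<close>.
  Each row receives through \<open>carry\<close> the letters bumped out of the row above.\<close>

primrec growth :: "(nat \<Rightarrow> nat \<Rightarrow> nat) \<Rightarrow> nat \<Rightarrow> nat \<Rightarrow> nat \<Rightarrow> nat" where
  "growth a 0 = (\<lambda>k i. 0)"
| "growth a (Suc j) = (\<lambda>k. trop (growth a j k) (carry (growth a j) (\<lambda>i. a i (Suc j)) k))"

text \<open>\<open>lam a k i j\<close> is the length of row \<open>k\<close> (counted from 0) of the tableaux of the top left \<open>i \<times> j\<close> block.\<close>

definition lam :: "(nat \<Rightarrow> nat \<Rightarrow> nat) \<Rightarrow> nat \<Rightarrow> nat \<Rightarrow> nat \<Rightarrow> nat" where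
  "lam a k i j = growth a j k i"

lemma lam_0 [simp]: "lam a k 0 j = 0" "lam a k i 0 = 0"
  by (cases j; simp add: lam_def)+

lemma lam_first:
  "lam a 0 (Suc i) (Suc j) = max (lam a 0 i (Suc j)) (lam a 0 (Suc i) j) + a (Suc i) (Suc j)"
  by (simp add: lam_def)

text \<open>Together with \<open>lam_first\<close> these are Fomin's local rules: the shape at one
  corner of a unit square is a function of the shapes at the other three and, in row 0, of the
  matrix entry. The truncated subtraction is exact by \<open>lam_mono_Suc\<close>.\<close>

lemma lam_Suc:
  "lam a (Suc k) (Suc i) (Suc j) = max (lam a (Suc k) i (Suc j)) (lam a (Suc k) (Suc i) j)
     + (min (lam a k i (Suc j)) (lam a k (Suc i) j) - lam a k i j)"
  by (simp add: lam_def min.commute)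

lemma lam_mono_Suc: "lam a k i j \<le> lam a k (Suc i) j" "lam a k i j \<le> lam a k i (Suc j)"
  by (cases j; cases k; simp add: lam_first lam_Suc)
     (cases i; cases k; simp add: lam_first lam_Suc)

lemma lam_mono: "i \<le> i' \<Longrightarrow> j \<le> j' \<Longrightarrow> lam a k i j \<le> lam a k i' j'"
  by (rule order_trans[of _ "lam a k i' j"])
     (simp_all add: lift_Suc_mono_le[of "\<lambda>i. lam a k i j"] lift_Suc_mono_le[of "lam a k i'"] lam_mono_Suc)

text \<open>The symmetry of RSK under transposition, at the level of shapes: the two neighbours
  enter the local rules only through max and min.\<close>

lemma lam_flip: "lam (\<lambda>i j. a j i) k j i = lam a k i j"
proof (induction k arbitrary: i j)
  case 0
  show ?case
  proof (induction i arbitrary: j)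
    case (Suc i)
    note IH = this
    show ?case by (induction j) (simp_all add: lam_first IH max.commute)
  qed simp
next
  case (Suc k)
  note IHk = this
  show ?case
  proof (induction i arbitrary: j)
    case (Suc i)
    note IH = this
    show ?case by (induction j) (simp_all add: lam_Suc IH IHk max.commute min.commute)
  qed simp
qed

text \<open>This is the horizontal strip condition between neighbouring shapes. The stronger bound
  by both neighbours makes the induction work: at the earlier squares it bounds the max in the local
  rule by \<open>lam a k i j\<close>, which is just what the rule subtracts.\<close>

lemma lam_interlace: "lam a (Suc k) (Suc i) j \<le> lam a k i j" "lam a (Suc k) i (Suc j) \<le> lam a k i j"
proof -
  have *: "lam a (Suc k) (Suc i) (Suc j) \<le> min (lam a k i (Suc j)) (lam a k (Suc i) j)" for i j
  proof (induction i arbitrary: j)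
    case 0
    show ?case by (induction j) (simp_all add: lam_Suc)
  next
    case (Suc i)
    note IH = this
    show ?case
    proof (induction j)
      case 0
      show ?case using IH[of 0] by (simp add: lam_Suc)
    next
      case (Suc j)
      have "lam a k (Suc i) (Suc j) \<le> lam a k (Suc i) (Suc (Suc j))"
        "lam a k (Suc i) (Suc j) \<le> lam a k (Suc (Suc i)) (Suc j)" by (rule lam_mono_Suc)+
      then show ?case using Suc IH[of "Suc j"] lam_Suc[of a k "Suc i" "Suc j"] by linarith
    qed
  qed
  show "lam a (Suc k) (Suc i) j \<le> lam a k i j" using *[of i "j - 1"] by (cases j) auto
  show "lam a (Suc k) i (Suc j) \<le> lam a k i j" using *[of "i - 1" j] by (cases i) auto
qed

lemma lam_eq_0: "i \<le> k \<Longrightarrow> lam a k i j = 0"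
proof (induction k arbitrary: i)
  case (Suc k)
  show ?case
  proof (cases i)
    case (Suc i')
    then show ?thesis using lam_interlace(1)[of a k i' j] Suc.IH[of i'] Suc.prems by simp
  qed simp
qed simp

lemma lam_antimono: "k \<le> k' \<Longrightarrow> lam a k' i j \<le> lam a k i j"
proof (induction rule: dec_induct)
  case (step k')
  show ?case using lam_interlace(1)[of a k' i j] lam_mono_Suc(1)[of a "Suc k'" i j] step by linarith
qed simp

text \<open>Max and min of two numbers add up to their sum, so adding the local rules over all rows
  gives inclusion-exclusion for the sizes of the four shapes. Rows from \<open>i\<close> on are
  empty, so every \<open>K\<close> that is at least \<open>i\<close> will do.\<close>

lemma lam_sum: "i \<le> K \<Longrightarrow> (\<Sum>k<K. lam a k i j) = (\<Sum>i'\<in>{1..i}. \<Sum>j'\<in>{1..j}. a i' j')"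
proof (induction i arbitrary: j K)
  case (Suc i)
  note IHi = Suc.IH and Suc = Suc.prems
  obtain K' where K: "K = Suc K'" "i \<le> K'" using Suc by (cases K) auto
  show ?case
  proof (induction j)
    case (Suc j)
    have le: "lam a k i j \<le> min (lam a k i (Suc j)) (lam a k (Suc i) j)" for k
      by (simp add: lam_mono_Suc)
    have "(\<Sum>k<K. lam a k (Suc i) (Suc j)) + (\<Sum>k<K'. lam a k i j)
       = lam a 0 (Suc i) (Suc j) + (\<Sum>k<K'. lam a (Suc k) (Suc i) (Suc j) + lam a k i j)"
      by (simp add: K sum.lessThan_Suc_shift sum.distrib del: sum.lessThan_Suc)
    also have "(\<Sum>k<K'. lam a (Suc k) (Suc i) (Suc j) + lam a k i j) =
      (\<Sum>k<K'. max (lam a (Suc k) i (Suc j)) (lam a (Suc k) (Suc i) j) +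
        min (lam a k i (Suc j)) (lam a k (Suc i) j))"
    proof (intro sum.cong refl)
      fix k
      show "lam a (Suc k) (Suc i) (Suc j) + lam a k i j = max (lam a (Suc k) i (Suc j)) (lam a (Suc k) (Suc i) j) +
        min (lam a k i (Suc j)) (lam a k (Suc i) j)"
        using le[of k] lam_Suc[of a k i j] by linarith
    qed
    also have "lam a 0 (Suc i) (Suc j) + \<dots> = a (Suc i) (Suc j) +
      ((\<Sum>k<K. max (lam a k i (Suc j)) (lam a k (Suc i) j)) + (\<Sum>k<K'. min (lam a k i (Suc j)) (lam a k (Suc i) j)))"
      by (simp add: K lam_first sum.lessThan_Suc_shift sum.distrib del: sum.lessThan_Suc)
    also have "(\<Sum>k<K'. min (lam a k i (Suc j)) (lam a k (Suc i) j)) = (\<Sum>k<K. min (lam a k i (Suc j)) (lam a k (Suc i) j))"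
      using K by (simp add: lam_eq_0)
    also have "(\<Sum>k<K. max (lam a k i (Suc j)) (lam a k (Suc i) j)) + \<dots> = (\<Sum>k<K. lam a k i (Suc j)) + (\<Sum>k<K. lam a k (Suc i) j)"
      unfolding sum.distrib[symmetric] by (intro sum.cong) (simp_all add: max_def min_def)
    finally have "(\<Sum>k<K. lam a k (Suc i) (Suc j)) + (\<Sum>i'\<in>{1..i}. \<Sum>j'\<in>{1..j}. a i' j')
      = a (Suc i) (Suc j) + ((\<Sum>i'\<in>{1..i}. \<Sum>j'\<in>{1..Suc j}. a i' j') + (\<Sum>i'\<in>{1..Suc i}. \<Sum>j'\<in>{1..j}. a i' j'))"
      using IHi[of K' j] IHi[of K "Suc j"] Suc.IH K by simp
    then show ?case by (simp add: sum.distrib)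
  qed simp
qed simp

text \<open>Injectivity of RSK, by running the local rules backwards: row \<open>k\<close> at
  \<open>(i, j)\<close> is solved for from the rule for row \<open>Suc k\<close> at the opposite
  corner of the square, starting from the shapes with \<open>i = m\<close> or \<open>j = n\<close>.
  The matrix entry is then read off from the rule for row 0.\<close>

lemma lam_inj:
  assumes "\<And>k i. i \<le> m \<Longrightarrow> lam a k i n = lam b k i n" "\<And>k j. j \<le> n \<Longrightarrow> lam a k m j = lam b k m j"
  shows "i \<in> {1..m} \<Longrightarrow> j \<in> {1..n} \<Longrightarrow> a i j = b i j"
proof -
  have eq: "lam a k i j = lam b k i j" if "i \<le> m" "j \<le> n" for k i j
    using that
  proof (induction "(m - i) + (n - j)" arbitrary: i j k rule: less_induct)
    case less
    show ?case
    proof (cases "i = m \<or> j = n")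
      case True
      then show ?thesis using assms less.prems by auto
    next
      case False
      then have l: "Suc i \<le> m" "Suc j \<le> n" using less.prems by auto
      have 1: "lam a k (Suc i) j = lam b k (Suc i) j" "lam a k i (Suc j) = lam b k i (Suc j)"
         "lam a k (Suc i) (Suc j) = lam b k (Suc i) (Suc j)" for k
        using less.hyps[of "Suc i" j] less.hyps[of i "Suc j"] less.hyps[of "Suc i" "Suc j"] l by auto
      have le: "lam a k i j \<le> min (lam a k i (Suc j)) (lam a k (Suc i) j)" for k a
        by (simp add: lam_mono_Suc)
      show ?thesis using lam_Suc[of a k i j] lam_Suc[of b k i j] le[of a k] le[of b k] 1[of k] 1[of "Suc k"]
        by linarith
    qed
  qed
  assume ij: "i \<in> {1..m}" "j \<in> {1..n}"
  then obtain i' j' where "i = Suc i'" "j = Suc j'" by (cases i; cases j) auto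
  then show "a i j = b i j" using lam_first[of a i' j'] lam_first[of b i' j'] eq[of i j' 0] eq[of i' j 0] eq[of i j 0] ij
    by simp
qed

text \<open>Along a zero row the rules only copy: the max is attained at the neighbour in line
  \<open>p - 1\<close> and the min equals the subtracted term, so line \<open>p\<close> of the
  shapes repeats line \<open>p - 1\<close>.\<close>

lemma lam_insert_zero_row:
  assumes a': "a' = (\<lambda>i j. if i < p then a i j else if i = p then 0 else a (i - 1) j)" and p: "1 \<le> p"
  shows "lam a' k i j = lam a k (if i < p then i else i - 1) j"
proof -
  obtain q where q: "p = Suc q" using p by (cases p) auto
  show ?thesis
  proof (induction k arbitrary: i j)
    case 0
    show ?case
    proof (induction i arbitrary: j)
      case (Suc i)
      note IH = this
      show ?case
      proof (induction j)
        case (Suc j)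
        show ?case using Suc IH q
          by (auto simp: lam_first a' max_absorb1 lam_mono_Suc split: if_splits)
             (cases i; auto simp: lam_first)
      qed simp
    qed (use p in simp)
  next
    case (Suc k)
    note IHk = this
    show ?case
    proof (induction i arbitrary: j)
      case (Suc i)
      note IH = this
      show ?case
      proof (induction j)
        case (Suc j)
        show ?case using Suc IH q IHk
          by (auto simp: lam_Suc max_absorb1 min_absorb2 lam_mono_Suc split: if_splits)
             (cases i; auto simp: lam_Suc)
      qed simp
    qed (use p in simp)
  qed
qed

section \<open>Row insertion\<close>

lemma le_trop:
  assumes "x 0 = 0" shows "x i \<le> trop x a i"
  using assms by (cases i) auto

lemma trop_mono: "i \<le> i' \<Longrightarrow> trop x a i \<le> trop x a i'"
  by (rule lift_Suc_mono_le) auto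

context
  fixes x a a' :: "nat \<Rightarrow> nat" and p :: nat
  assumes x: "x 0 = 0" "mono x" and p: "1 \<le> p" and a0: "\<forall>i>p. a i = 0"
    and aa': "a' = a(p := Suc (a p))"
begin

lemma mult_above: "i > p \<Longrightarrow> a i = 0"
  using a0 by blast

lemma upd_nth: "a' i = a i + of_bool (i = p)"
  by (simp add: aa')

lemma trop_upd_less: "i < p \<Longrightarrow> trop x a' i = trop x a i"
proof (induction i)
  case (Suc i)
  then show ?case using upd_nth[of "Suc i"] by simp
qed simp

text \<open>For \<open>p \<le> i\<close>, equal counts at \<open>p\<close> and \<open>i\<close> mean
  that the row has no entry above \<open>p\<close> and at most \<open>i\<close>. So the new letter
  adds one to the counts from \<open>p\<close> up to the next larger entry, which is the one that it
  replaces.\<close>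

lemma trop_upd: "trop x a' i = trop x a i + of_bool (p \<le> i \<and> trop x a i = trop x a p)"
proof (cases "i < p")
  case True
  then show ?thesis by (simp add: trop_upd_less)
next
  case False
  then have "p \<le> i" by simp
  then show ?thesis
  proof (induction rule: dec_induct)
    case base
    obtain q where q: "p = Suc q" using p by (cases p) auto
    then show ?case using trop_upd_less[of q] upd_nth[of p] by simp
  next
    case (step i)
    then show ?case using mult_above[of "Suc i"] trop_mono[of p i x a] upd_nth[of "Suc i"] by (auto simp: max_def)
  qed
qed

text \<open>No letter above \<open>p\<close> has been inserted, so once the count has risen beyond
  its value at \<open>p\<close>, it is the count of the old row.\<close>

lemma trop_eq_after:
  assumes "p \<le> i" "trop x a i \<noteq> trop x a p" shows "trop x a i = x i"
  using assms
proof (induction rule: dec_induct)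
  case (step i)
  have "x i \<le> x (Suc i)" using x(2) by (simp add: monoD)
  then show ?case using step mult_above[of "Suc i"] by (cases "trop x a i = trop x a p") (auto simp: max_def split: if_splits)
qed simp

lemma bump_upd_none:
  assumes "\<forall>i>p. trop x a i = trop x a p"
  shows "bump x a' = bump x a"
proof
  fix i show "bump x a' i = bump x a i"
  proof (cases i)
    case (Suc j)
    have "x (Suc j) \<le> trop x a (Suc j)" using x(1) by (rule le_trop)
    then show ?thesis using Suc trop_upd[of j] assms[rule_format, of "Suc j"] by (auto simp: of_bool_def)
  qed simp
qed

text \<open>The number \<open>p'\<close> is the least entry of the row above \<open>p\<close>, hence
  the letter that \<open>p\<close> bumps. The second conclusion renews the assumption of the context
  for the next row: no letter above \<open>p'\<close> has arrived there.\<close>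

lemma bump_upd:
  assumes p': "p < p'" "trop x a p' \<noteq> trop x a p" "\<forall>i. p < i \<longrightarrow> i < p' \<longrightarrow> trop x a i = trop x a p"
  shows "bump x a' = (bump x a)(p' := Suc (bump x a p'))" and "i > p' \<Longrightarrow> bump x a i = 0"
proof -
  obtain q where q: "p' = Suc q" using p'(1) by (cases p') auto
  show "i > p' \<Longrightarrow> bump x a i = 0"
  proof (cases i)
    case (Suc j)
    assume "i > p'"
    then have "trop x a j = x j" using trop_eq_after[of j] p' trop_mono[of p' j x a] trop_mono[of p p' x a] Suc by simp
    then show ?thesis using Suc by simp
  qed simp
  show "bump x a' = (bump x a)(p' := Suc (bump x a p'))"
  proof
    fix i show "bump x a' i = ((bump x a)(p' := Suc (bump x a p'))) i"
    proof (cases i)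
      case 0
      then show ?thesis using p' by auto
    next
      case (Suc j)
      have m: "x j \<le> x (Suc j)" using x(2) by (simp add: monoD)
      have l: "x j \<le> trop x a j" "x (Suc j) \<le> trop x a (Suc j)" using x(1) by (auto intro: le_trop)
      consider "Suc j < p'" | "Suc j = p'" | "p' < Suc j" by linarith
      then show ?thesis
      proof cases
        case 1
        then show ?thesis using Suc l m trop_upd[of j] trop_upd[of "Suc j"] p'(3)[rule_format, of "Suc j"] by (auto simp: of_bool_def)
      next
        case 2
        have "trop x a j = trop x a p" using p'(1) p'(3)[rule_format, of j] 2 by (cases "j = p") auto
        moreover have "x (Suc j) > trop x a p"
          using trop_eq_after[of "Suc j"] p' 2 trop_mono[of p p' x a] by simp
        ultimately show ?thesis using Suc l m trop_upd[of j] 2 p'(1) by (auto simp: of_bool_def)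
      next
        case 3
        have "trop x a j \<noteq> trop x a p" using 3 p' trop_mono[of p' j x a] trop_mono[of p p' x a] by simp
        then show ?thesis using Suc trop_upd[of j] 3 by auto
      qed
    qed
  qed
qed

end

text \<open>\<open>carry\<close> recurses from the bottom row and \<open>row_insert\<close> from the
  top row. To pass from one to the other, the word bumped out of row 0 is taken as the input of the
  remaining rows.\<close>

lemma carry_Cons: "carry x a (Suc k) = carry (\<lambda>k. x (Suc k)) (bump (x 0) a) k"
  by (induction k) simp_all

definition count_le :: "nat list \<Rightarrow> nat \<Rightarrow> nat" where
  "count_le r i = length (filter (\<lambda>y. y \<le> i) r)"

text \<open>A tableau with sorted nonempty rows is known once these counts are. Missing rows count
  as empty, so no bound on the number of rows has to be carried along.\<close>

fun cnt :: "tableau \<Rightarrow> nat \<Rightarrow> nat \<Rightarrow> nat" where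
  "cnt [] k i = 0"
| "cnt (r # rs) 0 i = count_le r i"
| "cnt (r # rs) (Suc k) i = cnt rs k i"

fun rlen :: "tableau \<Rightarrow> nat \<Rightarrow> nat" where
  "rlen [] k = 0"
| "rlen (r # rs) 0 = length r"
| "rlen (r # rs) (Suc k) = rlen rs k"

definition sorted_rows :: "tableau \<Rightarrow> bool" where
  "sorted_rows T \<longleftrightarrow> (\<forall>r\<in>set T. sorted r \<and> r \<noteq> [])"

lemma sorted_rows_simps [simp]: "sorted_rows []"
  "sorted_rows (r # rs) \<longleftrightarrow> sorted r \<and> r \<noteq> [] \<and> sorted_rows rs"
  by (auto simp: sorted_rows_def)

lemma count_le_simps [simp]: "count_le [] i = 0" "count_le (r @ s) i = count_le r i + count_le s i"
  "count_le (y # r) i = of_bool (y \<le> i) + count_le r i"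
  by (auto simp: count_le_def)

lemma count_le_max: "\<forall>y\<in>set r. y \<le> i \<Longrightarrow> count_le r i = length r"
  by (simp add: count_le_def)

lemma count_le_eq_iff:
  assumes "p \<le> i" shows "count_le r i = count_le r p \<longleftrightarrow> (\<forall>y\<in>set r. y \<le> i \<longrightarrow> y \<le> p)"
proof (induction r)
  case (Cons y r)
  have "count_le r p \<le> count_le r i" using assms by (induction r) auto
  then show ?case using Cons assms by auto
qed simp

lemma bump_row:
  assumes r: "sorted r" and ex: "\<not> (\<forall>y\<in>set r. y \<le> p)"
    and p': "p' = Min {y \<in> set r. p < y}" and j: "j = (LEAST i. i < length r \<and> r ! i = p')"
  shows "sorted (r[j := p])" "p < p'" "p' \<in> set r" "\<And>y. y \<in> set r \<Longrightarrow> p < y \<Longrightarrow> p' \<le> y"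
    "count_le (r[j := p]) i + of_bool (p' \<le> i) = count_le r i + of_bool (p \<le> i)"
proof -
  have fin: "finite {y \<in> set r. p < y}" "{y \<in> set r. p < y} \<noteq> {}" using ex by auto
  have "p' \<in> {y \<in> set r. p < y}" unfolding p' using fin by (rule Min_in)
  then show pp: "p < p'" "p' \<in> set r" by auto
  show mi: "p' \<le> y" if "y \<in> set r" "p < y" for y unfolding p' using fin that by auto
  have "j < length r \<and> r ! j = p'" unfolding j by (rule LeastI_ex) (use pp in \<open>auto simp: in_set_conv_nth\<close>)
  then have jl: "j < length r" "r ! j = p'" by auto
  have less: "r ! i \<le> p" if "i < j" for i
  proof (rule ccontr)
    assume "\<not> r ! i \<le> p"
    then have "p' \<le> r ! i" using mi[of "r ! i"] that jl by auto
    moreover have "r ! i \<le> r ! j" using sorted_nth_mono[OF r, of i j] that jl by simp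
    ultimately show False using not_less_Least[of i "\<lambda>i. i < length r \<and> r ! i = p'"] that jl j by auto
  qed
  have gr: "p' \<le> r ! i" if "j < i" "i < length r" for i
    using r that jl by (metis sorted_nth_mono less_imp_le)
  show "sorted (r[j := p])"
    unfolding sorted_iff_nth_mono_less
  proof (intro allI impI)
    fix i i' assume i: "i < i'" "i' < length (r[j := p])"
    then have "i < length r" "i' < length r" by auto
    show "r[j := p] ! i \<le> r[j := p] ! i'"
      using less[of i] gr[of i'] pp(1) sorted_nth_mono[OF r, of i i'] i by (auto simp: nth_list_update jl)
  qed
  have "r = take j r @ p' # drop (Suc j) r" using jl id_take_nth_drop by blast
  then have "count_le r i = count_le (take j r @ p' # drop (Suc j) r) i" by simp
  moreover have "r[j := p] = take j r @ p # drop (Suc j) r" using jl by (simp add: upd_conv_take_nth_drop)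
  ultimately show "count_le (r[j := p]) i + of_bool (p' \<le> i) = count_le r i + of_bool (p \<le> i)" by simp
qed

declare row_insert.simps(2) [simp del]

text \<open>Inserting one more letter appends it to the word \<open>a\<close>, while
  \<open>x\<close> remains the tableau to which the word is applied. Both vary in the induction,
  because the rows below see the shifted \<open>x\<close> and the word bumped out of the first
  row.\<close>

lemma row_insert_cnt:
  assumes "sorted_rows T" "\<And>k i. cnt T k i = trop (x k) (carry x a k) i"
    "\<And>k. x k 0 = 0" "\<And>k. mono (x k)" "\<forall>i>p. a i = 0" "1 \<le> p"
  shows "sorted_rows (row_insert T p) \<and>
    (\<forall>k i. cnt (row_insert T p) k i = trop (x k) (carry x (a(p := Suc (a p))) k) i)"
  using assms
proof (induction T arbitrary: x a p)
  case Nil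
  note upd = trop_upd[where x = "x 0" and a = a, OF Nil(3) Nil(4) Nil(6) Nil(5) refl] bump_upd_none[where x = "x 0" and a = a, OF Nil(3) Nil(4) Nil(6) Nil(5) refl]
  have z: "trop (x k) (carry x a k) i = 0" for k i using Nil(2)[of k i] by simp
  have b: "bump (x 0) (a(p := Suc (a p))) = bump (x 0) a"
    using upd(2) z[of 0] by simp
  show ?case
  proof (intro conjI allI)
    fix k i
    show "cnt (row_insert [] p) k i = trop (x k) (carry x (a(p := Suc (a p))) k) i"
    proof (cases k)
      case 0
      then show ?thesis using upd(1)[of i] z[of 0] by simp
    next
      case (Suc k')
      then show ?thesis using z[of k i] by (simp add: carry_Cons b del: carry.simps(2))
    qed
  qed simp
next
  case (Cons r rs)
  note upd = trop_upd[where x = "x 0" and a = a, OF Cons.prems(3) Cons.prems(4) Cons.prems(6) Cons.prems(5) refl]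
    and bupdn = bump_upd_none[where x = "x 0" and a = a, OF Cons.prems(3) Cons.prems(4) Cons.prems(6) Cons.prems(5) refl]
    and bupd = bump_upd[where x = "x 0" and a = a, OF Cons.prems(3) Cons.prems(4) Cons.prems(6) Cons.prems(5) refl]
  have cr: "count_le r i = trop (x 0) a i" for i using Cons.prems(2)[of 0 i] by simp
  have crs: "cnt rs k i = trop (x (Suc k)) (carry (\<lambda>k. x (Suc k)) (bump (x 0) a) k) i" for k i
    using Cons.prems(2)[of "Suc k" i] by (simp add: carry_Cons del: carry.simps(2))
  have r: "sorted r" "r \<noteq> []" "sorted_rows rs" using Cons.prems(1) by auto
  show ?case
  proof (cases "\<forall>y\<in>set r. y \<le> p")
    case True
    then have ins: "row_insert (r # rs) p = (r @ [p]) # rs" by (simp add: row_insert.simps(2))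
    have t: "trop (x 0) a i = trop (x 0) a p" if "p < i" for i
      using count_le_eq_iff[of p i r] that True by (simp add: cr)
    have b: "bump (x 0) (a(p := Suc (a p))) = bump (x 0) a"
      by (rule bupdn) (use t in blast)
    have "sorted (r @ [p])" using r True by (simp add: sorted_append)
    moreover have "cnt ((r @ [p]) # rs) k i = trop (x k) (carry x (a(p := Suc (a p))) k) i" for k i
    proof (cases k)
      case 0
      then show ?thesis using upd[of i] t[of i] by (cases "i = p") (auto simp: cr)
    next
      case (Suc k')
      then show ?thesis using crs by (simp add: carry_Cons b del: carry.simps(2))
    qed
    ultimately show ?thesis unfolding ins sorted_rows_simps using r by blast
  next
    case False
    define p' where "p' = Min {y \<in> set r. p < y}"
    define j where "j = (LEAST i. i < length r \<and> r ! i = p')"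
    have ins: "row_insert (r # rs) p = r[j := p] # row_insert rs p'"
      by (simp only: row_insert.simps(2) p'_def j_def Let_def False if_False)
    note br = bump_row[OF r(1) False p'_def j_def]
    have c1: "trop (x 0) a p' \<noteq> trop (x 0) a p"
      using count_le_eq_iff[of p p' r] br(2,3) by (auto simp: cr)
    have c2: "\<forall>i. p < i \<longrightarrow> i < p' \<longrightarrow> trop (x 0) a i = trop (x 0) a p"
    proof (intro allI impI)
      fix i assume "p < i" "i < p'"
      then show "trop (x 0) a i = trop (x 0) a p"
        using count_le_eq_iff[of p i r] br(4) by (force simp: cr)
    qed
    have b: "bump (x 0) (a(p := Suc (a p))) = (bump (x 0) a)(p' := Suc (bump (x 0) a p'))"
      "\<And>i. i > p' \<Longrightarrow> bump (x 0) a i = 0" using bupd[OF br(2) c1 c2] by auto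
    have IH: "sorted_rows (row_insert rs p') \<and>
      (\<forall>k i. cnt (row_insert rs p') k i = trop (x (Suc k)) (carry (\<lambda>k. x (Suc k)) ((bump (x 0) a)(p' := Suc (bump (x 0) a p'))) k) i)"
      by (rule Cons.IH) (use r crs b Cons.prems br(2) in auto)
    have "cnt (r[j := p] # row_insert rs p') k i = trop (x k) (carry x (a(p := Suc (a p))) k) i" for k i
    proof (cases k)
      case 0
      \<comment> \<open>The counts of the first row change for \<open>p \<le> i\<close> and
        \<open>i < p'\<close> only: the gain at \<open>p\<close> is cancelled at \<open>p'\<close>,
        where the old entry leaves.\<close>
      have "p \<le> i \<and> trop (x 0) a i = trop (x 0) a p \<longleftrightarrow> p \<le> i \<and> i < p'"
        using count_le_eq_iff[of p i r] br(2-4) by (auto simp: cr not_less) (meson leD le_less_linear order_trans)+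
      then show ?thesis using 0 br(2) br(5)[of i] upd[of i] by (auto simp: cr of_bool_def split: if_splits)
    next
      case (Suc k')
      then show ?thesis using IH by (simp add: carry_Cons b del: carry.simps(2))
    qed
    moreover have "r[j := p] \<noteq> []" using r by simp
    ultimately show ?thesis unfolding ins sorted_rows_simps using br(1) IH by blast
  qed
qed

lemma row_insert_entries: "\<Union>(set ` set (row_insert T p)) \<subseteq> insert p (\<Union>(set ` set T))"
proof (induction T arbitrary: p)
  case (Cons r rs)
  show ?case
  proof (cases "\<forall>y\<in>set r. y \<le> p")
    case False
    define p' where "p' = Min {y \<in> set r. p < y}"
    have "p' \<in> {y \<in> set r. p < y}" unfolding p'_def using False by (intro Min_in) auto
    moreover have "row_insert (r # rs) p = r[(LEAST i. i < length r \<and> r ! i = p') := p] # row_insert rs p'"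
      by (simp only: row_insert.simps(2) p'_def Let_def False if_False)
    ultimately show ?thesis using Cons[of p'] set_update_subset_insert[of r] by auto blast+
  qed (auto simp: row_insert.simps(2))
qed simp

lemma row_insert_rlen: "\<exists>K. \<forall>k. rlen (row_insert T p) k = rlen T k + of_bool (k = K)"
proof (induction T arbitrary: p)
  case Nil
  have "rlen [[p]] k = of_bool (k = 0)" for k by (cases k) auto
  then show ?case by auto
next
  case (Cons r rs)
  show ?case
  proof (cases "\<forall>y\<in>set r. y \<le> p")
    case True
    then have "rlen (row_insert (r # rs) p) k = rlen (r # rs) k + of_bool (k = 0)" for k
      by (cases k) (auto simp: row_insert.simps(2))
    then show ?thesis by blast
  next
    case False
    obtain K where "\<forall>k. rlen (row_insert rs (Min {y \<in> set r. p < y})) k = rlen rs k + of_bool (k = K)"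
      using Cons by blast
    then have "rlen (row_insert (r # rs) p) k = rlen (r # rs) k + of_bool (k = Suc K)" for k
      using False by (cases k) (auto simp: row_insert.simps(2) Let_def)
    then show ?thesis by blast
  qed
qed

text \<open>The scan stops at the first row in which \<open>Q\<close> is shorter than
  \<open>P\<close>, which under the hypotheses is row \<open>K\<close>. As no label exceeds
  \<open>q\<close>, the rows stay sorted and the counts below \<open>q\<close> do not
  change.\<close>

lemma add_box:
  assumes "sorted_rows P" "sorted_rows Q" "\<And>k. rlen P k = rlen Q k + of_bool (k = K)"
    "\<Union>(set ` set Q) \<subseteq> {1..q}" "1 \<le> q"
  shows "sorted_rows (add_box P Q q) \<and> rlen (add_box P Q q) = rlen P \<and>
    \<Union>(set ` set (add_box P Q q)) \<subseteq> {1..q} \<and> (\<forall>k. \<forall>i<q. cnt (add_box P Q q) k i = cnt Q k i)"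
  using assms
proof (induction P Q q arbitrary: K rule: add_box.induct)
  case (1 Q q)
  then show ?case using 1(3)[of K] by simp
next
  case (2 r rs q)
  have K: "K = 0" "length r = 1" using 2(1) 2(3)[of 0] by (cases "K = 0"; simp)+
  have "rs = []" using 2(1) 2(3)[of 1] K by (cases rs) auto
  moreover have "rlen [[q]] k = rlen [r] k" "i < q \<Longrightarrow> cnt [[q]] k i = 0" for k i
    using K by (cases k; simp)+
  ultimately show ?case using 2 by auto
next
  case (3 r rs s ss q)
  show ?case
  proof (cases "length s < length r")
    case True
    then have "K = 0" using 3(4)[of 0] by (auto split: if_splits)
    then have "rlen ((s @ [q]) # ss) k = rlen (r # rs) k" "i < q \<Longrightarrow> cnt ((s @ [q]) # ss) k i = cnt (s # ss) k i" for k i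
      using 3(4)[of k] by (cases k; auto)+
    moreover have "sorted (s @ [q])" using 3 by (auto simp: sorted_append)
    ultimately show ?thesis using 3 True by auto
  next
    case False
    then obtain K' where K: "K = Suc K'" using 3(4)[of 0] by (cases K) auto
    have "rlen rs k = rlen ss k + of_bool (k = K')" for k
      using 3(4)[of "Suc k"] K by simp
    then have IH: "sorted_rows (add_box rs ss q) \<and> rlen (add_box rs ss q) = rlen rs \<and>
    \<Union>(set ` set (add_box rs ss q)) \<subseteq> {1..q} \<and> (\<forall>k. \<forall>i<q. cnt (add_box rs ss q) k i = cnt ss k i)"
      using 3 False by (intro "3.IH"[of K']) auto
    have "rlen (s # add_box rs ss q) k = rlen (r # rs) k"
      "i < q \<Longrightarrow> cnt (s # add_box rs ss q) k i = cnt (s # ss) k i" for k i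
      using IH 3(4)[of 0] K by (cases k; auto)+
    then show ?thesis using IH 3 False by auto
  qed
qed

text \<open>Positions and counts in a sorted row form a Galois connection. This is why an entry can
  be recovered from the counts as a least element.\<close>

lemma count_le_less_iff:
  assumes "sorted r" "c < length r" shows "c < count_le r i \<longleftrightarrow> r ! c \<le> i"
proof -
  have cl: "count_le r i = card {c. c < length r \<and> r ! c \<le> i}"
    by (simp add: count_le_def length_filter_conv_card)
  show ?thesis
  proof
    assume "r ! c \<le> i"
    then have "{..c} \<subseteq> {c. c < length r \<and> r ! c \<le> i}"
      using assms by (auto intro: order_trans[OF sorted_nth_mono])
    then have "card {..c} \<le> count_le r i" unfolding cl by (intro card_mono) auto
    then show "c < count_le r i" by simp
  next
    assume *: "c < count_le r i"
    show "r ! c \<le> i"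
    proof (rule ccontr)
      assume "\<not> r ! c \<le> i"
      then have "{c. c < length r \<and> r ! c \<le> i} \<subseteq> {..<c}"
        using assms(1) by (auto simp: not_le) (meson leD leI order_less_le_trans sorted_nth_mono)
      then have "count_le r i \<le> card {..<c}" unfolding cl by (intro card_mono) auto
      then show False using * by simp
    qed
  qed
qed

lemma cnt_nth: "k < length T \<Longrightarrow> cnt T k = count_le (T ! k)"
proof (induction T arbitrary: k)
  case (Cons r rs)
  then show ?case by (cases k) auto
qed simp

lemma rlen_nth: "rlen T k = (if k < length T then length (T ! k) else 0)"
proof (induction T arbitrary: k)
  case (Cons r rs)
  then show ?case by (cases k) auto
qed simp

lemma cnt_max: "\<Union>(set ` set T) \<subseteq> {1..m} \<Longrightarrow> m \<le> i \<Longrightarrow> cnt T k i = rlen T k"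
proof (induction T arbitrary: k)
  case (Cons r rs)
  then show ?case by (cases k) (auto intro!: count_le_max)
qed simp

lemma cnt_0: "\<Union>(set ` set T) \<subseteq> {1..m} \<Longrightarrow> cnt T k 0 = 0"
proof (induction T arbitrary: k)
  case (Cons r rs)
  have "count_le r 0 = 0" using Cons.prems by (auto simp: count_le_def filter_empty_conv)
  then show ?case using Cons by (cases k) auto
qed simp

lemma cnt_mono: "mono (cnt T k)"
proof (induction T arbitrary: k)
  case Nil
  show ?case by (simp add: mono_def)
next
  case (Cons r rs)
  have "mono (count_le r)" by (rule monoI, induction r) (auto intro: le_SucI)
  then show ?case using Cons by (cases k) (auto simp: mono_def)
qed

section \<open>Entries and columns read off from the counts\<close>

definition ent :: "(nat \<Rightarrow> nat) \<Rightarrow> nat \<Rightarrow> nat" where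
  "ent g c = (LEAST i. c < g i)"

definition hgt :: "(nat \<Rightarrow> nat) \<Rightarrow> nat \<Rightarrow> nat" where
  "hgt g c = (LEAST k. g k \<le> c)"

definition col_det :: "(nat \<Rightarrow> nat \<Rightarrow> 'r::comm_ring_1) \<Rightarrow> (nat \<Rightarrow> nat \<Rightarrow> nat) \<Rightarrow> nat \<Rightarrow> nat \<Rightarrow> nat \<Rightarrow> 'r" where
  "col_det v a m n c = (let h = hgt (\<lambda>k. lam a k m n) c in
     det (mat h h (\<lambda>(s, t). v (ent (\<lambda>i. lam a s i n) c) (ent (\<lambda>j. lam a t m j) c))))"

text \<open>Column \<open>c\<close> of \<open>P\<close> consists of the numbers \<open>ent (\<lambda>i. lam a s i n) c\<close>, where \<open>s\<close> is less than its height
  \<open>hgt (\<lambda>k. lam a k m n) c\<close>, since \<open>lam a s i n\<close> counts the entries of row \<open>s\<close> that are at most \<open>i\<close>. The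
  entries \<open>v i j\<close> stand for the variables, so that substitution acts on \<open>v\<close> only.\<close>

definition bidet :: "(nat \<Rightarrow> nat \<Rightarrow> 'r::comm_ring_1) \<Rightarrow> (nat \<Rightarrow> nat \<Rightarrow> nat) \<Rightarrow> nat \<Rightarrow> nat \<Rightarrow> 'r" where
  "bidet v a m n = (\<Prod>c<lam a 0 m n. col_det v a m n c)"

lemma nth_ent:
  assumes "sorted_rows T" "c < rlen T k" shows "T ! k ! c = ent (cnt T k) c"
proof -
  have k: "k < length T" "c < length (T ! k)" using assms(2) by (auto simp: rlen_nth split: if_splits)
  then have "sorted (T ! k)" using assms(1) by (auto simp: sorted_rows_def)
  then have "c < cnt T k i \<longleftrightarrow> T ! k ! c \<le> i" for i
    using k by (simp add: cnt_nth count_le_less_iff)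
  then show ?thesis unfolding ent_def by (auto intro: Least_equality[symmetric])
qed

text \<open>In a partition shape the rows that reach column \<open>c\<close> form an initial
  segment, so the filter in \<open>nth_transpose\<close> does not shift the row numbers.\<close>

lemma filter_length_rows:
  assumes "\<And>k. rlen T (Suc k) \<le> rlen T k"
  shows "k < length (filter (\<lambda>r. c < length r) T) \<longleftrightarrow> c < rlen T k"
    and "k < length (filter (\<lambda>r. c < length r) T) \<Longrightarrow> filter (\<lambda>r. c < length r) T ! k = T ! k"
proof -
  have "(k < length (filter (\<lambda>r. c < length r) T) \<longleftrightarrow> c < rlen T k) \<and>
     (k < length (filter (\<lambda>r. c < length r) T) \<longrightarrow> filter (\<lambda>r. c < length r) T ! k = T ! k)"
    using assms
  proof (induction T arbitrary: k)
    case (Cons r rs)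
    have d: "rlen rs (Suc k) \<le> rlen rs k" for k using Cons.prems[of "Suc k"] by simp
    show ?case
    proof (cases "c < length r")
      case True
      then show ?thesis using Cons.IH[OF d] by (cases k) auto
    next
      case False
      have "rlen (r # rs) k \<le> rlen (r # rs) 0" for k
        by (rule lift_Suc_antimono_le[of "rlen (r # rs)"]) (use Cons.prems in auto)
      then have le: "rlen (r # rs) k \<le> c" for k using False by (metis not_less order_trans rlen.simps(2))
      have "rlen rs k \<le> c" for k using le[of "Suc k"] by simp
      then have "length (filter (\<lambda>r. c < length r) rs) = 0"
        using Cons.IH[OF d, of 0] by (metis gr0I leD)
      then show ?thesis using le[of k] False by simp
    qed
  qed simp
  then show "k < length (filter (\<lambda>r. c < length r) T) \<longleftrightarrow> c < rlen T k"
    "k < length (filter (\<lambda>r. c < length r) T) \<Longrightarrow> filter (\<lambda>r. c < length r) T ! k = T ! k" by auto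
qed

lemma transpose_rows:
  assumes "\<And>k. rlen T (Suc k) \<le> rlen T k" "sorted_rows T"
  shows "length (List.transpose T) = rlen T 0"
    and "c < rlen T 0 \<Longrightarrow> List.transpose T ! c = map (\<lambda>k. ent (cnt T k) c) [0..<hgt (rlen T) c]"
proof -
  have *: "foldr (\<lambda>xs. max (length xs)) T 0 = rlen T 0" if "\<And>k. rlen T (Suc k) \<le> rlen T k" for T :: tableau
    using that
  proof (induction T)
    case (Cons r rs)
    have "foldr (\<lambda>xs. max (length xs)) rs 0 = rlen rs 0" using Cons.prems[of "Suc _"] by (intro Cons.IH) simp
    then show ?case using Cons.prems[of 0] by simp
  qed simp
  show l: "length (List.transpose T) = rlen T 0" using * assms(1) by (simp add: length_transpose)
  let ?F = "filter (\<lambda>r. c < length r) T"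
  assume "c < rlen T 0"
  then have "List.transpose T ! c = map (\<lambda>r. r ! c) ?F"
    by (simp add: nth_transpose l)
  moreover have "hgt (rlen T) c = length ?F" unfolding hgt_def
    by (rule Least_equality) (use filter_length_rows(1)[OF assms(1), of _ c] in \<open>auto simp: not_le[symmetric]\<close>)
  moreover have "map (\<lambda>r. r ! c) ?F = map (\<lambda>k. ent (cnt T k) c) [0..<length ?F]"
    by (rule nth_equalityI)
      (simp_all add: nth_ent[OF assms(2)] filter_length_rows(1)[OF assms(1)] filter_length_rows(2)[OF assms(1)])
  ultimately show "List.transpose T ! c = map (\<lambda>k. ent (cnt T k) c) [0..<hgt (rlen T) c]" by simp
qed

section \<open>Insertion of a whole column and of a whole matrix\<close>

lemma trop_zero: "x 0 = 0 \<Longrightarrow> mono x \<Longrightarrow> trop x (\<lambda>_. 0) i = x i"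
  by (induction i) (auto simp: max_absorb2 monoD)

lemma bump_zero: "x 0 = 0 \<Longrightarrow> mono x \<Longrightarrow> bump x (\<lambda>_. 0) = (\<lambda>_. 0)"
proof
  fix i assume "x 0 = 0" "mono x"
  then show "bump x (\<lambda>_. 0) i = 0" by (cases i) (auto simp: trop_zero min_def)
qed

lemma carry_zero: "(\<And>k. x k 0 = 0) \<Longrightarrow> (\<And>k. mono (x k)) \<Longrightarrow> carry x (\<lambda>_. 0) k = (\<lambda>_. 0)"
  by (induction k) (simp_all add: bump_zero)

text \<open>The starting state of the local rules is the tableau before the column, and the word is
  the part of the column read so far; as its letters arrive in weakly increasing order,
  \<open>row_insert_cnt\<close> applies to each. All new boxes of \<open>Q\<close> carry the label
  \<open>q\<close>, so its counts below \<open>q\<close> survive.\<close>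

lemma insert_column:
  assumes P: "sorted_rows P" "sorted_rows Q" "rlen Q = rlen P"
    "\<Union>(set ` set P) \<subseteq> {1..m}" "\<Union>(set ` set Q) \<subseteq> {1..q}" "1 \<le> q"
    and w: "sorted w" "set w \<subseteq> {1..m}"
  shows "case foldl insert_biletter (P, Q) (map (\<lambda>p. (p, q)) w) of (P', Q') \<Rightarrow>
    sorted_rows P' \<and> sorted_rows Q' \<and> rlen Q' = rlen P' \<and>
    \<Union>(set ` set P') \<subseteq> {1..m} \<and> \<Union>(set ` set Q') \<subseteq> {1..q} \<and>
    (\<forall>k i. cnt P' k i = trop (cnt P k) (carry (cnt P) (count_list w) k) i) \<and>
    (\<forall>k. \<forall>i<q. cnt Q' k i = cnt Q k i)"
  using w
proof (induction w rule: rev_induct)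
  case Nil
  have "count_list [] = (\<lambda>_. 0 :: nat)" by auto
  moreover have "trop (cnt P k) (carry (cnt P) (\<lambda>_. 0) k) i = cnt P k i" for k i
    using carry_zero[of "cnt P"] cnt_0[OF P(4)] cnt_mono by (simp add: trop_zero)
  ultimately show ?case using P by simp
next
  case (snoc p w)
  obtain P' Q' where PQ: "foldl insert_biletter (P, Q) (map (\<lambda>p. (p, q)) w) = (P', Q')" by fastforce
  have w: "sorted w" "set w \<subseteq> {1..m}" "\<forall>y\<in>set w. y \<le> p" "p \<in> {1..m}" using snoc.prems by (auto simp: sorted_append)
  note IH = snoc.IH[OF w(1,2), unfolded PQ prod.case]
  have c: "count_list (w @ [p]) = (count_list w)(p := Suc (count_list w p))" by auto
  have "sorted_rows (row_insert P' p) \<and>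
    (\<forall>k i. cnt (row_insert P' p) k i = trop (cnt P k) (carry (cnt P) ((count_list w)(p := Suc (count_list w p))) k) i)"
  proof (rule row_insert_cnt)
    show "\<forall>i>p. count_list w i = 0"
    proof (intro allI impI)
      fix i assume "p < i"
      then have "i \<notin> set w" using w(3) leD by blast
      then show "count_list w i = 0" by simp
    qed
    show "sorted_rows P'" using IH by blast
    show "cnt P' k i = trop (cnt P k) (carry (cnt P) (count_list w) k) i" for k i using IH by blast
    show "cnt P k 0 = 0" for k using P(4) by (rule cnt_0)
    show "mono (cnt P k)" for k by (rule cnt_mono)
    show "1 \<le> p" using w(4) by simp
  qed
  note ri = this[folded c]
  have IH': "sorted_rows Q'" "rlen Q' = rlen P'" "\<Union>(set ` set P') \<subseteq> {1..m}" "\<Union>(set ` set Q') \<subseteq> {1..q}"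
    "\<forall>k. \<forall>i<q. cnt Q' k i = cnt Q k i"
    using IH by - (elim conjE, assumption)+
  have e: "\<Union>(set ` set (row_insert P' p)) \<subseteq> {1..m}"
    by (rule order_trans[OF row_insert_entries]) (use w(4) IH'(3) in simp)
  obtain K where K: "\<And>k. rlen (row_insert P' p) k = rlen P' k + of_bool (k = K)"
    using row_insert_rlen[of P' p] by blast
  have "sorted_rows (add_box (row_insert P' p) Q' q) \<and> rlen (add_box (row_insert P' p) Q' q) = rlen (row_insert P' p) \<and>
    \<Union>(set ` set (add_box (row_insert P' p) Q' q)) \<subseteq> {1..q} \<and>
    (\<forall>k. \<forall>i<q. cnt (add_box (row_insert P' p) Q' q) k i = cnt Q' k i)"
    by (rule add_box[of _ _ K]) (use ri IH' P(6) K in simp_all)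
  moreover have "foldl insert_biletter (P, Q) (map (\<lambda>p. (p, q)) (w @ [p])) =
      (row_insert P' p, add_box (row_insert P' p) Q' q)"
    by (simp add: PQ) (simp add: insert_biletter_def Let_def)
  ultimately show ?case using ri e IH'(5) by (simp del: map_append count_list_append)
qed

definition col_word :: "nat \<Rightarrow> exponent \<Rightarrow> nat \<Rightarrow> nat list" where
  "col_word m \<alpha> j = concat (map (\<lambda>i. replicate (Poly_Mapping.lookup \<alpha> (i, j)) i) [1..<m + 1])"

lemma col_word: "sorted (col_word m \<alpha> j)" "set (col_word m \<alpha> j) \<subseteq> {1..m}"
  "count_list (col_word m \<alpha> j) i = (if i \<in> {1..m} then Poly_Mapping.lookup \<alpha> (i, j) else 0)"
proof -
  have r: "count_list (replicate l x) i = (if x = i then l else 0)" for l and x i :: nat by (induction l) auto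
  have "sorted (col_word m \<alpha> j) \<and> set (col_word m \<alpha> j) \<subseteq> {1..m} \<and>
    count_list (col_word m \<alpha> j) i = (if i \<in> {1..m} then Poly_Mapping.lookup \<alpha> (i, j) else 0)"
    by (induction m) (auto simp: col_word_def sorted_append r split: if_splits)
  then show "sorted (col_word m \<alpha> j)" "set (col_word m \<alpha> j) \<subseteq> {1..m}"
  "count_list (col_word m \<alpha> j) i = (if i \<in> {1..m} then Poly_Mapping.lookup \<alpha> (i, j) else 0)" by auto
qed

abbreviation entry :: "exponent \<Rightarrow> nat \<Rightarrow> nat \<Rightarrow> nat" where
  "entry \<alpha> i j \<equiv> Poly_Mapping.lookup \<alpha> (i, j)"

lemma entry_outside: "\<alpha> \<in> nat_matrices m n \<Longrightarrow> \<not> (i \<in> {1..m} \<and> j \<in> {1..n}) \<Longrightarrow> entry \<alpha> i j = 0"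
  by (auto simp: nat_matrices_def in_keys_iff subset_iff)

text \<open>The counts of \<open>Q\<close> need no analysis of bumping: its boxes with labels up to
  \<open>j\<close> form the shape reached after \<open>j\<close> columns, which is the shape of
  \<open>P\<close> at that moment, and later columns leave these boxes alone. The \<open>min\<close>
  expresses that the counts are constant beyond the last column.\<close>

lemma rsk_cnt:
  assumes "\<alpha> \<in> nat_matrices m n"
  shows "case rsk m n \<alpha> of (P, Q) \<Rightarrow> sorted_rows P \<and> sorted_rows Q \<and> rlen Q = rlen P \<and>
    (\<forall>k. rlen P k = lam (entry \<alpha>) k m n) \<and>
    (\<forall>k i. cnt P k i = lam (entry \<alpha>) k i n) \<and> (\<forall>k j. cnt Q k j = lam (entry \<alpha>) k m (min j n))"
proof -
  let ?S = "\<lambda>j. foldl insert_biletter ([], []) (concat (map (\<lambda>j. map (\<lambda>p. (p, j)) (col_word m \<alpha> j)) [1..<j + 1]))"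
  have inv: "case ?S j of (P, Q) \<Rightarrow> sorted_rows P \<and> sorted_rows Q \<and> rlen Q = rlen P \<and>
    \<Union>(set ` set P) \<subseteq> {1..m} \<and> \<Union>(set ` set Q) \<subseteq> {1..j} \<and>
    (\<forall>k i. cnt P k i = lam (entry \<alpha>) k i j) \<and> (\<forall>k i. cnt Q k i = lam (entry \<alpha>) k m (min i j))" for j
  proof (induction j)
    case (Suc j)
    obtain P Q where PQ: "?S j = (P, Q)" by fastforce
    note IH = Suc.IH[unfolded PQ prod.case]
    obtain P' Q' where PQ': "?S (Suc j) = (P', Q')" by fastforce
    have S: "(P', Q') = foldl insert_biletter (P, Q) (map (\<lambda>p. (p, Suc j)) (col_word m \<alpha> (Suc j)))"
      using PQ PQ' by simp
    have c: "count_list (col_word m \<alpha> (Suc j)) = (\<lambda>i. entry \<alpha> i (Suc j))"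
    proof
      fix i show "count_list (col_word m \<alpha> (Suc j)) i = entry \<alpha> i (Suc j)"
        using entry_outside[OF assms, of i "Suc j"] by (simp add: col_word(3) del: atLeastAtMost_iff)
    qed
    have "\<Union>(set ` set Q) \<subseteq> {1..Suc j}" using IH by fastforce
    then have ic: "sorted_rows P' \<and> sorted_rows Q' \<and> rlen Q' = rlen P' \<and>
      \<Union>(set ` set P') \<subseteq> {1..m} \<and> \<Union>(set ` set Q') \<subseteq> {1..Suc j} \<and>
      (\<forall>k i. cnt P' k i = trop (cnt P k) (carry (cnt P) (\<lambda>i. entry \<alpha> i (Suc j)) k) i) \<and>
      (\<forall>k. \<forall>i<Suc j. cnt Q' k i = cnt Q k i)"
      using insert_column[of P Q m "Suc j" "col_word m \<alpha> (Suc j)", folded S, unfolded c prod.case] IH col_word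
      by auto
    have "cnt P = growth (entry \<alpha>) j" using IH by (intro ext) (auto simp: lam_def)
    then have cP: "cnt P' k i = lam (entry \<alpha>) k i (Suc j)" for k i
      using ic by (simp add: lam_def)
    have "cnt Q' k i = lam (entry \<alpha>) k m (min i (Suc j))" for k i
    proof (cases "i < Suc j")
      case True
      then show ?thesis using ic IH by simp
    next
      case False
      have "cnt Q' k i = rlen Q' k" using ic False by (intro cnt_max[of _ "Suc j"]) auto
      also have "\<dots> = cnt P' k m" using cnt_max[of P' m m k] ic by simp
      finally show ?thesis using False by (simp add: cP)
    qed
    then show ?case using PQ' ic cP by simp
  qed simp
  have "biletters m n \<alpha> = concat (map (\<lambda>j. map (\<lambda>p. (p, j)) (col_word m \<alpha> j)) [1..<n + 1])"
    by (simp add: biletters_def col_word_def map_concat comp_def)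
  then have "rsk m n \<alpha> = ?S n" by (simp only: rsk_def)
  moreover obtain P Q where PQ: "?S n = (P, Q)" by fastforce
  moreover have "rlen P k = lam (entry \<alpha>) k m n" for k
    using inv[of n, unfolded PQ prod.case] cnt_max[of P m m k] by simp
  ultimately show ?thesis using inv[of n] by simp
qed

lemma ent_cong: "c < g n \<Longrightarrow> (\<And>i. i \<le> n \<Longrightarrow> g i = g' i) \<Longrightarrow> ent g c = ent g' c"
proof -
  assume *: "c < g n" "\<And>i. i \<le> n \<Longrightarrow> g i = g' i"
  have "ent g c \<le> n" unfolding ent_def using *(1) by (rule Least_le)
  moreover have "c < g (ent g c)" unfolding ent_def using *(1) by (rule LeastI)
  ultimately have 1: "c < g' (ent g c)" using *(2) by simp
  have "ent g' c = ent g c" unfolding ent_def[of g' c]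
  proof (rule Least_equality)
    fix y assume "c < g' y"
    then show "ent g c \<le> y" using \<open>ent g c \<le> n\<close> *(2)[of y] unfolding ent_def[of g]
      by (cases "y \<le> n") (auto intro: Least_le)
  qed (rule 1)
  then show ?thesis ..
qed

lemma less_hgt: "k < hgt g c \<Longrightarrow> c < g k"
  unfolding hgt_def using not_less_Least not_le by blast

text \<open>The bridge from the algorithm to the counts: all later statements about bitableaux
  concern \<open>bidet\<close>, which sees RSK through \<open>lam\<close> alone.\<close>

theorem bitableau_rsk:
  assumes "\<alpha> \<in> nat_matrices m n"
  shows "(case rsk m n \<alpha> of (P, Q) \<Rightarrow> bitableau P Q) = bidet var (entry \<alpha>) m n"
proof -
  obtain P Q where PQ: "rsk m n \<alpha> = (P, Q)" by fastforce
  let ?l = "lam (entry \<alpha>)"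
  note r = rsk_cnt[OF assms, unfolded PQ prod.case]
  have rP: "rlen P = (\<lambda>k. ?l k m n)" using r by auto
  have d: "rlen P (Suc k) \<le> rlen P k" "rlen Q (Suc k) \<le> rlen Q k" for k
    using r by (auto intro: lam_antimono)
  have cP: "cnt P k = (\<lambda>i. ?l k i n)" "cnt Q k = (\<lambda>j. ?l k m (min j n))" for k
    using r by auto
  have "minor (List.transpose P ! c) (List.transpose Q ! c) = col_det var (entry \<alpha>) m n c" if "c < ?l 0 m n" for c
  proof -
    have "ent (\<lambda>j. ?l k m (min j n)) c = ent (\<lambda>j. ?l k m j) c" if "k < hgt (\<lambda>k. ?l k m n) c" for k
      by (rule ent_cong[of _ _ n]) (use less_hgt[OF that] in auto)
    then show ?thesis
      using transpose_rows(2)[of P c] transpose_rows(2)[of Q c] d r that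
      by (auto simp: minor_def col_det_def cP rP Let_def intro!: arg_cong[of _ _ det] eq_matI)
  qed
  moreover have "map2 minor (List.transpose P) (List.transpose Q) =
      map (\<lambda>c. minor (List.transpose P ! c) (List.transpose Q ! c)) [0..<?l 0 m n]"
    using transpose_rows(1)[of P] transpose_rows(1)[of Q] d r by (intro nth_equalityI) auto
  ultimately show ?thesis unfolding PQ prod.case bitableau_def bidet_def
    by (simp add: prod.list_conv_set_nth atLeast0LessThan)
qed

section \<open>Bitableaux of related matrices\<close>

text \<open>Transposition exchanges the two tableaux, and a minor equals the corresponding minor of
  the transposed matrix.\<close>

lemma bidet_flip: "bidet v (\<lambda>i j. a j i) n m = bidet (\<lambda>i j. v j i) a m n"
proof -
  have "col_det v (\<lambda>i j. a j i) n m c = col_det (\<lambda>i j. v j i) a m n c" for c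
  proof -
    let ?h = "hgt (\<lambda>k. lam a k m n) c"
    let ?M = "mat ?h ?h (\<lambda>(s, t). v (ent (\<lambda>j. lam a t m j) c) (ent (\<lambda>i. lam a s i n) c))"
    have "det (transpose_mat ?M) = det ?M" by (rule det_transpose[of _ ?h]) simp
    moreover have "transpose_mat ?M = mat ?h ?h (\<lambda>(s, t). v (ent (\<lambda>j. lam a s m j) c) (ent (\<lambda>i. lam a t i n) c))"
      by (rule eq_matI) auto
    ultimately show ?thesis by (simp add: col_det_def Let_def lam_flip[of a])
  qed
  then show ?thesis by (simp add: bidet_def lam_flip[of a])
qed

lemma ent_eqI: "c < g e \<Longrightarrow> (\<And>i. i < e \<Longrightarrow> g i \<le> c) \<Longrightarrow> ent g c = e"
  unfolding ent_def by (rule Least_equality) (auto simp: not_less[symmetric])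

lemma ent_less: "c < g m \<Longrightarrow> c < g (ent g c)" "c < g m \<Longrightarrow> ent g c \<le> m" "i < ent g c \<Longrightarrow> g i \<le> c"
  unfolding ent_def by (auto intro: LeastI Least_le dest: not_less_Least)

lemma ent_insert_zero_row:
  assumes "1 \<le> p" "c < g m"
  shows "ent (\<lambda>i. g (if i < p then i else i - 1)) c = (if ent g c < p then ent g c else Suc (ent g c))"
  using ent_less(1,2)[of c g m, OF assms(2)] ent_less(3)[of _ g c] assms(1)
  by (intro ent_eqI) (auto split: if_splits)

text \<open>A zero row changes no shape. It only renames the entries from \<open>p\<close> on in the
  first tableau, and the renaming is absorbed into \<open>v\<close>.\<close>

lemma bidet_insert_zero_row:
  assumes p: "1 \<le> p" "p \<le> Suc m"
  shows "bidet v (\<lambda>i j. if i < p then a i j else if i = p then 0 else a (i - 1) j) (Suc m) n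
    = bidet (\<lambda>i j. v (if i < p then i else Suc i) j) a m n"
proof -
  let ?a = "\<lambda>i j. if i < p then a i j else if i = p then 0 else a (i - 1) j"
  have l: "lam ?a k i j = lam a k (if i < p then i else i - 1) j" for k i j
    by (rule lam_insert_zero_row[OF refl p(1)])
  have lm: "lam ?a k (Suc m) j = lam a k m j" for k j using p unfolding l by auto
  have "col_det v ?a (Suc m) n c = col_det (\<lambda>i j. v (if i < p then i else Suc i) j) a m n c" for c
  proof -
    have "ent (\<lambda>i. lam a s (if i < p then i else i - 1) n) c =
        (if ent (\<lambda>i. lam a s i n) c < p then ent (\<lambda>i. lam a s i n) c else Suc (ent (\<lambda>i. lam a s i n) c))"
      if "s < hgt (\<lambda>k. lam a k m n) c" for s
      using ent_insert_zero_row[OF p(1), of c "\<lambda>i. lam a s i n" m] less_hgt[OF that] by simp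
    then show ?thesis unfolding col_det_def Let_def lm unfolding l
      by (intro arg_cong[of _ _ det] eq_matI) simp_all
  qed
  then show ?thesis by (simp only: bidet_def lm)
qed

section \<open>Raising a dominant entry\<close>

lemma prod_insert_factor:
  fixes f :: "nat \<Rightarrow> 'a::comm_monoid_mult"
  assumes "c \<le> N" "\<And>i. i < c \<Longrightarrow> f' i = f i" "\<And>i. c \<le> i \<Longrightarrow> i < N \<Longrightarrow> f' (Suc i) = f i"
  shows "(\<Prod>i<Suc N. f' i) = f' c * (\<Prod>i<N. f i)"
  using assms(1,3)
proof (induction N rule: dec_induct)
  case base
  then show ?case using assms(2) by (simp add: mult.commute)
next
  case (step N)
  have "(\<Prod>i<Suc (Suc N). f' i) = (\<Prod>i<Suc N. f' i) * f' (Suc N)" by (rule prod.lessThan_Suc)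
  then show ?case using step by (simp add: mult.assoc)
qed

text \<open>Raising the counts from \<open>k\<close> on inserts one entry \<open>k\<close> into a
  row. Any position between \<open>g (k - 1)\<close> and \<open>g k\<close> can be regarded as its
  place, because the entries \<open>k\<close> form a block there; this freedom later allows the same
  column to be chosen in both tableaux.\<close>

lemma ent_shift:
  assumes "mono g" "1 \<le> k" "k \<le> m" "g (k - 1) \<le> c0" "c0 \<le> g k"
    "\<And>i. i \<le> m \<Longrightarrow> g' i = g i + of_bool (k \<le> i)"
  shows "c < c0 \<Longrightarrow> ent g' c = ent g c" "ent g' c0 = k"
    "c0 \<le> c \<Longrightarrow> c < g m \<Longrightarrow> ent g' (Suc c) = ent g c"
proof -
  have mg: "i \<le> j \<Longrightarrow> g i \<le> g j" for i j using assms(1) by (rule monoD)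
  have up: "g' i \<le> Suc (g i)" if "i \<le> m" for i using assms(6)[of i] that by simp
  show "ent g' c = ent g c" if "c < c0"
  proof (rule ent_eqI)
    have c: "c < g m" using that assms(5) mg[OF assms(3)] by linarith
    note e = ent_less(1,2)[of c g m, OF c] ent_less(3)[of _ g c]
    show "c < g' (ent g c)" using e assms(6)[of "ent g c"] by simp
    fix i assume i: "i < ent g c"
    then have "\<not> k \<le> i" using e(3)[of i] mg[of k i] assms(5) that by linarith
    then show "g' i \<le> c" using i e assms(6)[of i] by simp
  qed
  show "ent g' c0 = k"
  proof (rule ent_eqI)
    show "c0 < g' k" using assms by simp
    fix i assume "i < k"
    then show "g' i \<le> c0" using order_trans[OF mg[of i "k - 1"] assms(4)] assms(3) assms(6)[of i] by simp
  qed
  show "ent g' (Suc c) = ent g c" if "c0 \<le> c" "c < g m"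
  proof (rule ent_eqI)
    note e = ent_less(1,2)[of c g m, OF that(2)] ent_less(3)[of _ g c]
    have "k \<le> ent g c" using e(1) that(1) assms(4) mg[of "ent g c" "k - 1"] by linarith
    then show "Suc c < g' (ent g c)" using e assms(6)[of "ent g c"] by simp
    fix i assume "i < ent g c"
    then show "g' i \<le> Suc c" using e(2) e(3)[of i] up[of i] by simp
  qed
qed

lemma col_det_1: "hgt (\<lambda>k. lam a k m n) c = 1 \<Longrightarrow>
  col_det v a m n c = v (ent (\<lambda>i. lam a 0 i n) c) (ent (\<lambda>j. lam a 0 m j) c)"
  by (simp add: col_det_def det_single)

lemma lam_le_sum: "lam a 0 i j \<le> (\<Sum>i'\<in>{1..i}. \<Sum>j'\<in>{1..j}. a i' j')"
  "lam a 0 i j + lam a 1 i j \<le> (\<Sum>i'\<in>{1..i}. \<Sum>j'\<in>{1..j}. a i' j')"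
proof -
  have "(\<Sum>k<Suc (Suc i). lam a k i j) = (\<Sum>i'\<in>{1..i}. \<Sum>j'\<in>{1..j}. a i' j')" by (rule lam_sum) simp
  then show "lam a 0 i j \<le> (\<Sum>i'\<in>{1..i}. \<Sum>j'\<in>{1..j}. a i' j')"
   "lam a 0 i j + lam a 1 i j \<le> (\<Sum>i'\<in>{1..i}. \<Sum>j'\<in>{1..j}. a i' j')"
    by (simp_all add: sum.lessThan_Suc_shift del: sum.lessThan_Suc)
qed

text \<open>The first row is at least as long as the weight of any lattice path (last passage
  percolation). Vertical segments, and horizontal ones by \<open>lam_flip\<close>, are all that is
  needed.\<close>

lemma lam_down: "i \<le> i' \<Longrightarrow> 1 \<le> j \<Longrightarrow> lam a 0 i j + (\<Sum>x\<in>{i<..i'}. a x j) \<le> lam a 0 i' j"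
proof (induction rule: dec_induct)
  case (step i')
  have "{i<..Suc i'} = insert (Suc i') {i<..i'}" using step by auto
  moreover have "lam a 0 (Suc i') j \<ge> lam a 0 i' j + a (Suc i') j"
    using step.prems by (cases j) (auto simp: lam_first)
  ultimately show ?case using step by simp
qed simp

lemma lam_right: "j \<le> j' \<Longrightarrow> 1 \<le> i \<Longrightarrow> lam a 0 i j + (\<Sum>y\<in>{j<..j'}. a i y) \<le> lam a 0 i j'"
  using lam_down[of j j' i "\<lambda>i j. a j i"] by (simp add: lam_flip[of a])

text \<open>The entry plus the total equals the row sum plus the column sum plus the sum outside
  both lines. Hence dominance means that the sums of row \<open>k\<close> and column
  \<open>l\<close> together reach the total.\<close>

definition dominant :: "(nat \<Rightarrow> nat \<Rightarrow> nat) \<Rightarrow> nat \<Rightarrow> nat \<Rightarrow> nat \<Rightarrow> nat \<Rightarrow> bool" where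
  "dominant a m n k l \<longleftrightarrow> k \<in> {1..m} \<and> l \<in> {1..n} \<and>
     (\<Sum>i\<in>{1..m} - {k}. \<Sum>j\<in>{1..n} - {l}. a i j) \<le> a k l"

lemma dominant_flip: "dominant (\<lambda>i j. a j i) n m l k \<longleftrightarrow> dominant a m n k l"
proof -
  have "(\<Sum>i\<in>{1..n} - {l}. \<Sum>j\<in>{1..m} - {k}. a j i) = (\<Sum>i\<in>{1..m} - {k}. \<Sum>j\<in>{1..n} - {l}. a i j)"
    by (rule sum.swap)
  then show ?thesis unfolding dominant_def by auto
qed

text \<open>In the rows above \<open>k\<close>, the part outside column \<open>l\<close> weighs at
  most \<open>a k l\<close>. Trading it for \<open>a k l\<close> leaves the weight of the vertical
  path down column \<open>l\<close> to \<open>(k, l)\<close>.\<close>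

lemma dominant_lam1:
  assumes "dominant a m n k l"
  shows "lam a 0 (k - 1) n \<le> lam a 0 k l"
proof -
  have kl: "1 \<le> k" "k \<le> m" "1 \<le> l" "l \<le> n" using assms by (auto simp: dominant_def)
  have split: "(\<Sum>j\<in>{1..n}. a i j) = a i l + (\<Sum>j\<in>{1..n} - {l}. a i j)" for i
    using kl by (simp add: sum.remove)
  have "lam a 0 (k - 1) n \<le> (\<Sum>i\<in>{1..k - 1}. \<Sum>j\<in>{1..n}. a i j)" by (rule lam_le_sum)
  also have "\<dots> = (\<Sum>i\<in>{1..k - 1}. a i l) + (\<Sum>i\<in>{1..k - 1}. \<Sum>j\<in>{1..n} - {l}. a i j)"
    by (simp only: split sum.distrib)
  also have "(\<Sum>i\<in>{1..k - 1}. \<Sum>j\<in>{1..n} - {l}. a i j) \<le> (\<Sum>i\<in>{1..m} - {k}. \<Sum>j\<in>{1..n} - {l}. a i j)"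
    using kl by (intro sum_mono2) auto
  also have "\<dots> \<le> a k l" using assms by (simp add: dominant_def)
  also have "(\<Sum>i\<in>{1..k - 1}. a i l) + a k l = (\<Sum>i\<in>{0<..k}. a i l)"
  proof -
    have "{0<..k} = insert k {1..k - 1}" using kl by auto
    then show ?thesis using kl by simp
  qed
  also have "\<dots> \<le> lam a 0 k l" using lam_down[of 0 k l a] kl by simp
  finally show ?thesis by simp
qed

text \<open>The path along row \<open>k\<close> to \<open>(k, l)\<close> and then down column
  \<open>l\<close> bounds the first row from below, so the second row is at most the remaining
  weight. After the part outside is traded for \<open>a k l\<close>, the remainder is the weight of
  the path down column \<open>l\<close> to \<open>(k, l)\<close> and then along row
  \<open>k\<close>.\<close>

lemma dominant_lam2:
  assumes "dominant a m n k l"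
  shows "lam a 1 m n \<le> lam a 0 k n"
proof -
  have kl: "1 \<le> k" "k \<le> m" "1 \<le> l" "l \<le> n" using assms by (auto simp: dominant_def)
  let ?R = "\<Sum>i\<in>{1..m} - {k}. \<Sum>j\<in>{1..n} - {l}. a i j"
  have split: "(\<Sum>j\<in>{1..n}. f j) = f l + (\<Sum>j\<in>{1..n} - {l}. f j)" for f :: "nat \<Rightarrow> nat"
    using kl by (simp add: sum.remove)
  have s2: "{1..m} - {k} = {0<..k - 1} \<union> {k<..m}" "{1..n} = {0<..l} \<union> {l<..n}" using kl by auto
  have "(\<Sum>i\<in>{1..m}. \<Sum>j\<in>{1..n}. a i j) = (\<Sum>j\<in>{1..n}. a k j) + (\<Sum>i\<in>{1..m} - {k}. a i l + (\<Sum>j\<in>{1..n} - {l}. a i j))"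
    using kl by (subst sum.remove[of _ k]) (simp_all only: split finite_atLeastAtMost atLeastAtMost_iff)
  also have "\<dots> = (\<Sum>j\<in>{1..n}. a k j) + (\<Sum>i\<in>{1..m} - {k}. a i l) + ?R"
    by (simp add: sum.distrib)
  also have "(\<Sum>i\<in>{1..m} - {k}. a i l) = (\<Sum>i\<in>{0<..k - 1}. a i l) + (\<Sum>i\<in>{k<..m}. a i l)"
    unfolding s2 by (rule sum.union_disjoint) auto
  also have "(\<Sum>j\<in>{1..n}. a k j) = (\<Sum>j\<in>{0<..l}. a k j) + (\<Sum>j\<in>{l<..n}. a k j)"
    unfolding s2 by (rule sum.union_disjoint) auto
  finally have total: "(\<Sum>i\<in>{1..m}. \<Sum>j\<in>{1..n}. a i j) = (\<Sum>j\<in>{0<..l}. a k j) + (\<Sum>j\<in>{l<..n}. a k j)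
    + ((\<Sum>i\<in>{0<..k - 1}. a i l) + (\<Sum>i\<in>{k<..m}. a i l)) + ?R" .
  have "(\<Sum>j\<in>{0<..l}. a k j) + (\<Sum>i\<in>{k<..m}. a i l) \<le> lam a 0 m n"
    using lam_right[of 0 l k a] lam_down[of k m l a] lam_mono[of m m l n a 0] kl by simp
  moreover have "{0<..k} = insert k {0<..k - 1}" using kl by auto
  then have "(\<Sum>i\<in>{0<..k - 1}. a i l) + a k l + (\<Sum>j\<in>{l<..n}. a k j) \<le> lam a 0 k n"
    using lam_down[of 0 k l a] lam_right[of l n k a] kl by simp
  moreover have "?R \<le> a k l" using assms by (simp add: dominant_def)
  ultimately show ?thesis using lam_le_sum(2)[where a = a and i = m and j = n] total by linarith
qed

text \<open>The increment fills the quadrant of \<open>(k, l)\<close> in row 0 and goes nowhere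
  else. Inside the quadrant all three neighbours are raised together. On its edge only one is
  raised, and by \<open>le1\<close> and \<open>le2\<close> it is at least as large as the other: the
  max passes the increment on, and the min, which feeds the next row, does not see it.\<close>

lemma lam_add_dominant:
  assumes d: "dominant a m n k l" and a': "\<And>i j. a' i j = a i j + of_bool (i = k \<and> j = l)"
  shows "i \<le> m \<Longrightarrow> j \<le> n \<Longrightarrow> lam a' r i j = lam a r i j + of_bool (r = 0 \<and> k \<le> i \<and> l \<le> j)"
proof -
  have kl: "1 \<le> k" "k \<le> m" "1 \<le> l" "l \<le> n" using assms by (auto simp: dominant_def)
  have le1: "lam a 0 i (Suc j) \<le> lam a 0 (Suc i) j" if "Suc i = k" "l \<le> j" "Suc j \<le> n" for i j
    using dominant_lam1[OF d] lam_mono[of i i "Suc j" n a 0] lam_mono[of k k l j a 0] that by auto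
  have "lam a 0 m (l - 1) \<le> lam a 0 k l"
    using dominant_lam1[OF dominant_flip[THEN iffD2, OF d]] by (simp add: lam_flip[of a])
  then have le2: "lam a 0 (Suc i) j \<le> lam a 0 i (Suc j)" if "Suc j = l" "k \<le> i" "Suc i \<le> m" for i j
    using lam_mono[of "Suc i" m j j a 0] lam_mono[of k i l l a 0] that by auto
  show "i \<le> m \<Longrightarrow> j \<le> n \<Longrightarrow> lam a' r i j = lam a r i j + of_bool (r = 0 \<and> k \<le> i \<and> l \<le> j)"
  proof (induction r arbitrary: i j)
    case 0
    then show ?case
    proof (induction i arbitrary: j)
      case (Suc i)
      note IH = this
      from IH(3) show ?case
      proof (induction j)
        case (Suc j)
        have x: "lam a' 0 i (Suc j) = lam a 0 i (Suc j) + of_bool (k \<le> i \<and> l \<le> Suc j)"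
          "lam a' 0 (Suc i) j = lam a 0 (Suc i) j + of_bool (k \<le> Suc i \<and> l \<le> j)"
          using IH(1)[of "Suc j"] IH(2) Suc by auto
        show ?case using le1[of i j] le2[of j i] IH(2) Suc.prems
          unfolding lam_first x a'[of "Suc i" "Suc j"] by (auto simp: le_Suc_eq max_def)
      qed (use kl in simp)
    qed (use kl in simp)
  next
    case (Suc r)
    note IHr = Suc.IH
    from Suc.prems show ?case
    proof (induction i arbitrary: j)
      case (Suc i)
      note IH = this
      from IH(3) show ?case
      proof (induction j)
        case (Suc j)
        have x: "lam a' (Suc r) i (Suc j) = lam a (Suc r) i (Suc j)"
          "lam a' (Suc r) (Suc i) j = lam a (Suc r) (Suc i) j"
          using IH(1)[of "Suc j"] IH(2) Suc by auto
        have y: "lam a' r i (Suc j) = lam a r i (Suc j) + of_bool (r = 0 \<and> k \<le> i \<and> l \<le> Suc j)"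
          "lam a' r (Suc i) j = lam a r (Suc i) j + of_bool (r = 0 \<and> k \<le> Suc i \<and> l \<le> j)"
          "lam a' r i j = lam a r i j + of_bool (r = 0 \<and> k \<le> i \<and> l \<le> j)"
          using IHr IH(2) Suc.prems by auto
        show ?case using le1[of i j] le2[of j i] IH(2) Suc.prems
          unfolding lam_Suc x y by (auto simp: le_Suc_eq min_def)
      qed simp
    qed simp
  qed
qed

lemma bidet_add_dominant:
  assumes d: "dominant a m n k l" and a': "\<And>i j. a' i j = a i j + of_bool (i = k \<and> j = l)"
  shows "bidet v a' m n = v k l * bidet v a m n"
proof -
  note L = lam_add_dominant[OF d a']
  have kl: "1 \<le> k" "k \<le> m" "1 \<le> l" "l \<le> n" using assms by (auto simp: dominant_def)
  have d': "dominant (\<lambda>i j. a j i) n m l k" using d by (rule dominant_flip[THEN iffD2])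
  have U: "lam a 0 (k - 1) n \<le> lam a 0 k l" "lam a 1 m n \<le> lam a 0 k n"
    "lam a 0 m (l - 1) \<le> lam a 0 k l" "lam a 1 m n \<le> lam a 0 m l"
    using dominant_lam1[OF d] dominant_lam2[OF d] dominant_lam1[OF d'] dominant_lam2[OF d']
    by (simp_all add: lam_flip[of a])
  \<comment> \<open>The least column at which \<open>k\<close> and \<open>l\<close> may both be
    inserted into the first rows with no second row underneath. By \<open>U\<close> it does not lie
    beyond the blocks of entries \<open>k\<close> and \<open>l\<close>.\<close>
  define c0 where "c0 = max (max (lam a 0 (k - 1) n) (lam a 0 m (l - 1))) (lam a 1 m n)"
  have M: "lam a 0 k l \<le> lam a 0 k n" "lam a 0 k l \<le> lam a 0 m l" "lam a 0 k n \<le> lam a 0 m n"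
    using kl by (auto intro: lam_mono)
  have c0: "lam a 0 (k - 1) n \<le> c0" "lam a 0 m (l - 1) \<le> c0" "lam a 1 m n \<le> c0"
    "c0 \<le> lam a 0 k n" "c0 \<le> lam a 0 m l" "c0 \<le> lam a 0 m n"
    using U M by (auto simp: c0_def)
  have mono: "mono (\<lambda>i. lam a 0 i n)" "mono (\<lambda>j. lam a 0 m j)"
    by (auto intro: monoI lam_mono)
  have gi: "lam a' 0 i n = lam a 0 i n + of_bool (k \<le> i)" if "i \<le> m" for i using L[of i n 0] that kl by simp
  have gj: "lam a' 0 m j = lam a 0 m j + of_bool (l \<le> j)" if "j \<le> n" for j using L[of m j 0] that kl by simp
  note row = ent_shift[where g' = "\<lambda>i. lam a' 0 i n", OF mono(1) kl(1,2) c0(1,4) gi]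
  note col = ent_shift[where g' = "\<lambda>j. lam a' 0 m j", OF mono(2) kl(3,4) c0(2,5) gj]
  have N: "lam a' 0 m n = Suc (lam a 0 m n)" using L[of m n 0] kl by simp
  have hi: "lam a' r m n = lam a r m n" if "r \<noteq> 0" for r using L[of m n r] that by simp
  have le1: "lam a r m n \<le> c0" if "r \<noteq> 0" for r
    using c0(3) lam_antimono[of 1 r a m n] that by simp
  have "(\<Prod>c<Suc (lam a 0 m n). col_det v a' m n c) = col_det v a' m n c0 * (\<Prod>c<lam a 0 m n. col_det v a m n c)"
  proof (rule prod_insert_factor[OF c0(6)])
    fix c assume c: "c < c0"
    have P: "(lam a' r m n \<le> c) = (lam a r m n \<le> c)" for r using c c0(6) N hi[of r] by (cases "r = 0") auto
    have h: "hgt (\<lambda>r. lam a' r m n) c = hgt (\<lambda>r. lam a r m n) c" unfolding hgt_def P ..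
    have e: "ent (\<lambda>i. lam a' s i n) c = ent (\<lambda>i. lam a s i n) c \<and> ent (\<lambda>j. lam a' s m j) c = ent (\<lambda>j. lam a s m j) c"
      if "s < hgt (\<lambda>r. lam a r m n) c" for s
    proof (cases "s = 0")
      case True
      then show ?thesis using row(1)[OF _ c] col(1)[OF _ c] by simp
    next
      case False
      have "c < lam a' s m n" using less_hgt[OF that] hi[OF False] by simp
      then have "ent (\<lambda>i. lam a' s i n) c = ent (\<lambda>i. lam a s i n) c"
        using L[of _ n s] False by (intro ent_cong[of c _ m]) auto
      moreover have "ent (\<lambda>j. lam a' s m j) c = ent (\<lambda>j. lam a s m j) c"
        using \<open>c < lam a' s m n\<close> L[of m _ s] False by (intro ent_cong[of c _ n]) auto
      ultimately show ?thesis ..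
    qed
    show "col_det v a' m n c = col_det v a m n c" unfolding col_det_def Let_def h
      by (intro arg_cong[of _ _ det] eq_matI) (auto simp: e)
  next
    \<comment> \<open>From \<open>c0\<close> on all columns have height one, so only the first rows
      matter, and these are shifted by one position.\<close>
    fix c assume c: "c0 \<le> c" "c < lam a 0 m n"
    have "hgt (\<lambda>r. lam a' r m n) (Suc c) = 1" unfolding hgt_def
      by (rule Least_equality) (use c N hi[of 1] c0(3) in \<open>auto simp: Suc_le_eq intro: ccontr\<close>)
    moreover have "hgt (\<lambda>r. lam a r m n) c = 1" unfolding hgt_def
      by (rule Least_equality) (use c c0(3) in \<open>auto simp: Suc_le_eq intro: ccontr\<close>)
    ultimately show "col_det v a' m n (Suc c) = col_det v a m n c"
      using row(3)[OF _ c] col(3)[OF _ c] by (simp add: col_det_1)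
  qed
  moreover have "hgt (\<lambda>r. lam a' r m n) c0 = 1" unfolding hgt_def
    by (rule Least_equality) (use c0(6) N hi[of 1] c0(3) in \<open>auto simp: Suc_le_eq intro: ccontr\<close>)
  then have "col_det v a' m n c0 = v k l" using row(2) col(2) by (simp add: col_det_1)
  ultimately show ?thesis by (simp add: bidet_def N)
qed

section \<open>Substitution and weights\<close>

definition msubst :: "(nat \<times> nat \<Rightarrow> ('c::comm_monoid_add \<Rightarrow>\<^sub>0 complex)) \<Rightarrow> exponent \<Rightarrow> ('c \<Rightarrow>\<^sub>0 complex)" where
  "msubst h \<alpha> = (\<Prod>x\<in>Poly_Mapping.keys \<alpha>. h x ^ Poly_Mapping.lookup \<alpha> x)"

definition psubst :: "(nat \<times> nat \<Rightarrow> ('c::comm_monoid_add \<Rightarrow>\<^sub>0 complex)) \<Rightarrow> cpoly \<Rightarrow> ('c \<Rightarrow>\<^sub>0 complex)" where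
  "psubst h f = (\<Sum>\<alpha>\<in>Poly_Mapping.keys f. Poly_Mapping.single 0 (Poly_Mapping.lookup f \<alpha>) * msubst h \<alpha>)"

lemma msubst_superset:
  "finite S \<Longrightarrow> Poly_Mapping.keys \<alpha> \<subseteq> S \<Longrightarrow> msubst h \<alpha> = (\<Prod>x\<in>S. h x ^ Poly_Mapping.lookup \<alpha> x)"
  unfolding msubst_def by (intro prod.mono_neutral_left) (auto simp: in_keys_iff)

lemma psubst_superset:
  "finite S \<Longrightarrow> Poly_Mapping.keys f \<subseteq> S \<Longrightarrow>
    psubst h f = (\<Sum>\<alpha>\<in>S. Poly_Mapping.single 0 (Poly_Mapping.lookup f \<alpha>) * msubst h \<alpha>)"
  unfolding psubst_def by (intro sum.mono_neutral_left) (auto simp: in_keys_iff)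

lemma msubst_add: "msubst h (\<alpha> + \<beta>) = msubst h \<alpha> * msubst h \<beta>"
proof -
  let ?S = "Poly_Mapping.keys \<alpha> \<union> Poly_Mapping.keys \<beta>"
  have "Poly_Mapping.keys (\<alpha> + \<beta>) \<subseteq> ?S" by (rule Poly_Mapping.keys_add)
  then show ?thesis
    by (simp add: msubst_superset[of ?S] lookup_add power_add prod.distrib)
qed

lemma msubst_0 [simp]: "msubst h 0 = 1"
  by (simp add: msubst_def)

lemma psubst_add: "psubst h (f + g) = psubst h f + psubst h g"
proof -
  let ?S = "Poly_Mapping.keys f \<union> Poly_Mapping.keys g"
  have "Poly_Mapping.keys (f + g) \<subseteq> ?S" by (rule Poly_Mapping.keys_add)
  then show ?thesis
    by (simp add: psubst_superset[of ?S] lookup_add single_add distrib_right sum.distrib)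
qed

lemma psubst_0 [simp]: "psubst h 0 = 0"
  by (simp add: psubst_def)

lemma psubst_single: "psubst h (Poly_Mapping.single \<alpha> c) = Poly_Mapping.single 0 c * msubst h \<alpha>"
  by (simp add: psubst_def)

lemma psubst_sum: "psubst h (sum f A) = (\<Sum>a\<in>A. psubst h (f a))"
  by (induction A rule: infinite_finite_induct) (simp_all add: psubst_add)

lemma poly_mapping_sum_single:
  "f = (\<Sum>\<alpha>\<in>Poly_Mapping.keys f. Poly_Mapping.single \<alpha> (Poly_Mapping.lookup f \<alpha>))"
  by (rule poly_mapping_eqI) (simp add: lookup_sum lookup_single when_def in_keys_iff)

lemma psubst_mult: "psubst h (f * g) = psubst h f * psubst h g"
proof -
  have "psubst h (Poly_Mapping.single a c * Poly_Mapping.single b d) =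
      psubst h (Poly_Mapping.single a c) * psubst h (Poly_Mapping.single b d)" for a b c d
  proof -
    have "psubst h (Poly_Mapping.single a c * Poly_Mapping.single b d) =
        Poly_Mapping.single 0 (c * d) * (msubst h a * msubst h b)"
      by (simp add: mult_single psubst_single msubst_add)
    also have "Poly_Mapping.single 0 (c * d) = Poly_Mapping.single 0 c * Poly_Mapping.single 0 d"
      by (simp add: mult_single)
    finally show ?thesis by (simp only: psubst_single mult.assoc mult.left_commute)
  qed
  then have "psubst h ((\<Sum>\<alpha>\<in>Poly_Mapping.keys f. Poly_Mapping.single \<alpha> (Poly_Mapping.lookup f \<alpha>)) *
     (\<Sum>\<alpha>\<in>Poly_Mapping.keys g. Poly_Mapping.single \<alpha> (Poly_Mapping.lookup g \<alpha>))) =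
    psubst h (\<Sum>\<alpha>\<in>Poly_Mapping.keys f. Poly_Mapping.single \<alpha> (Poly_Mapping.lookup f \<alpha>)) *
    psubst h (\<Sum>\<alpha>\<in>Poly_Mapping.keys g. Poly_Mapping.single \<alpha> (Poly_Mapping.lookup g \<alpha>))"
    by (simp add: sum_product psubst_sum)
  then show ?thesis by (simp flip: poly_mapping_sum_single)
qed

lemma psubst_1: "psubst h 1 = 1"
  using psubst_single[of h 0 1] by simp

interpretation psubst: comm_ring_hom "psubst h"
  by unfold_locales (simp_all add: psubst_add psubst_mult psubst_1)

lemma psubst_prod: "psubst h (prod f A) = (\<Prod>a\<in>A. psubst h (f a))"
  by (induction A rule: infinite_finite_induct) (simp_all add: psubst_mult psubst_1)

lemma psubst_var: "psubst h (var i j) = h (i, j)"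
  by (simp add: var_def monomial_def psubst_single msubst_def)

lemma psubst_bidet: "psubst h (bidet v a m n) = bidet (\<lambda>i j. psubst h (v i j)) a m n"
proof -
  have "psubst h (col_det v a m n c) = col_det (\<lambda>i j. psubst h (v i j)) a m n c" for c
    unfolding col_det_def Let_def psubst.hom_det[symmetric]
    by (intro arg_cong[of _ _ det] eq_matI) auto
  then show ?thesis by (simp add: bidet_def psubst_prod)
qed

section \<open>Renaming of variables\<close>

definition relabel :: "(nat \<times> nat \<Rightarrow> nat \<times> nat) \<Rightarrow> exponent \<Rightarrow> exponent" where
  "relabel f \<alpha> = (\<Sum>x\<in>Poly_Mapping.keys \<alpha>. Poly_Mapping.single (f x) (Poly_Mapping.lookup \<alpha> x))"

lemma lookup_relabel:
  assumes "inj f" shows "Poly_Mapping.lookup (relabel f \<alpha>) (f x) = Poly_Mapping.lookup \<alpha> x"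
    "y \<notin> range f \<Longrightarrow> Poly_Mapping.lookup (relabel f \<alpha>) y = 0"
  using assms by (auto simp: relabel_def lookup_sum lookup_single when_def inj_eq in_keys_iff intro!: sum.neutral)

lemma inj_relabel: assumes "inj f" shows "inj (relabel f)"
  by (rule injI, rule poly_mapping_eqI) (metis lookup_relabel(1)[OF assms])

lemma monomial_add: "monomial (a + b) = monomial a * monomial b"
  by (simp add: monomial_def mult_single)

lemma monomial_power: "monomial (Poly_Mapping.single x 1) ^ k = monomial (Poly_Mapping.single x k)"
proof (induction k)
  case (Suc k)
  then show ?case by (simp flip: monomial_add single_add)
qed (simp add: monomial_def)

lemma monomial_sum: "monomial (sum f A) = (\<Prod>a\<in>A. monomial (f a))"
  by (induction A rule: infinite_finite_induct) (simp_all add: monomial_add, simp_all add: monomial_def)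

text \<open>An injective renaming of variables sends distinct monomials to distinct monomials, so
  coefficients are merely moved. With this the bitableaux before and after a transposition or the
  deletion of a zero row are compared.\<close>

lemma lookup_psubst_relabel:
  assumes "inj f"
  shows "Poly_Mapping.lookup (psubst (\<lambda>x. var (fst (f x)) (snd (f x))) p) (relabel f \<beta>) = Poly_Mapping.lookup p \<beta>"
proof -
  have "msubst (\<lambda>x. var (fst (f x)) (snd (f x))) \<alpha> = monomial (relabel f \<alpha>)" for \<alpha>
    by (simp add: msubst_def var_def monomial_power[simplified] relabel_def monomial_sum)
  then have "psubst (\<lambda>x. var (fst (f x)) (snd (f x))) p =
      (\<Sum>\<alpha>\<in>Poly_Mapping.keys p. Poly_Mapping.single (relabel f \<alpha>) (Poly_Mapping.lookup p \<alpha>))"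
    by (simp add: psubst_def monomial_def mult_single)
  then show ?thesis
    by (simp add: lookup_sum lookup_single when_def inj_eq[OF inj_relabel[OF assms]] in_keys_iff)
qed

section \<open>Row and column sums as a bigrading\<close>

definition row_sum :: "nat \<Rightarrow> exponent \<Rightarrow> nat \<Rightarrow> nat" where
  "row_sum n \<alpha> i = (\<Sum>j\<in>{1..n}. entry \<alpha> i j)"

definition col_sum :: "nat \<Rightarrow> exponent \<Rightarrow> nat \<Rightarrow> nat" where
  "col_sum m \<alpha> j = (\<Sum>i\<in>{1..m}. entry \<alpha> i j)"

definition homog :: "nat \<Rightarrow> nat \<Rightarrow> (nat \<Rightarrow> nat) \<Rightarrow> (nat \<Rightarrow> nat) \<Rightarrow> cpoly \<Rightarrow> bool" where
  "homog m n r c f \<longleftrightarrow> (\<forall>\<alpha>\<in>Poly_Mapping.keys f. \<alpha> \<in> nat_matrices m n \<and> row_sum n \<alpha> = r \<and> col_sum m \<alpha> = c)"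

lemma nat_matrices_add: "\<alpha> \<in> nat_matrices m n \<Longrightarrow> \<beta> \<in> nat_matrices m n \<Longrightarrow> \<alpha> + \<beta> \<in> nat_matrices m n"
  using Poly_Mapping.keys_add[of \<alpha> \<beta>] by (auto simp: nat_matrices_def)

lemma homog_mult:
  assumes "homog m n r c f" "homog m n r' c' g"
  shows "homog m n (\<lambda>i. r i + r' i) (\<lambda>j. c j + c' j) (f * g)"
proof -
  have "\<alpha> \<in> nat_matrices m n \<and> row_sum n \<alpha> = (\<lambda>i. r i + r' i) \<and> col_sum m \<alpha> = (\<lambda>j. c j + c' j)"
    if \<alpha>: "\<alpha> \<in> Poly_Mapping.keys (f * g)" for \<alpha>
  proof -
    obtain x y where "\<alpha> = x + y" "x \<in> Poly_Mapping.keys f" "y \<in> Poly_Mapping.keys g"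
      using \<alpha> keys_mult[of f g] by blast
    then show ?thesis using assms
      by (fastforce simp: homog_def nat_matrices_add row_sum_def col_sum_def lookup_add sum.distrib)
  qed
  then show ?thesis by (simp add: homog_def)
qed

lemma homog_1: "homog m n (\<lambda>_. 0) (\<lambda>_. 0) 1"
  by (auto simp: homog_def nat_matrices_def row_sum_def col_sum_def)

lemma homog_prod:
  "finite A \<Longrightarrow> (\<And>a. a \<in> A \<Longrightarrow> homog m n (r a) (c a) (f a)) \<Longrightarrow>
    homog m n (\<lambda>i. \<Sum>a\<in>A. r a i) (\<lambda>j. \<Sum>a\<in>A. c a j) (prod f A)"
  by (induction A rule: finite_induct) (simp_all add: homog_1 homog_mult)

lemma homog_sum: "(\<And>a. a \<in> A \<Longrightarrow> homog m n r c (f a)) \<Longrightarrow> homog m n r c (sum f A)"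
  using keys_sum[of f A] by (fastforce simp: homog_def)

lemma homog_var:
  assumes "i \<in> {1..m}" "j \<in> {1..n}"
  shows "homog m n (\<lambda>x. of_bool (x = i)) (\<lambda>y. of_bool (y = j)) (var i j)"
  using assms by (auto simp: homog_def var_def monomial_def nat_matrices_def row_sum_def col_sum_def
      lookup_single when_def split: if_splits)

lemma homog_signof: "homog m n r c f \<Longrightarrow> homog m n r c (signof p * f)"
  by (auto simp: sign_def homog_def)

lemma ent_range:
  assumes "s < hgt (\<lambda>k. lam a k m n) c"
  shows "ent (\<lambda>i. lam a s i n) c \<in> {1..m}" "ent (\<lambda>j. lam a s m j) c \<in> {1..n}"
proof -
  have l: "c < lam a s m n" using less_hgt[OF assms] .
  note e = ent_less(1,2)[of c "\<lambda>i. lam a s i n", OF l] ent_less(1,2)[of c "\<lambda>j. lam a s m j", OF l]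
  then have "ent (\<lambda>i. lam a s i n) c \<noteq> 0" "ent (\<lambda>j. lam a s m j) c \<noteq> 0"
    by (metis lam_0(1) not_less0, metis e(3) lam_0(2) not_less0)
  then show "ent (\<lambda>i. lam a s i n) c \<in> {1..m}" "ent (\<lambda>j. lam a s m j) c \<in> {1..n}" using e by auto
qed

text \<open>Each term of the Leibniz expansion uses every row and every column of the minor once, so
  all terms have the same bidegree.\<close>

lemma homog_col_det:
  "homog m n (\<lambda>i. \<Sum>s<hgt (\<lambda>k. lam a k m n) c. of_bool (i = ent (\<lambda>i. lam a s i n) c))
    (\<lambda>j. \<Sum>s<hgt (\<lambda>k. lam a k m n) c. of_bool (j = ent (\<lambda>j. lam a s m j) c))
    (col_det var a m n c)"
proof -
  let ?h = "hgt (\<lambda>k. lam a k m n) c"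
  let ?r = "\<lambda>s. ent (\<lambda>i. lam a s i n) c" and ?c = "\<lambda>s. ent (\<lambda>j. lam a s m j) c"
  note range = ent_range[of _ a m n c]
  have "homog m n (\<lambda>i. \<Sum>s<?h. of_bool (i = ?r s)) (\<lambda>j. \<Sum>s<?h. of_bool (j = ?c s))
     (signof p * (\<Prod>s = 0..<?h. mat ?h ?h (\<lambda>(s, t). var (?r s) (?c t)) $$ (s, p s)))"
    if p: "p permutes {0..<?h}" for p
  proof (rule homog_signof)
    have ps: "p s < ?h" if "s < ?h" for s using permutes_in_image[OF p, of s] that by simp
    have "homog m n (\<lambda>i. \<Sum>s\<in>{0..<?h}. of_bool (i = ?r s)) (\<lambda>j. \<Sum>s\<in>{0..<?h}. of_bool (j = ?c (p s)))
      (\<Prod>s = 0..<?h. mat ?h ?h (\<lambda>(s, t). var (?r s) (?c t)) $$ (s, p s))"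
      by (rule homog_prod) (auto simp: ps intro!: homog_var range)
    moreover have "(\<Sum>s\<in>{0..<?h}. of_bool (j = ?c (p s))) = (\<Sum>s\<in>{0..<?h}. of_bool (j = ?c s) :: nat)" for j
      by (rule sum.permute[OF p, of "\<lambda>s. of_bool (j = ?c s)", unfolded comp_def, symmetric])
    ultimately show "homog m n (\<lambda>i. \<Sum>s<?h. of_bool (i = ?r s)) (\<lambda>j. \<Sum>s<?h. of_bool (j = ?c s))
      (\<Prod>s = 0..<?h. mat ?h ?h (\<lambda>(s, t). var (?r s) (?c t)) $$ (s, p s))"
      by (simp add: atLeast0LessThan)
  qed
  then show ?thesis unfolding col_det_def Let_def
    by (subst det_def'[of _ ?h]) (auto intro!: homog_sum)
qed

text \<open>The boxes of the shape are summed by columns and by rows; rows from \<open>m\<close> on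
  are empty.\<close>

lemma sum_hgt:
  assumes K: "m \<le> K"
  shows "(\<Sum>c<lam a 0 m n. \<Sum>s<hgt (\<lambda>k. lam a k m n) c. F s c) = (\<Sum>s<K. \<Sum>c<lam a s m n. F s c)"
proof -
  have h: "s < hgt (\<lambda>k. lam a k m n) c \<longleftrightarrow> c < lam a s m n" for s c
  proof
    assume "c < lam a s m n"
    then show "s < hgt (\<lambda>k. lam a k m n) c"
    proof (rule contrapos_pp)
      assume "\<not> s < hgt (\<lambda>k. lam a k m n) c"
      moreover have "lam a (hgt (\<lambda>k. lam a k m n) c) m n \<le> c"
        unfolding hgt_def by (rule LeastI[of _ m]) (simp add: lam_eq_0)
      ultimately show "\<not> c < lam a s m n" using lam_antimono[of "hgt (\<lambda>k. lam a k m n) c" s a m n] by simp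
    qed
  qed (rule less_hgt)
  have "(\<Sum>c<lam a 0 m n. \<Sum>s<hgt (\<lambda>k. lam a k m n) c. F s c) =
    (\<Sum>(c, s)\<in>Sigma {..<lam a 0 m n} (\<lambda>c. {..<hgt (\<lambda>k. lam a k m n) c}). F s c)"
    by (rule sum.Sigma) auto
  also have "\<dots> = (\<Sum>(s, c)\<in>Sigma {..<K} (\<lambda>s. {..<lam a s m n}). F s c)"
  proof (rule sum.reindex_bij_witness[of _ prod.swap prod.swap]; clarsimp simp: h)
    fix s c assume "c < lam a s m n"
    then show "s < K" using lam_eq_0[of m s a n] K by (cases "s < m") auto
  next
    fix s c assume "c < lam a s m n"
    then show "c < lam a 0 m n" using lam_antimono[of 0 s a m n] by simp
  qed
  also have "\<dots> = (\<Sum>s<K. \<Sum>c<lam a s m n. F s c)" by (rule sum.Sigma[symmetric]) auto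
  finally show ?thesis .
qed

lemma ent_eq_iff:
  assumes "mono g" "g 0 = 0" "c < g m"
  shows "Suc i = ent g c \<longleftrightarrow> g i \<le> c \<and> c < g (Suc i)"
proof -
  have "c < g (ent g c)" unfolding ent_def using assms(3) by (rule LeastI)
  moreover have "g j \<le> c" if "j < ent g c" for j using that unfolding ent_def by (meson not_less not_less_Least)
  moreover have "ent g c \<le> j" if "c < g j" for j using that unfolding ent_def by (rule Least_le)
  ultimately show ?thesis using monoD[OF assms(1)] by (metis Suc_leI le_antisym lessI not_le not_less_eq_eq order_less_le_trans)
qed

lemma count_ent:
  assumes "mono g" "g 0 = 0" "Suc i \<le> m"
  shows "(\<Sum>c<g m. of_bool (Suc i = ent g c)) = g (Suc i) - g i"
proof -
  have "{c\<in>{..<g m}. Suc i = ent g c} = {g i..<g (Suc i)}"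
  proof (rule Set.set_eqI)
    fix c show "c \<in> {c\<in>{..<g m}. Suc i = ent g c} \<longleftrightarrow> c \<in> {g i..<g (Suc i)}"
      using ent_eq_iff[OF assms(1,2), of c m i] monoD[OF assms(1), OF assms(3)] by (cases "c < g m") simp_all
  qed
  moreover have "(\<Sum>c<g m. of_bool (Suc i = ent g c)) = card {c\<in>{..<g m}. Suc i = ent g c}"
    by (simp add: of_bool_def flip: sum.inter_filter)
  ultimately show ?thesis by simp
qed

lemma lam_row_sum:
  assumes "Suc i \<le> K"
  shows "(\<Sum>s<K. lam a s (Suc i) n - lam a s i n) = (\<Sum>j\<in>{1..n}. a (Suc i) j)"
proof -
  have "(\<Sum>s<K. lam a s (Suc i) n - lam a s i n) + (\<Sum>s<K. lam a s i n) = (\<Sum>s<K. lam a s (Suc i) n)"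
    by (simp add: lam_mono_Suc flip: sum.distrib)
  then show ?thesis using lam_sum[of i K a n] lam_sum[of "Suc i" K a n] assms by simp
qed


text \<open>The multiplicity of \<open>i\<close> in the first tableau is the difference in size of
  two successive shapes, which is the row sum; likewise for the second tableau and the column sums.
  Hence the operator preserves weights.\<close>

lemma homog_bidet:
  assumes "\<alpha> \<in> nat_matrices m n"
  shows "homog m n (row_sum n \<alpha>) (col_sum m \<alpha>) (bidet var (entry \<alpha>) m n)"
proof -
  let ?l = "lam (entry \<alpha>)" and ?K = "m + n"
  let ?h = "\<lambda>c. hgt (\<lambda>k. ?l k m n) c"
  have "homog m n (\<lambda>i. \<Sum>c<?l 0 m n. \<Sum>s<?h c. of_bool (i = ent (\<lambda>i. ?l s i n) c))
      (\<lambda>j. \<Sum>c<?l 0 m n. \<Sum>s<?h c. of_bool (j = ent (\<lambda>j. ?l s m j) c)) (bidet var (entry \<alpha>) m n)"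
    unfolding bidet_def by (intro homog_prod finite_lessThan homog_col_det)
  moreover have "(\<Sum>c<?l 0 m n. \<Sum>s<?h c. of_bool (i = ent (\<lambda>i. ?l s i n) c)) = row_sum n \<alpha> i" for i
  proof (cases "i \<in> {1..m}")
    case True
    then obtain i' where i: "i = Suc i'" by (cases i) auto
    have "(\<Sum>c<?l 0 m n. \<Sum>s<?h c. of_bool (i = ent (\<lambda>i. ?l s i n) c)) =
        (\<Sum>s<?K. \<Sum>c<?l s m n. of_bool (Suc i' = ent (\<lambda>i. ?l s i n) c))" unfolding i by (rule sum_hgt) simp
    also have "\<dots> = (\<Sum>s<?K. ?l s (Suc i') n - ?l s i' n)"
      using True i by (intro sum.cong refl count_ent) (auto intro: monoI lam_mono)
    also have "\<dots> = row_sum n \<alpha> i" using True i lam_row_sum[of i' ?K "entry \<alpha>" n] by (simp add: row_sum_def)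
    finally show ?thesis .
  next
    case False
    then have "row_sum n \<alpha> i = 0" using entry_outside[OF assms, of i] by (auto simp: row_sum_def)
    moreover have "i \<noteq> ent (\<lambda>i. ?l s i n) c" if "s < ?h c" for s c using ent_range(1)[OF that] False by blast
    ultimately show ?thesis by simp
  qed
  moreover have "(\<Sum>c<?l 0 m n. \<Sum>s<?h c. of_bool (j = ent (\<lambda>j. ?l s m j) c)) = col_sum m \<alpha> j" for j
  proof (cases "j \<in> {1..n}")
    case True
    then obtain j' where j: "j = Suc j'" by (cases j) auto
    have "(\<Sum>c<?l 0 m n. \<Sum>s<?h c. of_bool (j = ent (\<lambda>j. ?l s m j) c)) =
        (\<Sum>s<?K. \<Sum>c<?l s m n. of_bool (Suc j' = ent (\<lambda>j. ?l s m j) c))" unfolding j by (rule sum_hgt) simp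
    also have "\<dots> = (\<Sum>s<?K. ?l s m (Suc j') - ?l s m j')"
      using True j by (intro sum.cong refl count_ent) (auto intro: monoI lam_mono)
    also have "\<dots> = col_sum m \<alpha> j"
      using True j lam_row_sum[of j' ?K "\<lambda>i j. entry \<alpha> j i" m] by (simp add: col_sum_def lam_flip[of "entry \<alpha>"])
    finally show ?thesis .
  next
    case False
    then have "col_sum m \<alpha> j = 0" using entry_outside[OF assms, of _ j] by (auto simp: col_sum_def)
    moreover have "j \<noteq> ent (\<lambda>j. ?l s m j) c" if "s < ?h c" for s c using ent_range(2)[OF that] False by blast
    ultimately show ?thesis by simp
  qed
  ultimately show ?thesis by simp
qed

section \<open>Leading monomials\<close>

lemma count_sum: "finite A \<Longrightarrow> (\<Sum>s\<in>A. if P s then 1 else 0) = card {s\<in>A. P s}"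
  by (simp add: sum.inter_filter[symmetric])

type_synonym lexp = "(nat \<times> nat \<times> nat) \<Rightarrow>\<^sub>0 nat"

text \<open>The coefficient 1 is built in, so that leading terms multiply without loss and later
  give ones on the diagonal of a matrix.\<close>

definition lead :: "(lexp \<Rightarrow>\<^sub>0 complex) \<Rightarrow> lexp \<Rightarrow> bool" where
  "lead f e \<longleftrightarrow> (\<exists>g. f = Poly_Mapping.single e 1 + g \<and> (\<forall>x\<in>Poly_Mapping.keys g. x < e))"

lemma lead_lookup:
  assumes "lead f e"
  shows "Poly_Mapping.lookup f e = 1" "Poly_Mapping.lookup f x \<noteq> 0 \<Longrightarrow> x \<le> e"
proof -
  obtain g where g: "f = Poly_Mapping.single e 1 + g" "\<forall>x\<in>Poly_Mapping.keys g. x < e"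
    using assms unfolding lead_def by blast
  then have "Poly_Mapping.lookup g e = 0" by (auto simp: in_keys_iff)
  then show "Poly_Mapping.lookup f e = 1" by (simp add: g lookup_add)
  assume x: "Poly_Mapping.lookup f x \<noteq> 0"
  show "x \<le> e"
  proof (cases "x = e")
    case False
    then have "x \<in> Poly_Mapping.keys g" using x by (simp add: g(1) lookup_add lookup_single when_def in_keys_iff)
    then show ?thesis using g(2) by (simp add: less_imp_le)
  qed simp
qed

lemma lead_1: "lead 1 0"
  unfolding lead_def by (rule exI[of _ 0]) simp

lemma lead_mult:
  assumes "lead f e" "lead f' e'" shows "lead (f * f') (e + e')"
proof -
  obtain g g' where g: "f = Poly_Mapping.single e 1 + g" "\<And>x. x \<in> Poly_Mapping.keys g \<Longrightarrow> x < e"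
    "f' = Poly_Mapping.single e' 1 + g'" "\<And>x. x \<in> Poly_Mapping.keys g' \<Longrightarrow> x < e'"
    using assms unfolding lead_def by blast
  have "f * f' = Poly_Mapping.single (e + e') 1 + (Poly_Mapping.single e 1 * g' + g * f')"
    by (simp add: g algebra_simps mult_single)
  moreover have "x < e + e'" if "x \<in> Poly_Mapping.keys (Poly_Mapping.single e 1 * g' + g * f')" for x
  proof -
    have "x \<in> Poly_Mapping.keys (Poly_Mapping.single e 1 * g') \<or> x \<in> Poly_Mapping.keys (g * f')"
      using subsetD[OF Poly_Mapping.keys_add that] by simp
    then show ?thesis
    proof
      assume "x \<in> Poly_Mapping.keys (Poly_Mapping.single e 1 * g')"
      then obtain y where "x = e + y" "y \<in> Poly_Mapping.keys g'"
        using subsetD[OF keys_mult] by fastforce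
      then show ?thesis using g(4) by (simp add: add_strict_left_mono)
    next
      assume "x \<in> Poly_Mapping.keys (g * f')"
      then obtain y z where "x = y + z" "y \<in> Poly_Mapping.keys g" "z \<in> Poly_Mapping.keys f'"
        using subsetD[OF keys_mult] by blast
      moreover have "z \<le> e'" using lead_lookup(2)[OF assms(2), of z] \<open>z \<in> Poly_Mapping.keys f'\<close> by (simp add: in_keys_iff)
      ultimately show ?thesis using g(2) add_less_le_mono by blast
    qed
  qed
  ultimately show ?thesis unfolding lead_def by blast
qed

lemma lead_prod: "finite A \<Longrightarrow> (\<And>a. a \<in> A \<Longrightarrow> lead (f a) (e a)) \<Longrightarrow> lead (prod f A) (sum e A)"
  by (induction A rule: finite_induct) (simp_all add: lead_1 lead_mult)

lemma poly_mapping_lessI: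
  "Poly_Mapping.lookup f k < Poly_Mapping.lookup g k \<Longrightarrow>
    (\<And>k'. k' < k \<Longrightarrow> Poly_Mapping.lookup f k' = Poly_Mapping.lookup g k') \<Longrightarrow> (f :: lexp) < g"
  by (simp add: less_poly_mapping.rep_eq) (blast intro: less_funI)

definition lmonom :: "lexp \<Rightarrow> (lexp \<Rightarrow>\<^sub>0 complex)" where
  "lmonom e = Poly_Mapping.single e 1"

lemma lmonom_mult: "lmonom a * lmonom b = lmonom (a + b)"
  by (simp add: lmonom_def mult_single)

lemma lmonom_prod: "(\<Prod>a\<in>A. lmonom (f a)) = lmonom (sum f A)"
  by (induction A rule: infinite_finite_induct) (simp_all add: lmonom_mult, simp_all add: lmonom_def)

abbreviation evar :: "nat \<times> nat \<times> nat \<Rightarrow> lexp" where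
  "evar k \<equiv> Poly_Mapping.single k 1"

text \<open>The entries of \<open>A B\<close>. The variables \<open>A\<^sub>i\<^sub>q\<close> and \<open>B\<^sub>q\<^sub>j\<close> have the keys \<open>(0, i, q)\<close> and \<open>(1, q, j)\<close>; small keys are
  the significant ones in the order on \<^typ>\<open>lexp\<close>.\<close>

definition prod_entry :: "nat \<Rightarrow> nat \<times> nat \<Rightarrow> (lexp \<Rightarrow>\<^sub>0 complex)" where
  "prod_entry m = (\<lambda>(i, j). \<Sum>q<m. lmonom (evar (0, i, q)) * lmonom (evar (1, q, j)))"

text \<open>All values below the first moved point are already taken by fixed points, so injectivity
  leaves only larger ones.\<close>

lemma fixpoint_first:
  assumes "inj_on f {0..<h::nat}" "\<exists>s<h. f s \<noteq> (s::nat)"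
  obtains s where "s < h" "s < f s" "\<And>t. t < s \<Longrightarrow> f t = t"
proof -
  define s where "s = (LEAST s. s < h \<and> f s \<noteq> s)"
  have s: "s < h \<and> f s \<noteq> s" unfolding s_def using assms(2) by (rule LeastI_ex)
  have l: "f t = t" if "t < s" for t
    using not_less_Least[of t "\<lambda>s. s < h \<and> f s \<noteq> s"] that s by (auto simp: s_def)
  have "\<not> f s < s"
  proof
    assume "f s < s"
    then have "f (f s) = f s" by (rule l)
    then show False using inj_onD[OF assms(1), of "f s" s] s \<open>f s < s\<close> by auto
  qed
  then show ?thesis using that[of s] s l by auto
qed

text \<open>Expanding by rows, terms in which two rows use the same inner index cancel. Among injective choices
  the identity is leading, because the first index \<open>s\<close> moved by an injection is moved upwards.\<close>

lemma lead_minor: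
  assumes a: "\<And>s t. s < t \<Longrightarrow> t < h \<Longrightarrow> a s < a t" and b: "\<And>s t. s < t \<Longrightarrow> t < h \<Longrightarrow> b s < (b t :: nat)"
    and h: "h \<le> m"
  shows "lead (det (mat h h (\<lambda>(s, t). prod_entry m (a s, b t)))) (\<Sum>s<h. evar (0, a s, s) + evar (1, s, b s))"
proof -
  let ?A = "\<lambda>i q. lmonom (evar (0, i, q))" and ?B = "\<lambda>q j. lmonom (evar (1, q, j))"
  let ?F = "{0..<h} \<rightarrow>\<^sub>E {..<m}" and ?P = "{p. p permutes {0..<h}}"
  define E where "E f p = (\<Sum>s\<in>{0..<h}. evar (0, a s, f s) + evar (1, f s, b (p s)))" for f p
  have inja: "a s = a t \<longleftrightarrow> s = t" if "s < h" "t < h" for s t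
    using a[of s t] a[of t s] that by (cases s t rule: linorder_cases) auto
  have injb: "b s = b t \<longleftrightarrow> s = t" if "s < h" "t < h" for s t
    using b[of s t] b[of t s] that by (cases s t rule: linorder_cases) auto
  have pl: "p s < h" if "p \<in> ?P" "s < h" for p s
    using permutes_in_image[of p "{0..<h}" s] that by simp
  have "det (mat h h (\<lambda>(s, t). prod_entry m (a s, b t))) =
      (\<Sum>p\<in>?P. signof p * (\<Prod>s = 0..<h. \<Sum>q<m. ?A (a s) q * ?B q (b (p s))))"
    by (subst det_def'[of _ h]) (auto simp: prod_entry_def pl intro!: sum.cong prod.cong)
  also have "\<dots> = (\<Sum>p\<in>?P. signof p * (\<Sum>f\<in>?F. \<Prod>s = 0..<h. ?A (a s) (f s) * ?B (f s) (b (p s))))"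
    by (simp add: prod_sum_PiE)
  also have "\<dots> = (\<Sum>f\<in>?F. (\<Prod>s = 0..<h. ?A (a s) (f s)) * (\<Sum>p\<in>?P. signof p * (\<Prod>s = 0..<h. ?B (f s) (b (p s)))))"
    unfolding sum_distrib_left by (subst sum.swap) (simp add: prod.distrib mult.left_commute)
  also have "\<dots> = (\<Sum>f | f \<in> ?F \<and> inj_on f {0..<h}.
     (\<Prod>s = 0..<h. ?A (a s) (f s)) * (\<Sum>p\<in>?P. signof p * (\<Prod>s = 0..<h. ?B (f s) (b (p s)))))"
  proof (rule sum.mono_neutral_right)
    show "finite ?F" by (intro finite_PiE) auto
    show "\<forall>f\<in>?F - {f \<in> ?F. inj_on f {0..<h}}.
       (\<Prod>s = 0..<h. ?A (a s) (f s)) * (\<Sum>p\<in>?P. signof p * (\<Prod>s = 0..<h. ?B (f s) (b (p s)))) = 0"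
    proof
      fix f assume "f \<in> ?F - {f \<in> ?F. inj_on f {0..<h}}"
      then obtain s t where st: "s < h" "t < h" "s \<noteq> t" "f s = f t" by (auto simp: inj_on_def)
      let ?M = "mat h h (\<lambda>(s, t). ?B (f s) (b t))"
      have "det ?M = 0"
        by (rule det_identical_rows[of _ h s t]) (use st in \<open>auto intro!: eq_vecI\<close>)
      moreover have "det ?M = (\<Sum>p\<in>?P. signof p * (\<Prod>s = 0..<h. ?B (f s) (b (p s))))"
        by (subst det_def'[of _ h]) (auto simp: pl intro!: sum.cong prod.cong)
      ultimately show "(\<Prod>s = 0..<h. ?A (a s) (f s)) * (\<Sum>p\<in>?P. signof p * (\<Prod>s = 0..<h. ?B (f s) (b (p s)))) = 0"
        by simp
    qed
  qed auto
  also have "\<dots> = (\<Sum>f | f \<in> ?F \<and> inj_on f {0..<h}. \<Sum>p\<in>?P. signof p * lmonom (E f p))"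
    unfolding sum_distrib_left E_def
    by (simp add: lmonom_mult lmonom_prod sum.distrib mult.left_commute)
  also have "\<dots> = (\<Sum>(f, p)\<in>{f. f \<in> ?F \<and> inj_on f {0..<h}} \<times> ?P. signof p * lmonom (E f p))"
    by (rule sum.cartesian_product)
  finally have det: "det (mat h h (\<lambda>(s, t). prod_entry m (a s, b t))) =
    (\<Sum>(f, p)\<in>{f. f \<in> ?F \<and> inj_on f {0..<h}} \<times> ?P. signof p * lmonom (E f p))" .
  define i0 where "i0 = restrict id {0..<h}"
  have i0: "i0 \<in> ?F" "inj_on i0 {0..<h}" using h by (auto simp: i0_def inj_on_def)
  have finF: "finite ?F" by (intro finite_PiE) auto
  have fin: "finite ({f. f \<in> ?F \<and> inj_on f {0..<h}} \<times> ?P)"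
    by (rule finite_cartesian_product[OF finite_subset[OF _ finF] finite_permutations]) auto
  have E0: "E i0 id = (\<Sum>s<h. evar (0, a s, s) + evar (1, s, b s))"
    by (auto simp: E_def i0_def atLeast0LessThan)
  have luA: "Poly_Mapping.lookup (E f p) (0, x, y) = card {s\<in>{0..<h}. a s = x \<and> f s = y}" for f p x y
    unfolding count_sum[OF finite_atLeastLessThan, symmetric]
    by (simp add: E_def lookup_sum lookup_add lookup_single when_def del: One_nat_def)
  have luB: "Poly_Mapping.lookup (E f p) (1, x, y) = card {s\<in>{0..<h}. f s = x \<and> b (p s) = y}" for f p x y
    unfolding count_sum[OF finite_atLeastLessThan, symmetric]
    by (simp add: E_def lookup_sum lookup_add lookup_single when_def del: One_nat_def)
  \<comment> \<open>If \<open>f\<close> moves an index, the comparison is decided by the variables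
    \<open>A\<close>: at the first moved \<open>s\<close> the key \<open>(0, a s, s)\<close> has a
    positive exponent for the identity and exponent 0 for \<open>f\<close>. If \<open>f\<close> is
    the identity, these keys all agree, and the variables \<open>B\<close> decide in the same way at
    the first index moved by \<open>p\<close>.\<close>
  have less: "E f p < E i0 id" if f: "f \<in> ?F" "inj_on f {0..<h}" and p: "p \<in> ?P" and ne: "(f, p) \<noteq> (i0, id)" for f p
  proof (cases "f = i0")
    case False
    have "\<exists>s<h. f s \<noteq> s"
    proof (rule ccontr)
      assume "\<not> (\<exists>s<h. f s \<noteq> s)"
      then have "f = i0" using f(1) by (auto simp: i0_def restrict_def fun_eq_iff PiE_def extensional_def)
      then show False using False by simp
    qed
    then obtain s where s: "s < h" "s < f s" "\<And>t. t < s \<Longrightarrow> f t = t"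
      using fixpoint_first[OF f(2)] by auto
    show ?thesis
    proof (rule poly_mapping_lessI[of _ "(0, a s, s)"])
      have "{t\<in>{0..<h}. a t = a s \<and> f t = s} = {}" (is "?S = {}") using s inja by auto
      then have "card ?S = 0" by (simp only: card.empty)
      moreover have "s \<in> {t\<in>{0..<h}. a t = a s \<and> i0 t = s}" using s by (auto simp: i0_def)
      then have "card {t\<in>{0..<h}. a t = a s \<and> i0 t = s} > 0" by (subst card_gt_0_iff) auto
      ultimately show "Poly_Mapping.lookup (E f p) (0, a s, s) < Poly_Mapping.lookup (E i0 id) (0, a s, s)"
        unfolding luA by linarith
      fix k' :: "nat \<times> nat \<times> nat" assume "k' < (0, a s, s)"
      moreover obtain z x y where "k' = (z, x, y)" by (cases k')
      ultimately have k': "k' = (0, x, y)" "x < a s \<or> x = a s \<and> y < s" by (auto simp: less_prod_def)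
      have "(t \<in> {0..<h} \<and> a t = x \<and> f t = y) = (t \<in> {0..<h} \<and> a t = x \<and> i0 t = y)" for t
      proof (cases "t \<in> {0..<h} \<and> a t = x")
        case True
        then consider "t < s" | "t = s" "y < s" using k'(2) a[of s t] inja[of s t] s(1) by (cases s t rule: linorder_cases) auto
        then show ?thesis using s by cases (auto simp: i0_def)
      qed auto
      then show "Poly_Mapping.lookup (E f p) k' = Poly_Mapping.lookup (E i0 id) k'" unfolding k' luA by simp
    qed
  next
    case True
    then have "p \<noteq> id" using ne by auto
    have "\<exists>s<h. p s \<noteq> s"
    proof (rule ccontr)
      assume "\<not> (\<exists>s<h. p s \<noteq> s)"
      then have "p = id" using p by (auto simp: permutes_def fun_eq_iff)
      then show False using \<open>p \<noteq> id\<close> by simp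
    qed
    then obtain s where s: "s < h" "s < p s" "\<And>t. t < s \<Longrightarrow> p t = t"
      using fixpoint_first[of p h] p by (auto simp: permutes_inj_on)
    show ?thesis unfolding True
    proof (rule poly_mapping_lessI[of _ "(1, s, b s)"])
      have "{t\<in>{0..<h}. i0 t = s \<and> b (p t) = b s} = {}" (is "?S = {}") using s injb[of "p s" s] pl[OF p s(1)] by (auto simp: i0_def)
      then have "card ?S = 0" by (simp only: card.empty)
      moreover have "s \<in> {t\<in>{0..<h}. i0 t = s \<and> b (id t) = b s}" using s by (auto simp: i0_def)
      then have "card {t\<in>{0..<h}. i0 t = s \<and> b (id t) = b s} > 0" by (subst card_gt_0_iff) auto
      ultimately show "Poly_Mapping.lookup (E i0 p) (1, s, b s) < Poly_Mapping.lookup (E i0 id) (1, s, b s)"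
        unfolding luB by linarith
      fix k' :: "nat \<times> nat \<times> nat" assume "k' < (1, s, b s)"
      moreover obtain z x y where "k' = (z, x, y)" by (cases k')
      ultimately have k': "k' = (z, x, y)" "z = 0 \<or> z = 1 \<and> (x < s \<or> x = s \<and> y < b s)"
        by (auto simp: less_prod_def)
      show "Poly_Mapping.lookup (E i0 p) k' = Poly_Mapping.lookup (E i0 id) k'"
      proof (cases "z = 0")
        case True
        then show ?thesis unfolding k' by (simp add: luA)
      next
        case False
        then have z: "z = 1" using k' by auto
        have "(t \<in> {0..<h} \<and> i0 t = x \<and> b (p t) = y) = (t \<in> {0..<h} \<and> i0 t = x \<and> b (id t) = y)" for t
        proof (cases "t \<in> {0..<h} \<and> i0 t = x")
          case True
          then consider "t < s" | "t = s" "y < b s" using k'(2) z by (auto simp: i0_def)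
          then show ?thesis using s b[of s "p s"] pl[OF p s(1)] by cases (auto simp: i0_def)
        qed auto
        then show ?thesis unfolding k' z luB by simp
      qed
    qed
  qed
  let ?R = "{f. f \<in> ?F \<and> inj_on f {0..<h}} \<times> ?P - {(i0, id)}"
  have "det (mat h h (\<lambda>(s, t). prod_entry m (a s, b t))) = lmonom (E i0 id) + (\<Sum>(f, p)\<in>?R. signof p * lmonom (E f p))"
    unfolding det using i0 fin by (subst sum.remove[of _ "(i0, id)"]) (auto simp: permutes_id sign_id)
  moreover have "x < E i0 id" if x: "x \<in> Poly_Mapping.keys (\<Sum>(f, p)\<in>?R. signof p * lmonom (E f p))" for x
  proof -
    obtain f p where fp: "(f, p) \<in> ?R" "x \<in> Poly_Mapping.keys (signof p * lmonom (E f p))"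
      using subsetD[OF keys_sum x] by (elim UN_E) (metis (no_types, lifting) case_prod_conv surj_pair)
    then have "x = E f p" by (auto simp: sign_def lmonom_def split: if_splits)
    then show ?thesis using less[of f p] fp by auto
  qed
  ultimately show ?thesis unfolding lead_def E0[symmetric] lmonom_def by blast
qed

lemma hgt_le: "hgt (\<lambda>k. lam a k m n) c \<le> m"
  unfolding hgt_def by (rule Least_le) (simp add: lam_eq_0)

text \<open>Strictness of columns, from interlacing: an entry \<open>Suc i\<close> at position
  \<open>c\<close> of row \<open>t\<close> forces an entry of at most \<open>i\<close> at that
  position in every row above.\<close>

lemma ent_strict_mono:
  assumes "s < t" "t < hgt (\<lambda>k. lam a k m n) c"
  shows "ent (\<lambda>i. lam a s i n) c < ent (\<lambda>i. lam a t i n) c" "ent (\<lambda>j. lam a s m j) c < ent (\<lambda>j. lam a t m j) c"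
proof -
  obtain t' where t: "t = Suc t'" "s \<le> t'" using assms(1) by (cases t) auto
  have l: "c < lam a t m n" using less_hgt[OF assms(2)] .
  obtain i where i: "ent (\<lambda>i. lam a t i n) c = Suc i" using ent_range(1)[OF assms(2)] by (cases "ent (\<lambda>i. lam a t i n) c") auto
  have "c < lam a t (Suc i) n" using ent_less(1)[of c "\<lambda>i. lam a t i n", OF l] i by simp
  then have "c < lam a s i n" using lam_interlace(1)[of a t' i n] lam_antimono[OF t(2), of a i n] unfolding t(1) by linarith
  then have "ent (\<lambda>i. lam a s i n) c \<le> i" unfolding ent_def by (rule Least_le)
  then show "ent (\<lambda>i. lam a s i n) c < ent (\<lambda>i. lam a t i n) c" using i by simp
  obtain j where j: "ent (\<lambda>j. lam a t m j) c = Suc j" using ent_range(2)[OF assms(2)] by (cases "ent (\<lambda>j. lam a t m j) c") auto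
  have "c < lam a t m (Suc j)" using ent_less(1)[of c "\<lambda>j. lam a t m j", OF l] j by simp
  then have "c < lam a s m j" using lam_interlace(2)[of a t' m j] lam_antimono[OF t(2), of a m j] unfolding t(1) by linarith
  then have "ent (\<lambda>j. lam a s m j) c \<le> j" unfolding ent_def by (rule Least_le)
  then show "ent (\<lambda>j. lam a s m j) c < ent (\<lambda>j. lam a t m j) c" using j by simp
qed

section \<open>The leading exponent of a bitableau\<close>

definition lead_exp :: "(nat \<Rightarrow> nat \<Rightarrow> nat) \<Rightarrow> nat \<Rightarrow> nat \<Rightarrow> lexp" where
  "lead_exp a m n = (\<Sum>c<lam a 0 m n. \<Sum>s<hgt (\<lambda>k. lam a k m n) c.
     evar (0, ent (\<lambda>i. lam a s i n) c, s) + evar (1, s, ent (\<lambda>j. lam a s m j) c))"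

lemma lead_bidet: "lead (bidet (\<lambda>i j. prod_entry m (i, j)) a m n) (lead_exp a m n)"
  unfolding bidet_def lead_exp_def
proof (rule lead_prod)
  fix c
  show "lead (col_det (\<lambda>i j. prod_entry m (i, j)) a m n c) (\<Sum>s<hgt (\<lambda>k. lam a k m n) c.
     evar (0, ent (\<lambda>i. lam a s i n) c, s) + evar (1, s, ent (\<lambda>j. lam a s m j) c))"
    unfolding col_det_def Let_def by (rule lead_minor[OF _ _ hgt_le]) (auto intro: ent_strict_mono)
qed simp

text \<open>The differences are multiplicities: the exponents of \<open>A\<close> tell how often
  each letter occurs in each row of the first tableau, those of \<open>B\<close> do so for the
  second. Thus the leading exponent knows both tableaux.\<close>

lemma lookup_lead_exp:
  assumes "s < m"
  shows "Suc i \<le> m \<Longrightarrow> Poly_Mapping.lookup (lead_exp a m n) (0, Suc i, s) = lam a s (Suc i) n - lam a s i n"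
    "Suc j \<le> n \<Longrightarrow> Poly_Mapping.lookup (lead_exp a m n) (1, s, Suc j) = lam a s m (Suc j) - lam a s m j"
proof -
  have "Poly_Mapping.lookup (lead_exp a m n) (0, Suc i, s) =
    (\<Sum>c<lam a 0 m n. \<Sum>t<hgt (\<lambda>k. lam a k m n) c. if t = s then of_bool (Suc i = ent (\<lambda>i. lam a t i n) c) else 0)"
    unfolding lead_exp_def lookup_sum by (intro sum.cong refl) (auto simp: lookup_add lookup_single when_def)
  also have "\<dots> = (\<Sum>t<m. \<Sum>c<lam a t m n. if t = s then of_bool (Suc i = ent (\<lambda>i. lam a t i n) c) else 0)"
    by (rule sum_hgt) simp
  also have "\<dots> = (\<Sum>t<m. if t = s then (\<Sum>c<lam a t m n. of_bool (Suc i = ent (\<lambda>i. lam a t i n) c)) else 0)"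
    by (intro sum.cong) auto
  also have "\<dots> = (\<Sum>c<lam a s m n. of_bool (Suc i = ent (\<lambda>i. lam a s i n) c))" using assms by (subst sum.delta) auto
  finally show "Poly_Mapping.lookup (lead_exp a m n) (0, Suc i, s) = lam a s (Suc i) n - lam a s i n" if "Suc i \<le> m"
    using count_ent[of "\<lambda>i. lam a s i n" i m] that by (simp add: mono_def lam_mono)
  have "Poly_Mapping.lookup (lead_exp a m n) (1, s, Suc j) =
    (\<Sum>c<lam a 0 m n. \<Sum>t<hgt (\<lambda>k. lam a k m n) c. if t = s then of_bool (Suc j = ent (\<lambda>j. lam a t m j) c) else 0)"
    unfolding lead_exp_def lookup_sum by (intro sum.cong refl) (auto simp: lookup_add lookup_single when_def)
  also have "\<dots> = (\<Sum>t<m. \<Sum>c<lam a t m n. if t = s then of_bool (Suc j = ent (\<lambda>j. lam a t m j) c) else 0)"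
    by (rule sum_hgt) simp
  also have "\<dots> = (\<Sum>t<m. if t = s then (\<Sum>c<lam a t m n. of_bool (Suc j = ent (\<lambda>j. lam a t m j) c)) else 0)"
    by (intro sum.cong) auto
  also have "\<dots> = (\<Sum>c<lam a s m n. of_bool (Suc j = ent (\<lambda>j. lam a s m j) c))" using assms by (subst sum.delta) auto
  finally show "Poly_Mapping.lookup (lead_exp a m n) (1, s, Suc j) = lam a s m (Suc j) - lam a s m j" if "Suc j \<le> n"
    using count_ent[of "\<lambda>j. lam a s m j" j n] that by (simp add: mono_def lam_mono)
qed

lemma eq_from_differences:
  fixes f g :: "nat \<Rightarrow> nat"
  assumes "f 0 = g 0" "mono f" "mono g" "\<And>i. Suc i \<le> m \<Longrightarrow> f (Suc i) - f i = g (Suc i) - g i"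
  shows "i \<le> m \<Longrightarrow> f i = g i"
proof (induction i)
  case (Suc i)
  have "f i \<le> f (Suc i)" "g i \<le> g (Suc i)" using assms(2,3) by (auto simp: mono_def)
  then show ?case using Suc assms(4)[of i] by simp
qed (rule assms(1))

text \<open>Multiplicities add up to counts, which are the shapes along the last line and the last
  column of the growth; \<open>lam_inj\<close> then reverses the growth. Rows from \<open>m\<close>
  on have no variables in the substitution, but they are empty.\<close>

lemma lead_exp_inj:
  assumes "\<alpha> \<in> nat_matrices m n" "\<beta> \<in> nat_matrices m n" "lead_exp (entry \<alpha>) m n = lead_exp (entry \<beta>) m n"
  shows "\<alpha> = \<beta>"
proof (rule poly_mapping_eqI)
  let ?a = "entry \<alpha>" and ?b = "entry \<beta>"
  have r: "lam ?a k i n = lam ?b k i n" if "i \<le> m" for k i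
  proof (cases "k < m")
    case True
    show ?thesis
    proof (rule eq_from_differences[of "\<lambda>i. lam ?a k i n" "\<lambda>i. lam ?b k i n", OF _ _ _ _ that])
      fix i assume "Suc i \<le> m"
      then show "lam ?a k (Suc i) n - lam ?a k i n = lam ?b k (Suc i) n - lam ?b k i n"
        using lookup_lead_exp(1)[OF True, of i ?a n] lookup_lead_exp(1)[OF True, of i ?b n] assms(3) by simp
    qed (auto simp: mono_def lam_mono)
  next
    case False
    then show ?thesis using that by (simp add: lam_eq_0)
  qed
  have c: "lam ?a k m j = lam ?b k m j" if "j \<le> n" for k j
  proof (cases "k < m")
    case True
    show ?thesis
    proof (rule eq_from_differences[of "\<lambda>j. lam ?a k m j" "\<lambda>j. lam ?b k m j", OF _ _ _ _ that])
      fix j assume "Suc j \<le> n"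
      then show "lam ?a k m (Suc j) - lam ?a k m j = lam ?b k m (Suc j) - lam ?b k m j"
        using lookup_lead_exp(2)[OF True, of j n ?a] lookup_lead_exp(2)[OF True, of j n ?b] assms(3) by simp
    qed (auto simp: mono_def lam_mono)
  next
    case False
    then show ?thesis by (simp add: lam_eq_0)
  qed
  fix x :: "nat \<times> nat"
  obtain i j where x: "x = (i, j)" by fastforce
  show "Poly_Mapping.lookup \<alpha> x = Poly_Mapping.lookup \<beta> x"
  proof (cases "i \<in> {1..m} \<and> j \<in> {1..n}")
    case True
    then show ?thesis using lam_inj[of m ?a n ?b i j] r c x by auto
  next
    case False
    then show ?thesis using entry_outside[OF assms(1) False] entry_outside[OF assms(2) False] x by simp
  qed
qed

section \<open>Integrality of coefficients\<close>

definition int_coeffs :: "('c::comm_monoid_add \<Rightarrow>\<^sub>0 complex) \<Rightarrow> bool" where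
  "int_coeffs f \<longleftrightarrow> (\<forall>k. Poly_Mapping.lookup f k \<in> \<int>)"

lemma int_coeffs_single: "c \<in> \<int> \<Longrightarrow> int_coeffs (Poly_Mapping.single k c)"
  by (auto simp: int_coeffs_def lookup_single when_def)

lemma int_coeffs_add: "int_coeffs f \<Longrightarrow> int_coeffs g \<Longrightarrow> int_coeffs (f + g)"
  by (simp add: int_coeffs_def lookup_add)

lemma int_coeffs_0: "int_coeffs 0"
  by (simp add: int_coeffs_def)

lemma int_coeffs_sum: "(\<And>a. a \<in> A \<Longrightarrow> int_coeffs (f a)) \<Longrightarrow> int_coeffs (sum f A)"
  by (induction A rule: infinite_finite_induct) (auto simp: int_coeffs_add int_coeffs_0)

lemma int_coeffs_mult:
  assumes "int_coeffs f" "int_coeffs g" shows "int_coeffs (f * g)"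
proof -
  have e: "f * g = (\<Sum>\<alpha>\<in>Poly_Mapping.keys f. \<Sum>\<beta>\<in>Poly_Mapping.keys g.
      Poly_Mapping.single (\<alpha> + \<beta>) (Poly_Mapping.lookup f \<alpha> * Poly_Mapping.lookup g \<beta>))"
  proof -
    have "(\<Sum>\<alpha>\<in>Poly_Mapping.keys f. Poly_Mapping.single \<alpha> (Poly_Mapping.lookup f \<alpha>)) *
      (\<Sum>\<beta>\<in>Poly_Mapping.keys g. Poly_Mapping.single \<beta> (Poly_Mapping.lookup g \<beta>)) =
      (\<Sum>\<alpha>\<in>Poly_Mapping.keys f. \<Sum>\<beta>\<in>Poly_Mapping.keys g.
      Poly_Mapping.single (\<alpha> + \<beta>) (Poly_Mapping.lookup f \<alpha> * Poly_Mapping.lookup g \<beta>))"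
      by (simp add: sum_product mult_single)
    then show ?thesis by (simp flip: poly_mapping_sum_single)
  qed
  show ?thesis using assms by (subst e) (auto simp: int_coeffs_def intro!: int_coeffs_sum[unfolded int_coeffs_def] int_coeffs_single[unfolded int_coeffs_def])
qed

lemma int_coeffs_1: "int_coeffs 1"
  using int_coeffs_single[of 1 0] by simp

lemma int_coeffs_prod: "(\<And>a. a \<in> A \<Longrightarrow> int_coeffs (f a)) \<Longrightarrow> int_coeffs (prod f A)"
  by (induction A rule: infinite_finite_induct) (auto simp: int_coeffs_mult int_coeffs_1)

lemma int_coeffs_power: "int_coeffs f \<Longrightarrow> int_coeffs (f ^ k)"
  by (induction k) (auto simp: int_coeffs_mult int_coeffs_1)

lemma int_coeffs_signof: "int_coeffs f \<Longrightarrow> int_coeffs (signof p * f)"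
  by (auto simp: sign_def int_coeffs_def)

lemma permutes_lt: "p permutes {0..<n} \<Longrightarrow> (i::nat) < n \<Longrightarrow> p i < n"
  using permutes_in_image[of p "{0..<n}" i] by simp

lemma int_coeffs_bidet: assumes "\<And>i j. int_coeffs (v i j)" shows "int_coeffs (bidet v a m n)"
  unfolding bidet_def
proof (rule int_coeffs_prod)
  fix c
  let ?h = "hgt (\<lambda>k. lam a k m n) c"
  show "int_coeffs (col_det v a m n c)"
    unfolding col_det_def Let_def
    by (subst det_def'[of _ ?h])
      (auto intro!: int_coeffs_sum int_coeffs_signof int_coeffs_prod simp: assms permutes_lt)
qed

lemma int_coeffs_msubst: "(\<And>x. int_coeffs (h x)) \<Longrightarrow> int_coeffs (msubst h \<alpha>)"
  unfolding msubst_def by (intro int_coeffs_prod int_coeffs_power) simp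

lemma det_Ints:
  assumes "\<And>i j. i < n \<Longrightarrow> j < n \<Longrightarrow> f (i, j) \<in> (\<int> :: complex set)"
  shows "det (mat n n f) \<in> \<int>"
  by (subst det_def'[of _ n]) (auto intro!: Ints_sum Ints_mult Ints_prod simp: assms permutes_lt)

section \<open>Determinants in the monomial basis\<close>

definition ldet :: "exponent list \<Rightarrow> (exponent \<Rightarrow> cpoly) \<Rightarrow> complex" where
  "ldet xs F = det (mat (length xs) (length xs) (\<lambda>(i, j). Poly_Mapping.lookup (F (xs ! j)) (xs ! i)))"

abbreviation rsk_poly :: "nat \<Rightarrow> nat \<Rightarrow> exponent \<Rightarrow> cpoly" where
  "rsk_poly m n \<alpha> \<equiv> bidet var (entry \<alpha>) m n"

lemma lookup_scalar_mult:
  "Poly_Mapping.lookup (Poly_Mapping.single 0 c * f) k = (c :: complex) * Poly_Mapping.lookup f k"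
  by (simp flip: mult_map_scale_conv_mult add: map.rep_eq when_def)

text \<open>Taking coefficients at the leading exponents of the substituted bitableaux gives
  \<open>?U\<close>; expanding the bitableaux in monomials first gives \<open>?C * ?M\<close>. Both
  factors are integral and \<open>?U\<close> is unitriangular, so \<open>det ?M\<close> divides
  1.\<close>

lemma ldet_unimodular_sorted:
  assumes "set xs \<subseteq> nat_matrices m n" "distinct xs"
    "\<And>\<alpha>. \<alpha> \<in> set xs \<Longrightarrow> Poly_Mapping.keys (rsk_poly m n \<alpha>) \<subseteq> set xs"
    "sorted (map (\<lambda>\<alpha>. lead_exp (entry \<alpha>) m n) xs)"
  shows "ldet xs (rsk_poly m n) \<in> {1, -1}"
proof -
  let ?N = "length xs" and ?e = "\<lambda>\<alpha>. lead_exp (entry \<alpha>) m n"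
  let ?M = "mat ?N ?N (\<lambda>(i, j). Poly_Mapping.lookup (rsk_poly m n (xs ! j)) (xs ! i))"
  let ?C = "mat ?N ?N (\<lambda>(i, k). Poly_Mapping.lookup (msubst (prod_entry m) (xs ! k)) (?e (xs ! i)))"
  let ?U = "mat ?N ?N (\<lambda>(i, j). Poly_Mapping.lookup (psubst (prod_entry m) (rsk_poly m n (xs ! j))) (?e (xs ! i)))"
  have ps: "psubst (prod_entry m) (rsk_poly m n \<alpha>) = bidet (\<lambda>i j. prod_entry m (i, j)) (entry \<alpha>) m n" for \<alpha>
    by (simp add: psubst_bidet psubst_var)
  have CM: "?C * ?M = ?U"
  proof (rule eq_matI)
    fix i j assume "i < dim_row ?U" "j < dim_col ?U"
    then have ij: "i < ?N" "j < ?N" by auto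
    have "psubst (prod_entry m) (rsk_poly m n (xs ! j)) =
      (\<Sum>\<alpha>\<in>set xs. Poly_Mapping.single 0 (Poly_Mapping.lookup (rsk_poly m n (xs ! j)) \<alpha>) * msubst (prod_entry m) \<alpha>)"
      by (rule psubst_superset) (use assms(3) ij in auto)
    also have "\<dots> = (\<Sum>k<?N. Poly_Mapping.single 0 (Poly_Mapping.lookup (rsk_poly m n (xs ! j)) (xs ! k)) * msubst (prod_entry m) (xs ! k))"
      by (rule sum.reindex_bij_betw[symmetric]) (use bij_betw_nth[OF assms(2)] in \<open>auto simp: atLeast0LessThan\<close>)
    finally show "(?C * ?M) $$ (i, j) = ?U $$ (i, j)"
      using ij by (simp add: scalar_prod_def lookup_sum lookup_scalar_mult atLeast0LessThan) (simp add: mult.commute)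
  qed auto
  \<comment> \<open>A nonzero coefficient bounds the leading exponent of \<open>xs ! i\<close> by
    that of \<open>xs ! j\<close>, and sorting gives the opposite bound. Equal leading exponents
    would be a repetition in the list.\<close>
  have "?U $$ (i, j) = 0" if "j < i" "i < ?N" for i j
  proof (rule ccontr)
    assume "?U $$ (i, j) \<noteq> 0"
    then have "?e (xs ! i) \<le> ?e (xs ! j)" using that lead_lookup(2)[OF lead_bidet] by (auto simp: ps)
    moreover have "?e (xs ! j) \<le> ?e (xs ! i)" using sorted_nth_mono[OF assms(4), of j i] that by simp
    ultimately have "?e (xs ! i) = ?e (xs ! j)" by (rule antisym)
    moreover have "xs ! i \<in> nat_matrices m n" "xs ! j \<in> nat_matrices m n" using assms(1) that by auto
    ultimately have "xs ! i = xs ! j" using lead_exp_inj by blast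
    then show False using assms(2) that by (simp add: nth_eq_iff_index_eq)
  qed
  then have "upper_triangular ?U" by (auto simp: upper_triangular_def)
  moreover have "?U $$ (i, i) = 1" if "i < ?N" for i
    using that lead_lookup(1)[OF lead_bidet] by (simp add: ps)
  ultimately have "det ?U = 1"
    by (subst det_upper_triangular[of _ ?N]) (auto simp: prod_list_diag_prod intro!: prod.neutral)
  then have 1: "det ?C * det ?M = 1" using det_mult[of ?C ?N ?M] CM by simp
  have ia: "int_coeffs (prod_entry m x)" for x
    by (cases x) (auto simp: prod_entry_def lmonom_def intro!: int_coeffs_sum int_coeffs_mult int_coeffs_single)
  have iv: "int_coeffs (var i j)" for i j by (simp add: var_def monomial_def int_coeffs_single)
  have "det ?C \<in> \<int>" using int_coeffs_msubst[of "prod_entry m", OF ia] by (intro det_Ints) (auto simp: int_coeffs_def)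
  moreover have "det ?M \<in> \<int>" using int_coeffs_bidet[of var, OF iv] by (intro det_Ints) (auto simp: int_coeffs_def)
  ultimately obtain c d where cd: "det ?C = of_int c" "det ?M = of_int d" by (auto elim!: Ints_cases)
  then have "(of_int (c * d) :: complex) = of_int 1" using 1 by simp
  then have "c * d = 1" by (simp only: of_int_eq_iff)
  then have "d = 1 \<or> d = -1" by (metis zmult_eq_1_iff)
  then show ?thesis using cd by (auto simp: ldet_def)
qed


section \<open>Independence of the chosen basis\<close>

lemma lookup_scale: "Poly_Mapping.lookup (cpoly_scale c f) k = c * Poly_Mapping.lookup f k"
  by (simp add: cpoly_scale_def lookup_scalar_mult)

lemma inj_monomial: "inj monomial"
  by (auto simp: inj_def monomial_def dest!: arg_cong[of _ _ Poly_Mapping.keys])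

lemma lookup_scale_monomial: "Poly_Mapping.lookup (cpoly_scale c (monomial \<alpha>)) \<beta> = (if \<alpha> = \<beta> then c else 0)"
  by (simp add: lookup_scale monomial_def lookup_single when_def)

lemma lookup_monomial_sum:
  assumes "finite S"
  shows "Poly_Mapping.lookup (\<Sum>\<alpha>\<in>S. cpoly_scale (u \<alpha>) (monomial \<alpha>)) \<beta> = (if \<beta> \<in> S then u \<beta> else 0)"
  using assms by (simp add: lookup_sum lookup_scale_monomial)

lemma monomial_expansion:
  assumes "finite S" "Poly_Mapping.keys f \<subseteq> S"
  shows "f = (\<Sum>\<alpha>\<in>S. cpoly_scale (Poly_Mapping.lookup f \<alpha>) (monomial \<alpha>))"
  by (rule poly_mapping_eqI) (use assms in \<open>auto simp: lookup_monomial_sum in_keys_iff\<close>)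

lemma independent_monomials:
  assumes "finite S" shows "cpoly.independent (monomial ` S)"
proof
  assume "cpoly.dependent (monomial ` S)"
  then obtain u where u: "\<exists>v\<in>monomial ` S. u v \<noteq> 0" "(\<Sum>v\<in>monomial ` S. cpoly_scale (u v) v) = 0"
    using cpoly.dependent_finite[of "monomial ` S"] assms by auto
  have "(\<Sum>\<alpha>\<in>S. cpoly_scale (u (monomial \<alpha>)) (monomial \<alpha>)) = 0"
    using u(2) by (subst (asm) sum.reindex) (auto intro: inj_on_subset[OF inj_monomial])
  then have "u (monomial \<alpha>) = 0" if "\<alpha> \<in> S" for \<alpha>
    using lookup_monomial_sum[OF assms, of "\<lambda>\<alpha>. u (monomial \<alpha>)" \<alpha>] that by simp
  then show False using u(1) by auto
qed

lemma span_monomials: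
  assumes "finite S" shows "f \<in> cpoly.span (monomial ` S) \<longleftrightarrow> Poly_Mapping.keys f \<subseteq> S"
proof
  assume "Poly_Mapping.keys f \<subseteq> S"
  then have "f = (\<Sum>\<alpha>\<in>S. cpoly_scale (Poly_Mapping.lookup f \<alpha>) (monomial \<alpha>))" by (rule monomial_expansion[OF assms])
  moreover have "\<dots> \<in> cpoly.span (monomial ` S)"
    by (intro cpoly.span_sum cpoly.span_scale cpoly.span_base) auto
  ultimately show "f \<in> cpoly.span (monomial ` S)" by simp
next
  assume "f \<in> cpoly.span (monomial ` S)"
  then show "Poly_Mapping.keys f \<subseteq> S"
  proof (induction rule: cpoly.span_induct_alt)
    case (step c x y)
    have "Poly_Mapping.keys (cpoly_scale c x) \<subseteq> S"
      using step(1) by (auto simp: in_keys_iff lookup_scale_monomial split: if_splits)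
    then show ?case using step Poly_Mapping.keys_add[of "cpoly_scale c x" y] by blast
  qed simp
qed

lemma representation_monomials:
  assumes "finite S" "Poly_Mapping.keys f \<subseteq> S" "\<alpha> \<in> S"
  shows "cpoly.representation (monomial ` S) f (monomial \<alpha>) = Poly_Mapping.lookup f \<alpha>"
proof -
  have f: "f \<in> cpoly.span (monomial ` S)" using assms by (simp add: span_monomials)
  note ind = independent_monomials[OF assms(1)]
  have "f = (\<Sum>b\<in>monomial ` S. cpoly_scale (cpoly.representation (monomial ` S) f b) b)"
    by (rule cpoly.sum_representation_eq[OF ind f _ order_refl, symmetric]) (use assms(1) in simp)
  also have "\<dots> = (\<Sum>\<alpha>\<in>S. cpoly_scale (cpoly.representation (monomial ` S) f (monomial \<alpha>)) (monomial \<alpha>))"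
    by (subst sum.reindex) (auto intro: inj_on_subset[OF inj_monomial])
  finally have "Poly_Mapping.lookup f \<alpha> = Poly_Mapping.lookup
    (\<Sum>\<alpha>\<in>S. cpoly_scale (cpoly.representation (monomial ` S) f (monomial \<alpha>)) (monomial \<alpha>)) \<alpha>" by simp
  then show ?thesis using assms by (simp add: lookup_monomial_sum)
qed

lemma is_basis_of_mem:
  assumes "is_basis_of X V" "i < length X" shows "X ! i \<in> set X" "X ! i \<in> V"
  using assms cpoly.span_base[of "X ! i" "set X"] unfolding is_basis_of_def by auto

text \<open>Stated for the coordinates of \<open>T w\<close>, so that one formula serves for
  products with the matrix of \<open>T\<close> and, with the identity as \<open>T\<close>, for the
  change of basis.\<close>

lemma representation_change:
  assumes "is_basis_of X V" "is_basis_of Y V" "w \<in> V" "x \<in> set X"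
    and T: "\<And>u. T (\<Sum>k<length Y. cpoly_scale (u k) (Y ! k)) = (\<Sum>k<length Y. cpoly_scale (u k) (T (Y ! k)))"
    and TV: "\<And>v. v \<in> V \<Longrightarrow> T v \<in> V"
  shows "cpoly.representation (set X) (T w) x =
    (\<Sum>k<length Y. cpoly.representation (set X) (T (Y ! k)) x * cpoly.representation (set Y) w (Y ! k))"
proof -
  let ?r = "\<lambda>k. cpoly.representation (set Y) w (Y ! k)"
  have X: "cpoly.independent (set X)" "cpoly.span (set X) = V" and Y: "distinct Y" "cpoly.independent (set Y)" "cpoly.span (set Y) = V"
    using assms(1,2) by (auto simp: is_basis_of_def)
  note YV = is_basis_of_mem(2)[OF assms(2)]
  have "w = (\<Sum>b\<in>set Y. cpoly_scale (cpoly.representation (set Y) w b) b)"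
    by (rule cpoly.sum_representation_eq[OF Y(2) _ _ order_refl, symmetric]) (use assms(3) Y in auto)
  also have "\<dots> = (\<Sum>k<length Y. cpoly_scale (?r k) (Y ! k))"
    by (rule sum.reindex_bij_betw[symmetric]) (use bij_betw_nth[OF Y(1)] in \<open>auto simp: atLeast0LessThan\<close>)
  finally have "T w = (\<Sum>k<length Y. cpoly_scale (?r k) (T (Y ! k)))" using T[of ?r] by simp
  also have "cpoly.representation (set X) \<dots> = (\<lambda>b. \<Sum>k<length Y. cpoly.representation (set X) (cpoly_scale (?r k) (T (Y ! k))) b)"
    by (rule cpoly.representation_sum[OF X(1)]) (use X(2) YV TV in \<open>auto intro: cpoly.span_scale\<close>)
  finally show ?thesis
    using YV TV X by (simp add: cpoly.representation_scale[OF X(1)] mult.commute)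
qed

text \<open>\<open>restriction_det\<close> uses a basis chosen by \<open>SOME\<close>; conjugation
  by the matrices of the base change makes the monomial basis available.\<close>

lemma restriction_matrix_basis_change:
  assumes X: "is_basis_of X V" and Y: "is_basis_of Y V"
    and add: "\<And>f g. T (f + g) = T f + T g" and scale: "\<And>c f. T (cpoly_scale c f) = cpoly_scale c (T f)"
    and TV: "\<And>v. v \<in> V \<Longrightarrow> T v \<in> V"
  shows "det (restriction_matrix X T) = det (restriction_matrix Y T)"
proof -
  have T0: "T 0 = 0" using scale[of 0 0] by simp
  have Ts: "T (\<Sum>k\<in>A. cpoly_scale (u k) (v k)) = (\<Sum>k\<in>A. cpoly_scale (u k) (T (v k)))" for u v and A :: "nat set"
    by (induction A rule: infinite_finite_induct) (simp_all add: T0 add scale)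
  have len: "length X = length Y"
  proof -
    have "length X = cpoly.dim V"
      using X by (auto simp: is_basis_of_def distinct_card[symmetric] cpoly.dim_span_eq_card_independent[symmetric])
    moreover have "length Y = cpoly.dim V"
      using Y by (auto simp: is_basis_of_def distinct_card[symmetric] cpoly.dim_span_eq_card_independent[symmetric])
    ultimately show ?thesis by simp
  qed
  let ?n = "length Y"
  have memb: "\<And>i. i < ?n \<Longrightarrow> X ! i \<in> set X \<and> X ! i \<in> V" "\<And>i. i < ?n \<Longrightarrow> Y ! i \<in> set Y \<and> Y ! i \<in> V"
    using is_basis_of_mem[OF X] is_basis_of_mem[OF Y] len by simp_all
  define P where "P = (\<lambda>X Y. mat ?n ?n (\<lambda>(i, j). cpoly.representation (set X) (Y ! j) (X ! i)))"
  have PP: "P X Y * P Y X = 1\<^sub>m ?n" if "is_basis_of X V" "is_basis_of Y V" "length X = ?n" "length Y = ?n" for X Y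
  proof (rule eq_matI)
    fix i j assume "i < dim_row (1\<^sub>m ?n :: complex mat)" "j < dim_col (1\<^sub>m ?n :: complex mat)"
    then have ij: "i < ?n" "j < ?n" by auto
    have XV: "X ! j \<in> V" "X ! i \<in> set X" using is_basis_of_mem[OF that(1)] that(3) ij by simp_all
    have "cpoly.representation (set X) (X ! j) (X ! i) =
      (\<Sum>k<length Y. cpoly.representation (set X) (Y ! k) (X ! i) * cpoly.representation (set Y) (X ! j) (Y ! k))"
      using representation_change[of X V Y "X ! j" "X ! i" "\<lambda>x. x"] that XV by simp
    moreover have "cpoly.representation (set X) (X ! j) (X ! i) = (if i = j then 1 else 0)"
      using that ij by (subst cpoly.representation_basis) (auto simp: is_basis_of_def nth_eq_iff_index_eq)
    ultimately show "(P X Y * P Y X) $$ (i, j) = 1\<^sub>m ?n $$ (i, j)"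
      using ij that by (simp add: P_def scalar_prod_def atLeast0LessThan)
  qed (auto simp: P_def)
  have "restriction_matrix X T = P X Y * restriction_matrix Y T * P Y X"
  proof -
    have 1: "restriction_matrix Y T * P Y X = mat ?n ?n (\<lambda>(k, j). cpoly.representation (set Y) (T (X ! j)) (Y ! k))"
    proof (rule eq_matI)
      fix i j assume "i < dim_row (mat ?n ?n (\<lambda>(k, j). cpoly.representation (set Y) (T (X ! j)) (Y ! k)))"
        "j < dim_col (mat ?n ?n (\<lambda>(k, j). cpoly.representation (set Y) (T (X ! j)) (Y ! k)))"
      then have ij: "i < ?n" "j < ?n" by auto
      then show "(restriction_matrix Y T * P Y X) $$ (i, j) = mat ?n ?n (\<lambda>(k, j). cpoly.representation (set Y) (T (X ! j)) (Y ! k)) $$ (i, j)"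
        using representation_change[OF Y Y _ _ Ts TV, of "X ! j" "Y ! i"] memb
        by (simp add: P_def restriction_matrix_def scalar_prod_def atLeast0LessThan)
    qed (auto simp: P_def restriction_matrix_def)
    have "restriction_matrix X T = P X Y * (restriction_matrix Y T * P Y X)"
      unfolding 1
    proof (rule eq_matI)
      fix i j assume "i < dim_row (P X Y * mat ?n ?n (\<lambda>(k, j). cpoly.representation (set Y) (T (X ! j)) (Y ! k)))"
        "j < dim_col (P X Y * mat ?n ?n (\<lambda>(k, j). cpoly.representation (set Y) (T (X ! j)) (Y ! k)))"
      then have ij: "i < ?n" "j < ?n" by (auto simp: P_def)
      then show "restriction_matrix X T $$ (i, j) = (P X Y * mat ?n ?n (\<lambda>(k, j). cpoly.representation (set Y) (T (X ! j)) (Y ! k))) $$ (i, j)"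
        using representation_change[of X V Y "T (X ! j)" "X ! i" "\<lambda>x. x"] X Y memb TV len
        by (simp add: P_def restriction_matrix_def scalar_prod_def atLeast0LessThan)
    qed (auto simp: P_def restriction_matrix_def len)
    also have "\<dots> = P X Y * restriction_matrix Y T * P Y X"
      by (rule assoc_mult_mat[symmetric, of _ ?n ?n _ ?n _ ?n]) (auto simp: P_def restriction_matrix_def)
    finally show ?thesis .
  qed
  then have "similar_mat (restriction_matrix X T) (restriction_matrix Y T)"
    using PP[OF X Y len refl] PP[OF Y X refl len]
    by (intro similar_matI[of _ _ "P X Y" "P Y X" ?n]) (auto simp: P_def restriction_matrix_def len)
  then show ?thesis by (rule det_similar)
qed

lemma RSK_op_superset:
  "finite S \<Longrightarrow> Poly_Mapping.keys f \<subseteq> S \<Longrightarrow>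
    RSK_op m n f = (\<Sum>\<alpha>\<in>S. cpoly_scale (Poly_Mapping.lookup f \<alpha>) (case rsk m n \<alpha> of (P, Q) \<Rightarrow> bitableau P Q))"
  unfolding RSK_op_def by (intro sum.mono_neutral_left) (auto simp: in_keys_iff)

lemma RSK_op_add: "RSK_op m n (f + g) = RSK_op m n f + RSK_op m n g"
proof -
  let ?S = "Poly_Mapping.keys f \<union> Poly_Mapping.keys g"
  have "Poly_Mapping.keys (f + g) \<subseteq> ?S" by (rule Poly_Mapping.keys_add)
  then show ?thesis
    by (simp add: RSK_op_superset[of ?S] lookup_add cpoly.scale_left_distrib sum.distrib)
qed

lemma RSK_op_scale: "RSK_op m n (cpoly_scale c f) = cpoly_scale c (RSK_op m n f)"
proof -
  have "Poly_Mapping.keys (cpoly_scale c f) \<subseteq> Poly_Mapping.keys f" by (auto simp: in_keys_iff lookup_scale)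
  then show ?thesis
    by (simp add: RSK_op_superset[of "Poly_Mapping.keys f"] lookup_scale cpoly.scale_sum_right)
qed

lemma RSK_op_monomial:
  "\<alpha> \<in> nat_matrices m n \<Longrightarrow> RSK_op m n (monomial \<alpha>) = rsk_poly m n \<alpha>"
  by (simp add: RSK_op_def monomial_def bitableau_rsk)

lemma restriction_det_eq_ldet:
  assumes "distinct xs" "set xs \<subseteq> nat_matrices m n"
    "\<And>\<alpha>. \<alpha> \<in> set xs \<Longrightarrow> Poly_Mapping.keys (rsk_poly m n \<alpha>) \<subseteq> set xs"
  shows "restriction_det (cpoly.span (monomial ` set xs)) (RSK_op m n) = ldet xs (rsk_poly m n)"
proof -
  let ?V = "cpoly.span (monomial ` set xs)" and ?T = "RSK_op m n"
  have b: "is_basis_of (map monomial xs) ?V"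
    using assms(1) independent_monomials[of "set xs"]
    by (auto simp: is_basis_of_def distinct_map intro: inj_on_subset[OF inj_monomial])
  then have b': "is_basis_of (SOME bs. is_basis_of bs ?V) ?V" by (rule someI)
  have TV: "?T f \<in> ?V" if "f \<in> ?V" for f
  proof -
    have "Poly_Mapping.keys f \<subseteq> set xs" using that by (simp add: span_monomials)
    then have "?T f = (\<Sum>\<alpha>\<in>set xs. cpoly_scale (Poly_Mapping.lookup f \<alpha>) (rsk_poly m n \<alpha>))"
      using assms(2) by (subst RSK_op_superset[of "set xs"]) (auto intro!: sum.cong simp: bitableau_rsk)
    also have "\<dots> \<in> ?V" using assms(3) by (intro cpoly.span_sum cpoly.span_scale) (simp add: span_monomials)
    finally show ?thesis .
  qed
  have "restriction_det ?V ?T = det (restriction_matrix (map monomial xs) ?T)"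
    unfolding restriction_det_def
    by (rule restriction_matrix_basis_change[OF b' b RSK_op_add RSK_op_scale TV])
  also have "restriction_matrix (map monomial xs) ?T =
      mat (length xs) (length xs) (\<lambda>(i, j). Poly_Mapping.lookup (rsk_poly m n (xs ! j)) (xs ! i))"
  proof (rule eq_matI)
    fix i j assume "i < dim_row (mat (length xs) (length xs) (\<lambda>(i, j). Poly_Mapping.lookup (rsk_poly m n (xs ! j)) (xs ! i)))"
      "j < dim_col (mat (length xs) (length xs) (\<lambda>(i, j). Poly_Mapping.lookup (rsk_poly m n (xs ! j)) (xs ! i)))"
    then have ij: "i < length xs" "j < length xs" by auto
    then have "xs ! j \<in> nat_matrices m n" using assms(2) by auto
    then show "restriction_matrix (map monomial xs) ?T $$ (i, j) =
      mat (length xs) (length xs) (\<lambda>(i, j). Poly_Mapping.lookup (rsk_poly m n (xs ! j)) (xs ! i)) $$ (i, j)"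
      using ij assms(3)[of "xs ! j"] by (simp add: restriction_matrix_def RSK_op_monomial representation_monomials)
  qed (auto simp: restriction_matrix_def)
  finally show ?thesis by (simp add: ldet_def)
qed

section \<open>Determinants of weight spaces\<close>

definition weight_exps :: "nat list \<Rightarrow> nat list \<Rightarrow> exponent set" where
  "weight_exps \<sigma> \<pi> = {\<alpha> \<in> nat_matrices (length \<sigma>) (length \<pi>).
     (\<forall>i<length \<sigma>. row_sum (length \<pi>) \<alpha> (Suc i) = \<sigma> ! i) \<and>
     (\<forall>j<length \<pi>. col_sum (length \<sigma>) \<alpha> (Suc j) = \<pi> ! j)}"

definition degree_exps :: "nat \<Rightarrow> nat \<Rightarrow> nat \<Rightarrow> exponent set" where
  "degree_exps m n d = {\<alpha> \<in> nat_matrices m n. (\<Sum>i\<in>{1..m}. row_sum n \<alpha> i) = d}"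

lemma sum_1_to: "(\<Sum>i\<in>{1..m}. f i) = (\<Sum>i<m. f (Suc i))"
  by (induction m) auto

lemma ball_1_to: "(\<forall>i\<in>{1..m}. P i) \<longleftrightarrow> (\<forall>i<m. P (Suc i))"
proof
  assume *: "\<forall>i<m. P (Suc i)"
  show "\<forall>i\<in>{1..m}. P i"
  proof
    fix i assume "i \<in> {1..m}" then show "P i" using * by (cases i) auto
  qed
qed auto

lemma weight_space_weight_exps: "weight_space \<sigma> \<pi> = cpoly.span (monomial ` weight_exps \<sigma> \<pi>)"
  by (simp only: weight_space_def weight_exps_def row_sum_def col_sum_def ball_1_to diff_Suc_1)

lemma degree_space_degree_exps: "degree_space m n d = cpoly.span (monomial ` degree_exps m n d)"
  by (simp add: degree_space_def degree_exps_def row_sum_def)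

lemma finite_degree_exps: "finite (degree_exps m n d)"
proof (rule inj_on_finite)
  let ?S = "{1..m} \<times> {1..n}"
  show "inj_on (\<lambda>\<alpha>. restrict (Poly_Mapping.lookup \<alpha>) ?S) (degree_exps m n d)"
  proof (rule inj_onI, rule poly_mapping_eqI)
    fix \<alpha> \<beta> x assume *: "\<alpha> \<in> degree_exps m n d" "\<beta> \<in> degree_exps m n d" "restrict (Poly_Mapping.lookup \<alpha>) ?S = restrict (Poly_Mapping.lookup \<beta>) ?S"
    show "Poly_Mapping.lookup \<alpha> x = Poly_Mapping.lookup \<beta> x"
    proof (cases "x \<in> ?S")
      case True
      then show ?thesis using fun_cong[OF *(3), of x] by simp
    next
      case False
      then have "x \<notin> Poly_Mapping.keys \<alpha>" "x \<notin> Poly_Mapping.keys \<beta>" using * by (auto simp: degree_exps_def nat_matrices_def)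
      then show ?thesis by (simp add: in_keys_iff)
    qed
  qed
  show "(\<lambda>\<alpha>. restrict (Poly_Mapping.lookup \<alpha>) ?S) ` degree_exps m n d \<subseteq> ?S \<rightarrow>\<^sub>E {..d}"
  proof (rule image_subsetI, rule restrict_PiE_iff[THEN iffD2], rule ballI)
    fix \<alpha> x assume "\<alpha> \<in> degree_exps m n d" "x \<in> ?S"
    then obtain i j where x: "x = (i, j)" "i \<in> {1..m}" "j \<in> {1..n}" by auto
    have "entry \<alpha> i j \<le> row_sum n \<alpha> i" unfolding row_sum_def by (rule member_le_sum) (use x in auto)
    also have "\<dots> \<le> (\<Sum>i\<in>{1..m}. row_sum n \<alpha> i)" by (rule member_le_sum) (use x in auto)
    finally show "Poly_Mapping.lookup \<alpha> x \<in> {..d}" using x \<open>\<alpha> \<in> degree_exps m n d\<close> by (simp add: degree_exps_def)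
  qed
  show "finite (?S \<rightarrow>\<^sub>E {..d})" by (intro finite_PiE) auto
qed

lemma weight_exps_subset_degree_exps: "weight_exps \<sigma> \<pi> \<subseteq> degree_exps (length \<sigma>) (length \<pi>) (sum_list \<sigma>)"
  by (auto simp: weight_exps_def degree_exps_def sum_1_to sum_list_sum_nth atLeast0LessThan simp del: One_nat_def)

lemma finite_weight_exps: "finite (weight_exps \<sigma> \<pi>)"
  using weight_exps_subset_degree_exps finite_degree_exps by (rule finite_subset)

lemma keys_rsk_poly_weight_exps: "\<alpha> \<in> weight_exps \<sigma> \<pi> \<Longrightarrow> Poly_Mapping.keys (rsk_poly (length \<sigma>) (length \<pi>) \<alpha>) \<subseteq> weight_exps \<sigma> \<pi>"
  using homog_bidet[of \<alpha> "length \<sigma>" "length \<pi>"] by (auto simp: weight_exps_def homog_def)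

lemma keys_rsk_poly_degree_exps: "\<alpha> \<in> degree_exps m n d \<Longrightarrow> Poly_Mapping.keys (rsk_poly m n \<alpha>) \<subseteq> degree_exps m n d"
  using homog_bidet[of \<alpha> m n] by (auto simp: degree_exps_def homog_def)

lemma det_RSK_weight_ldet:
  assumes "distinct xs" "set xs = weight_exps \<sigma> \<pi>"
  shows "det_RSK_weight \<sigma> \<pi> = ldet xs (rsk_poly (length \<sigma>) (length \<pi>))"
  unfolding det_RSK_weight_def weight_space_weight_exps assms(2)[symmetric]
  by (rule restriction_det_eq_ldet) (use assms keys_rsk_poly_weight_exps in \<open>auto simp: weight_exps_def\<close>)

lemma det_RSK_weight_unimodular: "det_RSK_weight \<sigma> \<pi> \<in> {1, -1}"
proof -
  obtain xs where xs: "distinct xs" "set xs = weight_exps \<sigma> \<pi>" using finite_distinct_list[OF finite_weight_exps] by blast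
  let ?e = "\<lambda>\<alpha>. lead_exp (entry \<alpha>) (length \<sigma>) (length \<pi>)"
  have ys: "distinct (sort_key ?e xs)" "set (sort_key ?e xs) = weight_exps \<sigma> \<pi>" using xs by auto
  show ?thesis unfolding det_RSK_weight_ldet[OF ys]
    by (rule ldet_unimodular_sorted) (use ys keys_rsk_poly_weight_exps in \<open>auto simp: weight_exps_def\<close>)
qed

text \<open>Listing the target exponents as \<open>map g xs\<close> makes the two matrices literally
  equal.\<close>

lemma det_RSK_weight_transport:
  assumes g: "inj_on g (weight_exps \<sigma> \<pi>)" "g ` weight_exps \<sigma> \<pi> = weight_exps \<sigma>' \<pi>'"
    and F: "\<And>\<alpha> \<beta>. \<alpha> \<in> weight_exps \<sigma> \<pi> \<Longrightarrow> \<beta> \<in> weight_exps \<sigma> \<pi> \<Longrightarrow>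
      Poly_Mapping.lookup (rsk_poly (length \<sigma>') (length \<pi>') (g \<alpha>)) (g \<beta>) =
      Poly_Mapping.lookup (rsk_poly (length \<sigma>) (length \<pi>) \<alpha>) \<beta>"
  shows "det_RSK_weight \<sigma>' \<pi>' = det_RSK_weight \<sigma> \<pi>"
proof -
  obtain xs where xs: "distinct xs" "set xs = weight_exps \<sigma> \<pi>" using finite_distinct_list[OF finite_weight_exps] by blast
  have ys: "distinct (map g xs)" "set (map g xs) = weight_exps \<sigma>' \<pi>'" using xs g by (auto simp: distinct_map)
  have "ldet (map g xs) (rsk_poly (length \<sigma>') (length \<pi>')) = ldet xs (rsk_poly (length \<sigma>) (length \<pi>))"
    unfolding ldet_def
    by (intro arg_cong[of _ _ det] eq_matI) (auto intro!: F simp: xs(2)[symmetric])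
  then show ?thesis using det_RSK_weight_ldet[OF ys] det_RSK_weight_ldet[OF xs] by simp
qed

section \<open>Comparison of weights: transposition, zero entries, corners\<close>

lemma entry_relabel_swap: "entry (relabel prod.swap \<alpha>) i j = entry \<alpha> j i"
  using lookup_relabel(1)[of prod.swap \<alpha> "(j, i)"] by simp

lemma relabel_swap_weight_exps: "\<alpha> \<in> weight_exps \<sigma> \<pi> \<Longrightarrow> relabel prod.swap \<alpha> \<in> weight_exps \<pi> \<sigma>"
proof -
  assume \<alpha>: "\<alpha> \<in> weight_exps \<sigma> \<pi>"
  have "Poly_Mapping.keys (relabel prod.swap \<alpha>) \<subseteq> {1..length \<pi>} \<times> {1..length \<sigma>}"
  proof
    fix x assume "x \<in> Poly_Mapping.keys (relabel prod.swap \<alpha>)"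
    then have "entry \<alpha> (snd x) (fst x) \<noteq> 0" by (cases x) (simp add: in_keys_iff entry_relabel_swap)
    then have "(snd x, fst x) \<in> Poly_Mapping.keys \<alpha>" by (simp add: in_keys_iff)
    then show "x \<in> {1..length \<pi>} \<times> {1..length \<sigma>}" using \<alpha> by (cases x) (auto simp: weight_exps_def nat_matrices_def)
  qed
  then show ?thesis using \<alpha> by (simp add: weight_exps_def nat_matrices_def row_sum_def col_sum_def entry_relabel_swap)
qed

lemma det_RSK_weight_flip: "det_RSK_weight \<pi> \<sigma> = det_RSK_weight \<sigma> \<pi>"
proof (rule det_RSK_weight_transport)
  have inv: "relabel prod.swap (relabel prod.swap \<alpha>) = \<alpha>" for \<alpha>
  proof (rule poly_mapping_eqI)
    fix x show "Poly_Mapping.lookup (relabel prod.swap (relabel prod.swap \<alpha>)) x = Poly_Mapping.lookup \<alpha> x"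
      by (cases x) (simp add: entry_relabel_swap)
  qed
  show "inj_on (relabel prod.swap) (weight_exps \<sigma> \<pi>)" by (rule inj_on_inverseI) (rule inv)
  show "relabel prod.swap ` weight_exps \<sigma> \<pi> = weight_exps \<pi> \<sigma>"
  proof
    show "weight_exps \<pi> \<sigma> \<subseteq> relabel prod.swap ` weight_exps \<sigma> \<pi>"
    proof
      fix \<alpha> assume "\<alpha> \<in> weight_exps \<pi> \<sigma>"
      then show "\<alpha> \<in> relabel prod.swap ` weight_exps \<sigma> \<pi>"
        by (intro image_eqI[of _ _ "relabel prod.swap \<alpha>"] relabel_swap_weight_exps) (simp_all add: inv)
    qed
  qed (auto intro: relabel_swap_weight_exps)
  fix \<alpha> \<beta>
  have "rsk_poly (length \<pi>) (length \<sigma>) (relabel prod.swap \<alpha>) = bidet (\<lambda>i j. var j i) (entry \<alpha>) (length \<sigma>) (length \<pi>)"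
    using bidet_flip[of var "entry \<alpha>"] by (simp add: entry_relabel_swap)
  also have "\<dots> = psubst (\<lambda>x. var (fst (prod.swap x)) (snd (prod.swap x))) (rsk_poly (length \<sigma>) (length \<pi>) \<alpha>)"
    by (simp add: psubst_bidet psubst_var)
  finally show "Poly_Mapping.lookup (rsk_poly (length \<pi>) (length \<sigma>) (relabel prod.swap \<alpha>)) (relabel prod.swap \<beta>) =
      Poly_Mapping.lookup (rsk_poly (length \<sigma>) (length \<pi>) \<alpha>) \<beta>"
    by (simp only: lookup_psubst_relabel[OF inj_swap])
qed

text \<open>The increasing injection that omits \<open>p\<close>; it renumbers the rows when a zero
  row is inserted at \<open>p\<close>.\<close>

definition skip :: "nat \<Rightarrow> nat \<Rightarrow> nat" where
  "skip p i = (if i < p then i else Suc i)"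

lemma bij_betw_skip: "1 \<le> p \<Longrightarrow> p \<le> Suc m \<Longrightarrow> bij_betw (skip p) {1..m} ({1..Suc m} - {p})"
  by (rule bij_betw_byWitness[where f' = "\<lambda>i. if i < p then i else i - 1"]) (auto simp: skip_def)

lemma sum_skip:
  assumes "1 \<le> p" "p \<le> Suc m"
  shows "(\<Sum>i\<in>{1..Suc m}. h i) = h p + (\<Sum>i\<in>{1..m}. h (skip p i))"
proof -
  have "(\<Sum>i\<in>{1..Suc m}. h i) = h p + (\<Sum>i\<in>{1..Suc m} - {p}. h i)" using assms by (intro sum.remove) auto
  then show ?thesis by (simp only: sum.reindex_bij_betw[OF bij_betw_skip[OF assms]])
qed

lemma inj_skip: "inj (map_prod (skip p) id)"
  by (intro prod.inj_map) (auto simp: inj_def skip_def split: if_splits)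

lemma entry_relabel_skip:
  assumes "1 \<le> p"
  shows "entry (relabel (map_prod (skip p) id) \<alpha>) i j = (if i < p then entry \<alpha> i j else if i = p then 0 else entry \<alpha> (i - 1) j)"
proof -
  note l = lookup_relabel(1)[OF inj_skip[of p], of \<alpha>] lookup_relabel(2)[OF inj_skip[of p], where \<alpha> = \<alpha>]
  consider "i < p" | "i = p" | "i > p" by linarith
  then show ?thesis
  proof cases
    case 1
    then show ?thesis using l(1)[of "(i, j)"] by (simp add: skip_def)
  next
    case 2
    then have "(i, j) \<notin> range (map_prod (skip p) id)" by (auto simp: skip_def split: if_splits)
    then show ?thesis using l(2)[of "(i, j)"] 2 by simp
  next
    case 3
    then have "\<not> i - 1 < p" "Suc (i - 1) = i" by auto
    then show ?thesis using l(1)[of "(i - 1, j)"] 3 by (simp add: skip_def)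
  qed
qed

lemma nth_skip: "i < length (xs @ ys) \<Longrightarrow> (xs @ z # ys) ! (skip (Suc (length xs)) (Suc i) - 1) = (xs @ ys) ! i"
  by (auto simp: skip_def nth_append)

text \<open>A zero in the weight forces a zero row, so every exponent arises by renumbering from the
  shorter weight.\<close>

lemma det_RSK_weight_zero: "det_RSK_weight (xs @ 0 # ys) \<pi> = det_RSK_weight (xs @ ys) \<pi>"
proof (rule det_RSK_weight_transport)
  let ?p = "Suc (length xs)" and ?m = "length (xs @ ys)" and ?n = "length \<pi>" and ?\<sigma> = "xs @ 0 # ys" and ?\<sigma>' = "xs @ ys"
  let ?f = "map_prod (skip ?p) id"
  let ?g = "relabel ?f"
  have p: "1 \<le> ?p" "?p \<le> Suc ?m" by auto
  have lm: "length ?\<sigma> = Suc ?m" by simp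
  note e = entry_relabel_skip[OF p(1)]
  have es: "entry (?g \<beta>) (skip ?p i) j = entry \<beta> i j" for \<beta> i j
    using lookup_relabel(1)[OF inj_skip[of ?p], of \<beta> "(i, j)"] by simp
  have mem: "?g \<beta> \<in> weight_exps ?\<sigma> \<pi> \<longleftrightarrow> \<beta> \<in> weight_exps ?\<sigma>' \<pi>" for \<beta>
  proof -
    have c: "col_sum (Suc ?m) (?g \<beta>) j = col_sum ?m \<beta> j" for j
      unfolding col_sum_def sum_skip[OF p] es by (simp add: e)
    have r: "row_sum ?n (?g \<beta>) (skip ?p i) = row_sum ?n \<beta> i" for i by (simp add: row_sum_def es)
    have r0: "row_sum ?n (?g \<beta>) ?p = 0" by (simp add: row_sum_def e)
    have nm: "?g \<beta> \<in> nat_matrices (Suc ?m) ?n \<longleftrightarrow> \<beta> \<in> nat_matrices ?m ?n"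
    proof -
      have "?g \<beta> \<in> nat_matrices (Suc ?m) ?n \<longleftrightarrow> (\<forall>i j. entry (?g \<beta>) i j \<noteq> 0 \<longrightarrow> i \<in> {1..Suc ?m} \<and> j \<in> {1..?n})"
        by (auto simp: nat_matrices_def in_keys_iff subset_iff)
      also have "\<dots> \<longleftrightarrow> (\<forall>i j. entry \<beta> i j \<noteq> 0 \<longrightarrow> skip ?p i \<in> {1..Suc ?m} \<and> j \<in> {1..?n})" (is "?L \<longleftrightarrow> ?R")
      proof
        assume L: ?L show ?R using L es by metis
      next
        assume R: ?R
        show ?L
        proof (intro allI impI)
          fix i j assume ne: "entry (?g \<beta>) i j \<noteq> 0"
          then have "i \<noteq> ?p" by (auto simp: e)
          then obtain i' where "i = skip ?p i'" by (cases "i < ?p") (auto simp: skip_def intro: that[of i] that[of "i - 1"])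
          then show "i \<in> {1..Suc ?m} \<and> j \<in> {1..?n}" using R ne es by metis
        qed
      qed
      also have "\<dots> \<longleftrightarrow> (\<forall>i j. entry \<beta> i j \<noteq> 0 \<longrightarrow> i \<in> {1..?m} \<and> j \<in> {1..?n})"
      proof -
        have "skip ?p i \<in> {1..Suc ?m} \<longleftrightarrow> i \<in> {1..?m}" for i by (auto simp: skip_def)
        then show ?thesis by (simp only:)
      qed
      also have "\<dots> \<longleftrightarrow> \<beta> \<in> nat_matrices ?m ?n" by (auto simp: nat_matrices_def in_keys_iff subset_iff)
      finally show ?thesis .
    qed
    have "(\<forall>i<Suc ?m. row_sum ?n (?g \<beta>) (Suc i) = ?\<sigma> ! i) \<longleftrightarrow> (\<forall>i\<in>{1..Suc ?m}. row_sum ?n (?g \<beta>) i = ?\<sigma> ! (i - 1))"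
      by (simp only: ball_1_to diff_Suc_1)
    also have "{1..Suc ?m} = insert ?p (skip ?p ` {1..?m})"
      using bij_betw_skip[OF p] p by (auto simp: bij_betw_def)
    also have "(\<forall>i\<in>insert ?p (skip ?p ` {1..?m}). row_sum ?n (?g \<beta>) i = ?\<sigma> ! (i - 1)) \<longleftrightarrow>
       (\<forall>i\<in>{1..?m}. row_sum ?n \<beta> i = ?\<sigma> ! (skip ?p i - 1))" by (simp add: r r0)
    also have "\<dots> \<longleftrightarrow> (\<forall>i<?m. row_sum ?n \<beta> (Suc i) = ?\<sigma>' ! i)"
      unfolding ball_1_to using nth_skip[of _ xs ys 0] by auto
    finally have rs: "(\<forall>i<Suc ?m. row_sum ?n (?g \<beta>) (Suc i) = ?\<sigma> ! i) \<longleftrightarrow> (\<forall>i<?m. row_sum ?n \<beta> (Suc i) = ?\<sigma>' ! i)" .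
    show ?thesis by (simp only: weight_exps_def lm mem_Collect_eq c nm rs)
  qed
  show "inj_on ?g (weight_exps ?\<sigma>' \<pi>)" using inj_relabel[OF inj_skip] by (rule inj_on_subset) simp
  show "?g ` weight_exps ?\<sigma>' \<pi> = weight_exps ?\<sigma> \<pi>"
  proof
    show "weight_exps ?\<sigma> \<pi> \<subseteq> ?g ` weight_exps ?\<sigma>' \<pi>"
    proof
      fix \<alpha> assume \<alpha>: "\<alpha> \<in> weight_exps ?\<sigma> \<pi>"
      define \<beta> where "\<beta> = Poly_Mapping.map_key ?f \<alpha>"
      have \<beta>: "entry \<beta> i j = entry \<alpha> (skip ?p i) j" for i j
        unfolding \<beta>_def by (subst map_key.rep_eq[OF inj_skip]) simp
      have "row_sum ?n \<alpha> ?p = 0" using \<alpha> by (simp add: weight_exps_def nth_append)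
      then have z: "entry \<alpha> ?p j = 0" for j
        using \<alpha> entry_outside[of \<alpha> "Suc ?m" ?n ?p j] by (cases "j \<in> {1..?n}") (auto simp: row_sum_def weight_exps_def)
      have "?g \<beta> = \<alpha>"
      proof (rule poly_mapping_eqI)
        fix x :: "nat \<times> nat"
        show "Poly_Mapping.lookup (?g \<beta>) x = Poly_Mapping.lookup \<alpha> x"
          by (cases x) (auto simp: e \<beta> skip_def z)
      qed
      then show "\<alpha> \<in> ?g ` weight_exps ?\<sigma>' \<pi>" using mem[of \<beta>] \<alpha> by blast
    qed
  qed (use mem in auto)
  fix \<alpha> \<beta>
  have "rsk_poly (length ?\<sigma>) ?n (?g \<alpha>) = bidet (\<lambda>i j. var (skip ?p i) j) (entry \<alpha>) ?m ?n"
    using bidet_insert_zero_row[OF p, of var "entry \<alpha>" ?n] unfolding lm e skip_def .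
  also have "\<dots> = psubst (\<lambda>x. var (fst (?f x)) (snd (?f x))) (rsk_poly ?m ?n \<alpha>)"
    by (simp add: psubst_bidet psubst_var)
  finally show "Poly_Mapping.lookup (rsk_poly (length ?\<sigma>) ?n (?g \<alpha>)) (?g \<beta>) =
      Poly_Mapping.lookup (rsk_poly ?m ?n \<alpha>) \<beta>"
    by (simp only: lookup_psubst_relabel[OF inj_skip])
qed

abbreviation strip :: "nat list \<Rightarrow> nat list" where
  "strip \<equiv> filter (\<lambda>x. x \<noteq> 0)"

lemma det_RSK_weight_strip: "det_RSK_weight (strip \<sigma>) (strip \<pi>) = det_RSK_weight \<sigma> \<pi>"
proof -
  have *: "det_RSK_weight (xs @ strip ys) \<pi> = det_RSK_weight (xs @ ys) \<pi>" for xs ys \<pi>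
  proof (induction ys arbitrary: xs)
    case (Cons y ys)
    show ?case using Cons[of "xs @ [y]"] Cons[of xs] det_RSK_weight_zero[of xs ys] by (cases "y = 0") auto
  qed simp
  show ?thesis using *[of "[]" \<sigma> "strip \<pi>"] *[of "[]" \<pi> \<sigma>] by (simp add: det_RSK_weight_flip[of _ \<sigma>])
qed

text \<open>Row \<open>k\<close> and column \<open>l\<close> together count the corner twice and
  miss only the part outside. The equation is kept additive to avoid truncated subtraction.\<close>

lemma weight_exps_corner:
  assumes "\<alpha> \<in> weight_exps \<sigma> \<pi>" "k < length \<sigma>" "l < length \<pi>"
  shows "entry \<alpha> (Suc k) (Suc l) + sum_list \<sigma> = \<sigma> ! k + \<pi> ! l +
    (\<Sum>i\<in>{1..length \<sigma>} - {Suc k}. \<Sum>j\<in>{1..length \<pi>} - {Suc l}. entry \<alpha> i j)"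
proof -
  let ?m = "length \<sigma>" and ?n = "length \<pi>"
  have s: "(\<Sum>j\<in>{1..?n}. f j) = f (Suc l) + (\<Sum>j\<in>{1..?n} - {Suc l}. f j)" for f :: "nat \<Rightarrow> nat"
    using assms(3) by (simp add: sum.remove)
  have t: "(\<Sum>i\<in>{1..?m}. f i) = f (Suc k) + (\<Sum>i\<in>{1..?m} - {Suc k}. f i)" for f :: "nat \<Rightarrow> nat"
    using assms(2) by (simp add: sum.remove)
  have "sum_list \<sigma> = (\<Sum>i\<in>{1..?m}. row_sum ?n \<alpha> i)"
    using assms(1) by (auto simp: sum_1_to sum_list_sum_nth weight_exps_def atLeast0LessThan simp del: One_nat_def)
  also have "\<dots> = row_sum ?n \<alpha> (Suc k) + (\<Sum>i\<in>{1..?m} - {Suc k}. row_sum ?n \<alpha> i)" by (rule t)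
  also have "(\<Sum>i\<in>{1..?m} - {Suc k}. row_sum ?n \<alpha> i) = (\<Sum>i\<in>{1..?m} - {Suc k}. entry \<alpha> i (Suc l)) +
     (\<Sum>i\<in>{1..?m} - {Suc k}. \<Sum>j\<in>{1..?n} - {Suc l}. entry \<alpha> i j)"
    unfolding row_sum_def s by (rule sum.distrib)
  also have "row_sum ?n \<alpha> (Suc k) = \<sigma> ! k" using assms by (simp add: weight_exps_def)
  finally have 1: "sum_list \<sigma> = \<sigma> ! k + ((\<Sum>i\<in>{1..?m} - {Suc k}. entry \<alpha> i (Suc l)) +
     (\<Sum>i\<in>{1..?m} - {Suc k}. \<Sum>j\<in>{1..?n} - {Suc l}. entry \<alpha> i j))" .
  have "\<pi> ! l = col_sum ?m \<alpha> (Suc l)" using assms by (simp add: weight_exps_def)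
  also have "\<dots> = entry \<alpha> (Suc k) (Suc l) + (\<Sum>i\<in>{1..?m} - {Suc k}. entry \<alpha> i (Suc l))"
    unfolding col_sum_def by (rule t)
  finally show ?thesis using 1 by linarith
qed

text \<open>By \<open>weight_exps_corner\<close> every exponent of the smaller weight is dominant at
  the corner, so raising the corner multiplies the bitableau by one variable, just as it does with
  the monomials of the basis.\<close>

lemma det_RSK_weight_corner:
  assumes sums: "sum_list \<sigma> = sum_list \<pi>" and kl: "k < length \<sigma>" "l < length \<pi>" and big: "sum_list \<sigma> \<le> \<sigma> ! k + \<pi> ! l"
  shows "det_RSK_weight (\<sigma>[k := Suc (\<sigma> ! k)]) (\<pi>[l := Suc (\<pi> ! l)]) = det_RSK_weight \<sigma> \<pi>"
proof (rule det_RSK_weight_transport)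
  let ?m = "length \<sigma>" and ?n = "length \<pi>" and ?e = "Poly_Mapping.single (Suc k, Suc l) 1 :: exponent"
  let ?\<sigma> = "\<sigma>[k := Suc (\<sigma> ! k)]" and ?\<pi> = "\<pi>[l := Suc (\<pi> ! l)]" and ?g = "\<lambda>\<alpha>. \<alpha> + ?e"
  have e: "entry (?g \<alpha>) i j = entry \<alpha> i j + of_bool (i = Suc k \<and> j = Suc l)" for \<alpha> i j
    by (auto simp: lookup_add lookup_single when_def)
  have mem: "?g \<alpha> \<in> weight_exps ?\<sigma> ?\<pi> \<longleftrightarrow> \<alpha> \<in> weight_exps \<sigma> \<pi>" for \<alpha>
  proof -
    have "?g \<alpha> \<in> nat_matrices ?m ?n \<longleftrightarrow> \<alpha> \<in> nat_matrices ?m ?n"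
    proof
      assume "?g \<alpha> \<in> nat_matrices ?m ?n"
      then show "\<alpha> \<in> nat_matrices ?m ?n" by (auto simp: nat_matrices_def subset_iff in_keys_iff lookup_add)
    next
      assume "\<alpha> \<in> nat_matrices ?m ?n"
      then show "?g \<alpha> \<in> nat_matrices ?m ?n" using kl by (intro nat_matrices_add) (auto simp: nat_matrices_def)
    qed
    moreover have "row_sum ?n (?g \<alpha>) (Suc i) = row_sum ?n \<alpha> (Suc i) + of_bool (i = k)" for i
      unfolding row_sum_def e sum.distrib using kl by (cases "i = k") (auto simp: of_bool_def)
    moreover have "col_sum ?m (?g \<alpha>) (Suc j) = col_sum ?m \<alpha> (Suc j) + of_bool (j = l)" for j
      unfolding col_sum_def e sum.distrib using kl by (cases "j = l") (auto simp: of_bool_def)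
    ultimately show ?thesis using kl
      by (auto simp: weight_exps_def nth_list_update split: if_splits)
  qed
  show "inj_on ?g (weight_exps \<sigma> \<pi>)" by (rule inj_onI) simp
  show "?g ` weight_exps \<sigma> \<pi> = weight_exps ?\<sigma> ?\<pi>"
  proof
    show "weight_exps ?\<sigma> ?\<pi> \<subseteq> ?g ` weight_exps \<sigma> \<pi>"
    proof
      fix \<alpha> assume \<alpha>: "\<alpha> \<in> weight_exps ?\<sigma> ?\<pi>"
      \<comment> \<open>Raising adds 2 to the sum of the two entries and only 1 to the degree. The
        inequality \<open>big\<close> thus becomes strict for the larger weight, and the corner
        entry must be positive.\<close>
      have "sum_list ?\<sigma> = Suc (sum_list \<sigma>)" using kl by (simp add: sum_list_update elem_le_sum_list)
      then have "entry \<alpha> (Suc k) (Suc l) > 0" using weight_exps_corner[OF \<alpha>, of k l] kl big by simp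
      then have "?g (\<alpha> - ?e) = \<alpha>"
        by (intro poly_mapping_eqI) (auto simp: lookup_add lookup_minus lookup_single when_def)
      then show "\<alpha> \<in> ?g ` weight_exps \<sigma> \<pi>" using mem[of "\<alpha> - ?e"] \<alpha> by (metis imageI)
    qed
  qed (use mem in auto)
  fix \<alpha> \<beta> assume \<alpha>: "\<alpha> \<in> weight_exps \<sigma> \<pi>"
  have "dominant (entry \<alpha>) ?m ?n (Suc k) (Suc l)"
    using weight_exps_corner[OF \<alpha> kl] big kl by (simp add: dominant_def)
  then have "rsk_poly ?m ?n (?g \<alpha>) = var (Suc k) (Suc l) * rsk_poly ?m ?n \<alpha>"
    by (rule bidet_add_dominant) (rule e)
  moreover have "Poly_Mapping.lookup (monomial ?e * f) (?g \<beta>) = Poly_Mapping.lookup f \<beta>" for f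
  proof -
    have "monomial ?e * f = (\<Sum>\<gamma>\<in>Poly_Mapping.keys f. Poly_Mapping.single (?g \<gamma>) (Poly_Mapping.lookup f \<gamma>))"
      by (subst (1) poly_mapping_sum_single[of f]) (simp add: monomial_def sum_distrib_left mult_single add.commute)
    then show ?thesis by (simp add: lookup_sum lookup_single when_def in_keys_iff)
  qed
  ultimately show "Poly_Mapping.lookup (rsk_poly (length ?\<sigma>) (length ?\<pi>) (?g \<alpha>)) (?g \<beta>) =
      Poly_Mapping.lookup (rsk_poly ?m ?n \<alpha>) \<beta>" by (simp add: var_def)
qed

section \<open>Splitting of the degree space into weight spaces\<close>

definition weight_pairs :: "nat \<Rightarrow> nat \<Rightarrow> nat \<Rightarrow> (nat list \<times> nat list) set" where
  "weight_pairs m n d = {(\<sigma>, \<pi>). length \<sigma> = m \<and> length \<pi> = n \<and> sum_list \<sigma> = d \<and> sum_list \<pi> = d}"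

lemma finite_lists_sum: "finite {\<sigma> :: nat list. length \<sigma> = m \<and> sum_list \<sigma> = d}"
  by (rule finite_subset[OF _ finite_lists_length_eq[of "{..d}" m]]) (auto simp: member_le_sum_list)

lemma finite_weight_pairs: "finite (weight_pairs m n d)"
  by (rule finite_subset[OF _ finite_cartesian_product[OF finite_lists_sum[of m d] finite_lists_sum[of n d]]])
    (auto simp: weight_pairs_def)

lemma ldet_append:
  assumes "\<And>\<alpha>. \<alpha> \<in> set xs \<Longrightarrow> Poly_Mapping.keys (F \<alpha>) \<inter> set ys = {}"
  shows "ldet (xs @ ys) F = ldet xs F * ldet ys F"
proof -
  let ?M = "\<lambda>xs ys. mat (length xs) (length ys) (\<lambda>(i, j). Poly_Mapping.lookup (F (ys ! j)) (xs ! i))"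
  have "?M (xs @ ys) (xs @ ys) = four_block_mat (?M xs xs) (?M xs ys) (0\<^sub>m (length ys) (length xs)) (?M ys ys)"
  proof (rule eq_matI)
    fix i j assume "i < dim_row (four_block_mat (?M xs xs) (?M xs ys) (0\<^sub>m (length ys) (length xs)) (?M ys ys))"
      "j < dim_col (four_block_mat (?M xs xs) (?M xs ys) (0\<^sub>m (length ys) (length xs)) (?M ys ys))"
    then have ij: "i < length xs + length ys" "j < length xs + length ys" by auto
    have "Poly_Mapping.lookup (F (xs ! j)) (ys ! (i - length xs)) = 0" if "j < length xs" "\<not> i < length xs"
    proof -
      have "ys ! (i - length xs) \<in> set ys" using ij that by simp
      then show ?thesis using assms[of "xs ! j"] that by (auto simp: in_keys_iff)
    qed
    then show "?M (xs @ ys) (xs @ ys) $$ (i, j) =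
        four_block_mat (?M xs xs) (?M xs ys) (0\<^sub>m (length ys) (length xs)) (?M ys ys) $$ (i, j)"
      using ij by (auto simp: nth_append)
  qed auto
  then show ?thesis unfolding ldet_def
    by (simp add: det_four_block_mat_lower_left_zero[of _ "length xs" _ "length ys"])
qed

lemma det_RSK_degree_prod: "det_RSK_degree m n d = (\<Prod>(\<sigma>, \<pi>)\<in>weight_pairs m n d. det_RSK_weight \<sigma> \<pi>)"
proof -
  obtain ps where ps: "distinct ps" "set ps = weight_pairs m n d" using finite_distinct_list[OF finite_weight_pairs] by blast
  have "\<exists>xs. distinct xs \<and> set xs = weight_exps (fst p) (snd p)" for p :: "nat list \<times> nat list" using finite_distinct_list[OF finite_weight_exps] by blast
  then obtain X where X: "\<And>p. distinct (X p)" "\<And>p. set (X p) = weight_exps (fst p) (snd p)" by metis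
  have disj: "weight_exps (fst p) (snd p) \<inter> weight_exps (fst q) (snd q) = {}" if "p \<in> weight_pairs m n d" "q \<in> weight_pairs m n d" "p \<noteq> q" for p q
  proof (rule ccontr)
    assume "weight_exps (fst p) (snd p) \<inter> weight_exps (fst q) (snd q) \<noteq> {}"
    then obtain \<alpha> where "\<alpha> \<in> weight_exps (fst p) (snd p)" "\<alpha> \<in> weight_exps (fst q) (snd q)" by blast
    then have "fst p = fst q" "snd p = snd q"
      using that by (auto simp: weight_exps_def weight_pairs_def intro!: nth_equalityI)
    then show False using that by (simp add: prod_eq_iff)
  qed
  have *: "distinct (concat (map X qs)) \<and> ldet (concat (map X qs)) (rsk_poly m n) = (\<Prod>p\<leftarrow>qs. ldet (X p) (rsk_poly m n))"
    if "distinct qs" "set qs \<subseteq> weight_pairs m n d" for qs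
    using that
  proof (induction qs)
    case Nil
    show ?case by (simp add: ldet_def)
  next
    case (Cons q qs)
    have q: "length (fst q) = m" "length (snd q) = n" using Cons.prems by (auto simp: weight_pairs_def)
    have d: "weight_exps (fst q) (snd q) \<inter> set (concat (map X qs)) = {}"
      using Cons.prems disj[of q] by (auto simp: X)
    then have "Poly_Mapping.keys (rsk_poly m n \<alpha>) \<inter> set (concat (map X qs)) = {}" if "\<alpha> \<in> set (X q)" for \<alpha>
      using keys_rsk_poly_weight_exps[of \<alpha> "fst q" "snd q"] that q by (auto simp: X)
    then have "ldet (X q @ concat (map X qs)) (rsk_poly m n) = ldet (X q) (rsk_poly m n) * ldet (concat (map X qs)) (rsk_poly m n)"
      by (rule ldet_append)
    then show ?case using Cons d X by simp
  qed
  have "degree_exps m n d = (\<Union>p\<in>weight_pairs m n d. weight_exps (fst p) (snd p))"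
  proof
    show "(\<Union>p\<in>weight_pairs m n d. weight_exps (fst p) (snd p)) \<subseteq> degree_exps m n d"
      using weight_exps_subset_degree_exps by (fastforce simp: weight_pairs_def)
    show "degree_exps m n d \<subseteq> (\<Union>p\<in>weight_pairs m n d. weight_exps (fst p) (snd p))"
    proof
      fix \<alpha> assume \<alpha>: "\<alpha> \<in> degree_exps m n d"
      let ?\<sigma> = "map (\<lambda>i. row_sum n \<alpha> (Suc i)) [0..<m]" and ?\<pi> = "map (\<lambda>j. col_sum m \<alpha> (Suc j)) [0..<n]"
      have "sum_list ?\<sigma> = d" using \<alpha> by (simp add: degree_exps_def sum_1_to interv_sum_list_conv_sum_set_nat atLeast0LessThan del: One_nat_def)
      moreover have "sum_list ?\<pi> = (\<Sum>j\<in>{1..n}. col_sum m \<alpha> j)" by (simp add: sum_1_to interv_sum_list_conv_sum_set_nat atLeast0LessThan del: One_nat_def)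
      then have "sum_list ?\<pi> = d" using \<alpha> sum.swap[of "\<lambda>i j. entry \<alpha> i j" "{1..n}" "{1..m}"]
        by (simp add: degree_exps_def row_sum_def col_sum_def)
      ultimately have "(?\<sigma>, ?\<pi>) \<in> weight_pairs m n d" by (simp add: weight_pairs_def)
      moreover have "\<alpha> \<in> weight_exps ?\<sigma> ?\<pi>" using \<alpha> by (simp add: weight_exps_def degree_exps_def)
      ultimately show "\<alpha> \<in> (\<Union>p\<in>weight_pairs m n d. weight_exps (fst p) (snd p))" by fastforce
    qed
  qed
  then have set: "set (concat (map X ps)) = degree_exps m n d" by (simp add: ps X)
  have "det_RSK_degree m n d = ldet (concat (map X ps)) (rsk_poly m n)"
    unfolding det_RSK_degree_def degree_space_degree_exps set[symmetric]
    by (rule restriction_det_eq_ldet) (use *[of ps] ps keys_rsk_poly_degree_exps in \<open>auto simp only: set degree_exps_def\<close>)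
  also have "\<dots> = (\<Prod>p\<leftarrow>ps. ldet (X p) (rsk_poly m n))" using *[of ps] ps by simp
  also have "\<dots> = (\<Prod>p\<in>weight_pairs m n d. ldet (X p) (rsk_poly m n))"
    using ps by (simp add: prod.distinct_set_conv_list[symmetric])
  also have "\<dots> = (\<Prod>(\<sigma>, \<pi>)\<in>weight_pairs m n d. det_RSK_weight \<sigma> \<pi>)"
  proof (intro prod.cong refl)
    fix p assume "p \<in> weight_pairs m n d"
    then show "ldet (X p) (rsk_poly m n) = (case p of (\<sigma>, \<pi>) \<Rightarrow> det_RSK_weight \<sigma> \<pi>)"
      using det_RSK_weight_ldet[of "X p" "fst p" "snd p"] X[of p] by (auto simp: weight_pairs_def)
  qed
  finally show ?thesis .
qed

section \<open>Reduction of weight pairs\<close>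

type_synonym wpair = "nat list \<times> nat list"

definition balanced :: "wpair \<Rightarrow> bool" where
  "balanced p \<longleftrightarrow> sum_list (fst p) = sum_list (snd p)"

text \<open>In a balanced pair the strict inequality forces both entries to be positive, so the
  decrements are not truncated.\<close>

definition reduces :: "wpair \<Rightarrow> wpair \<Rightarrow> bool" where
  "reduces p q \<longleftrightarrow> (\<exists>k<length (fst p). \<exists>l<length (snd p). sum_list (fst p) < fst p ! k + snd p ! l \<and>
     q = ((fst p)[k := fst p ! k - 1], (snd p)[l := snd p ! l - 1]))"

lemma reducesI: "k < length (fst p) \<Longrightarrow> l < length (snd p) \<Longrightarrow> sum_list (fst p) < fst p ! k + snd p ! l \<Longrightarrow>
    reduces p ((fst p)[k := fst p ! k - 1], (snd p)[l := snd p ! l - 1])"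
  unfolding reduces_def by blast

lemma sum_list_dec: "k < length xs \<Longrightarrow> 0 < xs ! k \<Longrightarrow> Suc (sum_list (xs[k := xs ! k - 1])) = sum_list (xs :: nat list)"
  using elem_le_sum_list[of k xs] by (simp add: sum_list_update)

lemma reduces_sum:
  assumes "balanced p" "reduces p q"
  shows "balanced q" "Suc (sum_list (fst q)) = sum_list (fst p)" "length (fst q) = length (fst p)" "length (snd q) = length (snd p)"
    "det_RSK_weight (fst q) (snd q) = det_RSK_weight (fst p) (snd p)"
proof -
  obtain \<sigma> \<pi> where p: "p = (\<sigma>, \<pi>)" by (cases p)
  obtain k l where kl: "k < length \<sigma>" "l < length \<pi>" "sum_list \<sigma> < \<sigma> ! k + \<pi> ! l"
    "q = (\<sigma>[k := \<sigma> ! k - 1], \<pi>[l := \<pi> ! l - 1])" using assms(2) by (auto simp: reduces_def p)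
  have b: "sum_list \<sigma> = sum_list \<pi>" using assms(1) by (simp add: balanced_def p)
  have nontrivial: "0 < \<sigma> ! k" "0 < \<pi> ! l" using elem_le_sum_list[OF kl(1)] elem_le_sum_list[OF kl(2)] kl(3) b by linarith+
  note s = sum_list_dec[OF kl(1) nontrivial(1)] sum_list_dec[OF kl(2) nontrivial(2)]
  show bq: "balanced q" using s b by (simp add: balanced_def kl(4))
  show "Suc (sum_list (fst q)) = sum_list (fst p)" "length (fst q) = length (fst p)" "length (snd q) = length (snd p)"
    using s by (simp_all add: kl(4) p)
  have "det_RSK_weight ((fst q)[k := Suc (fst q ! k)]) ((snd q)[l := Suc (snd q ! l)]) = det_RSK_weight (fst q) (snd q)"
    by (rule det_RSK_weight_corner) (use s kl nontrivial bq in \<open>auto simp: balanced_def\<close>)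
  then show "det_RSK_weight (fst q) (snd q) = det_RSK_weight (fst p) (snd p)" using kl nontrivial by (simp add: p)
qed

lemma reduces_rtrancl:
  assumes "reduces\<^sup>*\<^sup>* p q" "balanced p"
  shows "balanced q" "sum_list (fst q) \<le> sum_list (fst p)" "length (fst q) = length (fst p)" "length (snd q) = length (snd p)"
    "det_RSK_weight (fst q) (snd q) = det_RSK_weight (fst p) (snd p)"
proof -
  from assms have "balanced q \<and> sum_list (fst q) \<le> sum_list (fst p) \<and> length (fst q) = length (fst p) \<and> length (snd q) = length (snd p) \<and>
    det_RSK_weight (fst q) (snd q) = det_RSK_weight (fst p) (snd p)"
  proof (induction rule: rtranclp_induct)
    case (step q r)
    then show ?case using reduces_sum[of q r] by auto
  qed auto
  then show "balanced q" "sum_list (fst q) \<le> sum_list (fst p)" "length (fst q) = length (fst p)" "length (snd q) = length (snd p)"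
    "det_RSK_weight (fst q) (snd q) = det_RSK_weight (fst p) (snd p)" by auto
qed

lemma two_le_sum_list:
  fixes xs :: "nat list"
  assumes "i < length xs" "j < length xs" "i \<noteq> j"
  shows "xs ! i + xs ! j \<le> sum_list xs"
proof -
  have "(\<Sum>k\<in>{i, j}. xs ! k) \<le> (\<Sum>k\<in>{0..<length xs}. xs ! k)" using assms by (intro sum_mono2) auto
  then show ?thesis using assms by (simp add: sum_list_sum_nth)
qed

lemma three_le_sum_list:
  fixes xs :: "nat list"
  assumes "i < length xs" "j < length xs" "i \<noteq> j" "3 \<le> length xs" "0 \<notin> set xs"
  shows "xs ! i + xs ! j < sum_list xs"
proof -
  have "\<not> {..<length xs} \<subseteq> {i, j}"
  proof
    assume "{..<length xs} \<subseteq> {i, j}"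
    then have "card {..<length xs} \<le> card {i, j}" by (intro card_mono) auto
    then show False using assms by simp
  qed
  then obtain k where k: "k < length xs" "k \<noteq> i" "k \<noteq> j" by auto
  have "(\<Sum>k\<in>{i, j, k}. xs ! k) \<le> (\<Sum>k\<in>{0..<length xs}. xs ! k)" using assms k by (intro sum_mono2) auto
  moreover have "xs ! k \<noteq> 0" using assms(5) k(1) by (metis nth_mem)
  ultimately show ?thesis using assms k by (simp add: sum_list_sum_nth)
qed

lemma reduces_swap: "balanced p \<Longrightarrow> reduces p q \<Longrightarrow> reduces (prod.swap p) (prod.swap q)"
proof -
  assume "balanced p" "reduces p q"
  then obtain k l where "k < length (fst p)" "l < length (snd p)" "sum_list (snd p) < snd p ! l + fst p ! k"
    "q = ((fst p)[k := fst p ! k - 1], (snd p)[l := snd p ! l - 1])"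
    by (auto simp: reduces_def balanced_def add.commute)
  then show ?thesis using reducesI[of l "prod.swap p" k] by simp
qed

text \<open>Two steps that share neither row nor column cannot coexist: the four entries would
  exceed twice the degree. If they share a row, one step lowers the shared entry and the degree by
  one each, so the other remains possible; a shared column is treated by swapping.\<close>

lemma reduces_diamond:
  assumes "balanced p" "reduces p a" "reduces p b"
  shows "a = b \<or> (\<exists>c. reduces a c \<and> reduces b c)"
proof -
  have col: "\<exists>c. reduces (\<sigma>[k := \<sigma> ! k - 1], \<pi>[l := \<pi> ! l - 1]) c \<and> reduces (\<sigma>[k := \<sigma> ! k - 1], \<pi>[l' := \<pi> ! l' - 1]) c"
    if s: "sum_list \<sigma> = sum_list \<pi>" and k: "k < length \<sigma>" "l < length \<pi>" "l' < length \<pi>" "l \<noteq> l'"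
      "sum_list \<sigma> < \<sigma> ! k + \<pi> ! l" "sum_list \<sigma> < \<sigma> ! k + \<pi> ! l'" for \<sigma> \<pi> k l l'
  proof (intro exI conjI)
    have "0 < \<sigma> ! k" using elem_le_sum_list[OF k(2)] k s by linarith
    note sd = sum_list_dec[OF k(1) this]
    let ?c = "(\<sigma>[k := \<sigma> ! k - 1 - 1], \<pi>[l := \<pi> ! l - 1, l' := \<pi> ! l' - 1])"
    show "reduces (\<sigma>[k := \<sigma> ! k - 1], \<pi>[l := \<pi> ! l - 1]) ?c" unfolding reduces_def
      by (rule exI[of _ k], simp add: k, rule exI[of _ l']) (use sd k in auto)
    show "reduces (\<sigma>[k := \<sigma> ! k - 1], \<pi>[l' := \<pi> ! l' - 1]) ?c" unfolding reduces_def
      by (rule exI[of _ k], simp add: k, rule exI[of _ l]) (use sd k in \<open>auto simp: list_update_swap\<close>)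
  qed
  obtain \<sigma> \<pi> where p: "p = (\<sigma>, \<pi>)" by (cases p)
  have bal: "sum_list \<sigma> = sum_list \<pi>" using assms(1) by (simp add: balanced_def p)
  obtain k l where a: "k < length \<sigma>" "l < length \<pi>" "sum_list \<sigma> < \<sigma> ! k + \<pi> ! l"
    "a = (\<sigma>[k := \<sigma> ! k - 1], \<pi>[l := \<pi> ! l - 1])" using assms(2) by (auto simp: reduces_def p)
  obtain k' l' where b: "k' < length \<sigma>" "l' < length \<pi>" "sum_list \<sigma> < \<sigma> ! k' + \<pi> ! l'"
    "b = (\<sigma>[k' := \<sigma> ! k' - 1], \<pi>[l' := \<pi> ! l' - 1])" using assms(3) by (auto simp: reduces_def p)
  consider "k = k'" "l = l'" | "k = k'" "l \<noteq> l'" | "k \<noteq> k'" "l = l'" | "k \<noteq> k'" "l \<noteq> l'" by blast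
  then show ?thesis
  proof cases
    case 1
    then show ?thesis using a b by simp
  next
    case 2
    then show ?thesis using col[OF bal a(1) a(2) b(2)] a b by auto
  next
    case 3
    have "sum_list \<pi> < \<pi> ! l + \<sigma> ! k" "sum_list \<pi> < \<pi> ! l + \<sigma> ! k'" using a b bal 3 by auto
    then obtain c where c: "reduces (\<pi>[l := \<pi> ! l - 1], \<sigma>[k := \<sigma> ! k - 1]) c" "reduces (\<pi>[l := \<pi> ! l - 1], \<sigma>[k' := \<sigma> ! k' - 1]) c"
      using col[of \<pi> \<sigma> l k k'] bal a b 3 by auto
    have "balanced a" "balanced b" using reduces_sum(1)[OF assms(1)] assms(2,3) by auto
    then have "reduces a (prod.swap c)" "reduces b (prod.swap c)"
      using reduces_swap[OF _ c(1)] reduces_swap[OF _ c(2)] a(4) b(4) 3 by (auto simp: balanced_def)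
    then show ?thesis by blast
  next
    case 4
    then show ?thesis using two_le_sum_list[of k \<sigma> k'] two_le_sum_list[of l \<pi> l'] a b bal by linarith
  qed
qed

definition terminal :: "wpair \<Rightarrow> bool" where
  "terminal p \<longleftrightarrow> (\<forall>k<length (fst p). \<forall>l<length (snd p). fst p ! k + snd p ! l \<le> sum_list (fst p))"

lemma terminal_iff: "terminal p \<longleftrightarrow> (\<forall>q. \<not> reduces p q)"
proof
  assume "terminal p"
  then show "\<forall>q. \<not> reduces p q" by (fastforce simp: terminal_def reduces_def)
next
  assume *: "\<forall>q. \<not> reduces p q"
  show "terminal p" unfolding terminal_def
  proof (intro allI impI, rule ccontr)
    fix k l assume "k < length (fst p)" "l < length (snd p)" "\<not> fst p ! k + snd p ! l \<le> sum_list (fst p)"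
    then show False using reducesI[of k p l] * by simp
  qed
qed

text \<open>Pairs with fewer than two rows or columns are set aside, because their determinant is 1
  (\<open>pair_det_not_nontrivial\<close>).\<close>

definition nontrivial :: "wpair \<Rightarrow> bool" where
  "nontrivial p \<longleftrightarrow> 0 \<notin> set (fst p) \<and> 0 \<notin> set (snd p) \<and> 2 \<le> length (fst p) \<and> 2 \<le> length (snd p)"

lemma lt_sum_list:
  fixes xs :: "nat list"
  assumes "0 \<notin> set xs" "2 \<le> length xs" "i < length xs" shows "xs ! i < sum_list xs"
proof -
  define j where "j = (if i = 0 then 1 else 0 :: nat)"
  have j: "j < length xs" "j \<noteq> i" using assms by (auto simp: j_def)
  then have "xs ! j \<noteq> 0" using assms(1) by (metis nth_mem)
  then show ?thesis using two_le_sum_list[OF assms(3) j(1)] j by simp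
qed

text \<open>With at least two positive entries, each entry is below the degree; the strict
  inequality then makes both lowered entries at least 2 beforehand.\<close>

lemma reduces_nontrivial:
  assumes "balanced p" "nontrivial p" "reduces p q" shows "nontrivial q"
proof -
  obtain \<sigma> \<pi> where p: "p = (\<sigma>, \<pi>)" by (cases p)
  obtain k l where kl: "k < length \<sigma>" "l < length \<pi>" "sum_list \<sigma> < \<sigma> ! k + \<pi> ! l"
    "q = (\<sigma>[k := \<sigma> ! k - 1], \<pi>[l := \<pi> ! l - 1])" using assms(3) by (auto simp: reduces_def p)
  have "\<pi> ! l < sum_list \<pi>" "\<sigma> ! k < sum_list \<sigma>" using assms(2) kl by (auto simp: nontrivial_def p intro: lt_sum_list)
  then have "0 < \<sigma> ! k - 1" "0 < \<pi> ! l - 1" using kl(3) assms(1) by (auto simp: balanced_def p)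
  then show ?thesis using assms(2) set_update_subset_insert[of \<sigma> k "\<sigma> ! k - 1"] set_update_subset_insert[of \<pi> l "\<pi> ! l - 1"]
    by (auto simp: nontrivial_def p kl(4))
qed

lemma reduces_rtrancl_nontrivial: "reduces\<^sup>*\<^sup>* p q \<Longrightarrow> balanced p \<Longrightarrow> nontrivial p \<Longrightarrow> nontrivial q"
  by (induction rule: rtranclp_induct) (auto intro: reduces_nontrivial reduces_rtrancl(1))

lemma nf_exists: "balanced p \<Longrightarrow> \<exists>q. reduces\<^sup>*\<^sup>* p q \<and> terminal q"
proof (induction "sum_list (fst p)" arbitrary: p rule: less_induct)
  case less
  show ?case
  proof (cases "terminal p")
    case False
    then obtain q where q: "reduces p q" by (auto simp: terminal_iff)
    then obtain r where "reduces\<^sup>*\<^sup>* q r" "terminal r" using less.hyps[of q] reduces_sum(1,2)[OF less.prems q] by auto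
    then show ?thesis using q by (meson converse_rtranclp_into_rtranclp)
  qed blast
qed

text \<open>Newman's argument by induction on the degree, with \<open>reduces_diamond\<close> as
  local confluence.\<close>

lemma nf_unique: "balanced p \<Longrightarrow> reduces\<^sup>*\<^sup>* p q \<Longrightarrow> reduces\<^sup>*\<^sup>* p r \<Longrightarrow> terminal q \<Longrightarrow> terminal r \<Longrightarrow> q = r"
proof (induction "sum_list (fst p)" arbitrary: p q r rule: less_induct)
  case less
  show ?case
  proof (cases "terminal p")
    case True
    then have "q = p" "r = p" using less.prems by (metis converse_rtranclpE terminal_iff)+
    then show ?thesis by simp
  next
    case False
    then have "p \<noteq> q" "p \<noteq> r" using less.prems by auto
    then obtain a b where a: "reduces p a" "reduces\<^sup>*\<^sup>* a q" and b: "reduces p b" "reduces\<^sup>*\<^sup>* b r"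
      using less.prems by (metis converse_rtranclpE)
    have lt: "sum_list (fst a) < sum_list (fst p)" "sum_list (fst b) < sum_list (fst p)" "balanced a" "balanced b"
      using reduces_sum(1,2)[OF less.prems(1)] a b by (metis lessI)+
    from reduces_diamond[OF less.prems(1) a(1) b(1)] show ?thesis
    proof
      assume "a = b"
      then show ?thesis using less.hyps[OF lt(1,3) a(2)] b less.prems by simp
    next
      assume "\<exists>c. reduces a c \<and> reduces b c"
      then obtain c where c: "reduces a c" "reduces b c" by blast
      then obtain s where s: "reduces\<^sup>*\<^sup>* c s" "terminal s" using nf_exists[of c] reduces_sum(1)[OF lt(3)] by blast
      have "q = s" using less.hyps[OF lt(1,3) a(2)] s c less.prems by (meson converse_rtranclp_into_rtranclp)
      moreover have "r = s" using less.hyps[OF lt(2,4) b(2)] s c less.prems by (meson converse_rtranclp_into_rtranclp)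
      ultimately show ?thesis by simp
    qed
  qed
qed

section \<open>Counting the pairs that reduce to a given one\<close>

definition fibre :: "wpair \<Rightarrow> nat \<Rightarrow> wpair set" where
  "fibre q d = {p. balanced p \<and> sum_list (fst p) = d \<and> reduces\<^sup>*\<^sup>* p q}"

lemma reduces_rtrancl_swap: "reduces\<^sup>*\<^sup>* p q \<Longrightarrow> balanced p \<Longrightarrow> reduces\<^sup>*\<^sup>* (prod.swap p) (prod.swap q)"
proof (induction rule: rtranclp_induct)
  case (step q r)
  then show ?case using reduces_swap[of q r] reduces_rtrancl(1)[of p q] by (metis rtranclp.rtrancl_into_rtrancl)
qed simp

lemma fibre_swap: "card (fibre (prod.swap q) d) = card (fibre q d)"
proof -
  have *: "prod.swap p \<in> fibre (prod.swap q) d" if "p \<in> fibre q d" for p q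
    using that reduces_rtrancl_swap[of p q] by (auto simp: fibre_def balanced_def)
  have "fibre (prod.swap q) d = prod.swap ` fibre q d"
  proof
    show "fibre (prod.swap q) d \<subseteq> prod.swap ` fibre q d"
    proof
      fix p assume "p \<in> fibre (prod.swap q) d"
      then have "prod.swap p \<in> fibre q d" using *[of p "prod.swap q"] by simp
      then show "p \<in> prod.swap ` fibre q d" by (intro image_eqI[of _ _ "prod.swap p"]) simp_all
    qed
    show "prod.swap ` fibre q d \<subseteq> fibre (prod.swap q) d" by (rule image_subsetI) (rule *)
  qed
  then show ?thesis by (simp add: card_image)
qed

text \<open>If there are at least three columns, all corners of a reduced pair lie in one line, say in column \<open>l\<close>; the
  pairs above it arise by raising the entries of \<open>\<sigma>\<close> in the rows of corners, and \<open>\<pi> ! l\<close> accordingly.\<close>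

definition raisings :: "nat list \<Rightarrow> nat set \<Rightarrow> nat \<Rightarrow> nat list set" where
  "raisings \<sigma> K x = {\<tau>. length \<tau> = length \<sigma> \<and> sum_list \<tau> = sum_list \<sigma> + x \<and>
     (\<forall>k<length \<sigma>. \<sigma> ! k \<le> \<tau> ! k \<and> (k \<notin> K \<longrightarrow> \<tau> ! k = \<sigma> ! k))}"

lemma finite_raisings: "finite (raisings \<sigma> K x)"
  by (rule finite_subset[OF _ finite_lists_sum[of "length \<sigma>" "sum_list \<sigma> + x"]]) (auto simp: raisings_def)

lemma raisings_insert:
  assumes k: "k < length \<sigma>" "k \<notin> K"
  shows "raisings \<sigma> (insert k K) x = (\<Union>y\<le>x. (\<lambda>\<tau>. \<tau>[k := \<sigma> ! k + y]) ` raisings \<sigma> K (x - y))"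
proof
  show "raisings \<sigma> (insert k K) x \<subseteq> (\<Union>y\<le>x. (\<lambda>\<tau>. \<tau>[k := \<sigma> ! k + y]) ` raisings \<sigma> K (x - y))"
  proof
    fix \<tau> assume \<tau>: "\<tau> \<in> raisings \<sigma> (insert k K) x"
    define y where "y = \<tau> ! k - \<sigma> ! k"
    define \<rho> where "\<rho> = \<tau>[k := \<sigma> ! k]"
    have len: "length \<tau> = length \<sigma>" and le: "\<And>i. i < length \<sigma> \<Longrightarrow> \<sigma> ! i \<le> \<tau> ! i"
      and eq: "\<And>i. i < length \<sigma> \<Longrightarrow> i \<notin> insert k K \<Longrightarrow> \<tau> ! i = \<sigma> ! i" and s: "sum_list \<tau> = sum_list \<sigma> + x"
      using \<tau> by (auto simp: raisings_def)
    have yk: "\<tau> ! k = \<sigma> ! k + y" using le[OF k(1)] by (simp add: y_def)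
    have le\<rho>: "\<sigma> ! i \<le> \<rho> ! i" if "i < length \<sigma>" for i using le[OF that] that len k(1) by (cases "i = k") (auto simp: \<rho>_def)
    have s\<rho>: "sum_list \<rho> + y = sum_list \<sigma> + x"
      using s elem_le_sum_list[of k \<tau>] k len yk by (simp add: \<rho>_def sum_list_update)
    have "sum_list \<sigma> \<le> sum_list \<rho>" using le\<rho> len by (auto simp: sum_list_sum_nth \<rho>_def intro!: sum_mono)
    then have yx: "y \<le> x" and "sum_list \<rho> = sum_list \<sigma> + (x - y)" using s\<rho> by linarith+
    moreover have "\<rho> ! i = \<sigma> ! i" if "i < length \<sigma>" "i \<notin> K" for i
      using eq[OF that(1)] that len k(1) by (cases "i = k") (auto simp: \<rho>_def)
    ultimately have "\<rho> \<in> raisings \<sigma> K (x - y)" using le\<rho> len by (simp add: raisings_def \<rho>_def)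
    moreover have "\<tau> = \<rho>[k := \<sigma> ! k + y]" using yk by (simp add: \<rho>_def) (metis list_update_id)
    ultimately show "\<tau> \<in> (\<Union>y\<le>x. (\<lambda>\<tau>. \<tau>[k := \<sigma> ! k + y]) ` raisings \<sigma> K (x - y))" using yx by blast
  qed
  show "(\<Union>y\<le>x. (\<lambda>\<tau>. \<tau>[k := \<sigma> ! k + y]) ` raisings \<sigma> K (x - y)) \<subseteq> raisings \<sigma> (insert k K) x"
  proof safe
    fix y \<rho> assume y: "y \<le> x" and \<rho>: "\<rho> \<in> raisings \<sigma> K (x - y)"
    have "\<rho> ! k = \<sigma> ! k" "length \<rho> = length \<sigma>" "sum_list \<rho> = sum_list \<sigma> + (x - y)" using \<rho> k by (auto simp: raisings_def)
    then have "sum_list (\<rho>[k := \<sigma> ! k + y]) = sum_list \<sigma> + x"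
      using k y elem_le_sum_list[of k \<rho>] by (simp add: sum_list_update)
    then show "\<rho>[k := \<sigma> ! k + y] \<in> raisings \<sigma> (insert k K) x" using \<rho> k by (auto simp: raisings_def nth_list_update)
  qed
qed

text \<open>Stars and bars: \<open>x\<close> units are distributed over the rows in
  \<open>K\<close>. Conditioning on the share of one row gives the hockey-stick identity, except
  when \<open>K\<close> was empty before.\<close>

lemma card_raisings:
  assumes "K \<subseteq> {..<length \<sigma>}"
  shows "card (raisings \<sigma> K x) = (if K = {} then of_bool (x = 0) else (x + (card K - 1)) choose (card K - 1))"
proof -
  have "finite K" using assms finite_subset by blast
  then show ?thesis using assms
  proof (induction K arbitrary: x rule: finite_induct)
    case empty
    have "raisings \<sigma> {} x = (if x = 0 then {\<sigma>} else {})"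
    proof -
      have "\<tau> = \<sigma>" if "\<tau> \<in> raisings \<sigma> {} x" for \<tau> using that by (auto simp: raisings_def intro: nth_equalityI)
      then have "raisings \<sigma> {} x \<subseteq> {\<sigma>}" by blast
      moreover have "\<sigma> \<in> raisings \<sigma> {} x \<longleftrightarrow> x = 0" by (auto simp: raisings_def)
      ultimately show ?thesis by auto
    qed
    then show ?case by simp
  next
    case (insert k K)
    have k: "k < length \<sigma>" "k \<notin> K" using insert by auto
    have mem: "\<rho> ! k = \<sigma> ! k" "length \<rho> = length \<sigma>" if "\<rho> \<in> raisings \<sigma> K y" for \<rho> y using that k by (auto simp: raisings_def)
    have inj: "inj_on (\<lambda>\<tau>. \<tau>[k := \<sigma> ! k + y]) (raisings \<sigma> K z)" for y z
    proof (rule inj_onI)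
      fix \<tau> \<rho> assume *: "\<tau> \<in> raisings \<sigma> K z" "\<rho> \<in> raisings \<sigma> K z" "\<tau>[k := \<sigma> ! k + y] = \<rho>[k := \<sigma> ! k + y]"
      then have "\<tau>[k := \<sigma> ! k + y, k := \<sigma> ! k] = \<rho>[k := \<sigma> ! k + y, k := \<sigma> ! k]" by simp
      then show "\<tau> = \<rho>" using mem[OF *(1)] mem[OF *(2)] by simp (metis list_update_id)
    qed
    have "card (raisings \<sigma> (insert k K) x) = (\<Sum>y\<le>x. card ((\<lambda>\<tau>. \<tau>[k := \<sigma> ! k + y]) ` raisings \<sigma> K (x - y)))"
      unfolding raisings_insert[OF k]
    proof (rule card_UN_disjoint)
      show "\<forall>i\<in>{..x}. \<forall>j\<in>{..x}. i \<noteq> j \<longrightarrow> (\<lambda>\<tau>. \<tau>[k := \<sigma> ! k + i]) ` raisings \<sigma> K (x - i) \<inter> (\<lambda>\<tau>. \<tau>[k := \<sigma> ! k + j]) ` raisings \<sigma> K (x - j) = {}"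
      proof (intro ballI impI, rule ccontr)
        fix i j assume "i \<noteq> j" "(\<lambda>\<tau>. \<tau>[k := \<sigma> ! k + i]) ` raisings \<sigma> K (x - i) \<inter> (\<lambda>\<tau>. \<tau>[k := \<sigma> ! k + j]) ` raisings \<sigma> K (x - j) \<noteq> {}"
        then obtain \<tau> \<rho> where *: "\<tau> \<in> raisings \<sigma> K (x - i)" "\<rho> \<in> raisings \<sigma> K (x - j)" "\<tau>[k := \<sigma> ! k + i] = \<rho>[k := \<sigma> ! k + j]" by blast
        then have "\<tau>[k := \<sigma> ! k + i] ! k = \<rho>[k := \<sigma> ! k + j] ! k" by simp
        then show False using mem(2)[OF *(1)] mem(2)[OF *(2)] k \<open>i \<noteq> j\<close> by simp
      qed
    qed (auto simp: finite_raisings)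
    also have "\<dots> = (\<Sum>y\<le>x. card (raisings \<sigma> K (x - y)))" by (simp add: card_image[OF inj])
    also have "\<dots> = (\<Sum>y\<le>x. card (raisings \<sigma> K y))"
      by (rule sum.reindex_bij_witness[of _ "\<lambda>y. x - y" "\<lambda>y. x - y"]) auto
    also have "\<dots> = (x + card K) choose (card K)"
    proof (cases "K = {}")
      case True
      then show ?thesis using insert.IH by simp
    next
      case False
      then obtain g where g: "card K = Suc g" using insert.hyps(1) by (metis card_gt_0_iff gr0_implies_Suc)
      have "(\<Sum>y\<le>x. card (raisings \<sigma> K y)) = (\<Sum>y\<le>x. (g + y) choose g)"
        using insert.IH insert.prems False g by (simp add: add.commute)
      also have "\<dots> = (g + x + 1) choose (g + 1)" by (rule choose_rising_sum(1))
      finally show ?thesis using g by (simp add: add.commute)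
    qed
    finally show ?case using insert.hyps by simp
  qed
qed

definition corners :: "wpair \<Rightarrow> (nat \<times> nat) set" where
  "corners q = {(k, l). k < length (fst q) \<and> l < length (snd q) \<and> fst q ! k + snd q ! l = sum_list (fst q)}"

text \<open>Read backwards, a reduction raises one entry in each tuple. Only positions that were
  corners of the terminal pair can ever be raised, however many steps have been undone before; as
  all corners lie in column \<open>l\<close>, only \<open>\<pi> ! l\<close> grows in the second
  tuple.\<close>

lemma fibre_column:
  assumes q: "balanced (\<sigma>, \<pi>)" "terminal (\<sigma>, \<pi>)" and l: "l < length \<pi>" "\<And>k l'. (k, l') \<in> corners (\<sigma>, \<pi>) \<Longrightarrow> l' = l"
  defines "K \<equiv> {k. k < length \<sigma> \<and> \<sigma> ! k + \<pi> ! l = sum_list \<sigma>}"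
  shows "fibre (\<sigma>, \<pi>) (sum_list \<sigma> + x) = (\<lambda>\<tau>. (\<tau>, \<pi>[l := \<pi> ! l + x])) ` raisings \<sigma> K x"
proof
  have r: "\<sigma> ! k + \<pi> ! l' \<le> sum_list \<sigma>" if "k < length \<sigma>" "l' < length \<pi>" for k l' using q(2) that by (simp add: terminal_def)
  have "balanced p \<Longrightarrow> \<exists>\<tau> x. p = (\<tau>, \<pi>[l := \<pi> ! l + x]) \<and> \<tau> \<in> raisings \<sigma> K x" if "reduces\<^sup>*\<^sup>* p (\<sigma>, \<pi>)" for p
    using that
  proof (induction rule: converse_rtranclp_induct)
    case base
    show ?case by (intro exI[of _ \<sigma>] exI[of _ 0]) (simp add: raisings_def)
  next
    case (step p p')
    then obtain \<tau> x where p': "p' = (\<tau>, \<pi>[l := \<pi> ! l + x])" "\<tau> \<in> raisings \<sigma> K x" using reduces_sum(1) by blast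
    have \<tau>: "length \<tau> = length \<sigma>" "sum_list \<tau> = sum_list \<sigma> + x" "\<And>k. k < length \<sigma> \<Longrightarrow> \<sigma> ! k \<le> \<tau> ! k"
      "\<And>k. k < length \<sigma> \<Longrightarrow> k \<notin> K \<Longrightarrow> \<tau> ! k = \<sigma> ! k" using p'(2) by (auto simp: raisings_def)
    obtain \<sigma>1 \<pi>1 where p: "p = (\<sigma>1, \<pi>1)" by (cases p)
    obtain k l' where kl: "k < length \<sigma>1" "l' < length \<pi>1" "sum_list \<sigma>1 < \<sigma>1 ! k + \<pi>1 ! l'"
      "p' = (\<sigma>1[k := \<sigma>1 ! k - 1], \<pi>1[l' := \<pi>1 ! l' - 1])" using step.hyps(1) by (auto simp: reduces_def p)
    have bal: "sum_list \<sigma>1 = sum_list \<pi>1" using step.prems by (simp add: balanced_def p)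
    have nontrivial: "0 < \<sigma>1 ! k" "0 < \<pi>1 ! l'" using elem_le_sum_list[OF kl(1)] elem_le_sum_list[OF kl(2)] kl(3) bal by linarith+
    have eqs: "\<tau> = \<sigma>1[k := \<sigma>1 ! k - 1]" "\<pi>[l := \<pi> ! l + x] = \<pi>1[l' := \<pi>1 ! l' - 1]" using kl(4) p'(1) by auto
    have inv: "\<sigma>1 = \<tau>[k := Suc (\<tau> ! k)]" "\<pi>1 = (\<pi>[l := \<pi> ! l + x])[l' := Suc (\<pi>[l := \<pi> ! l + x] ! l')]"
      unfolding eqs using kl nontrivial by auto
    have len: "k < length \<sigma>" "l' < length \<pi>" using kl eqs \<tau>(1) by (metis length_list_update)+
    have S: "Suc (sum_list \<tau>) = sum_list \<sigma>1" using sum_list_dec[OF kl(1) nontrivial(1)] eqs by simp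
    have v: "\<sigma>1 ! k = Suc (\<tau> ! k)" "\<pi>1 ! l' = Suc (\<pi>[l := \<pi> ! l + x] ! l')" using inv len \<tau>(1) by simp_all
    have ge: "sum_list \<sigma> + x \<le> \<tau> ! k + \<pi>[l := \<pi> ! l + x] ! l'" using kl(3) S \<tau>(2) unfolding v by linarith
    \<comment> \<open>Away from \<open>l\<close> the entry of \<pi> is the original one, and
      \<open>\<tau> ! k\<close> has grown by at most \<open>x\<close>. So the step being legal makes
      \<open>(k, l')\<close> a corner of the terminal pair.\<close>
    have l': "l' = l"
    proof (rule ccontr)
      assume ne: "l' \<noteq> l"
      have "(\<Sum>i\<in>{0..<length \<sigma>} - {k}. \<sigma> ! i) \<le> (\<Sum>i\<in>{0..<length \<sigma>} - {k}. \<tau> ! i)" using \<tau>(3) by (intro sum_mono) auto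
      then have "\<tau> ! k \<le> \<sigma> ! k + x" using \<tau>(2) len \<tau>(1) by (simp add: sum_list_sum_nth sum.remove[of _ k])
      then have "(k, l') \<in> corners (\<sigma>, \<pi>)" using ge ne r[OF len] len by (simp add: corners_def)
      then show False using l(2) ne by blast
    qed
    have kK: "k \<in> K"
    proof (rule ccontr)
      assume "k \<notin> K"
      then have "\<sigma> ! k + \<pi> ! l = sum_list \<sigma>" using ge \<tau>(4)[OF len(1)] r[OF len] l' l(1) by simp
      then show False using \<open>k \<notin> K\<close> len by (simp add: K_def)
    qed
    have "sum_list \<sigma>1 = sum_list \<sigma> + Suc x" using S \<tau>(2) by simp
    then have "\<sigma>1 \<in> raisings \<sigma> K (Suc x)" unfolding inv(1) using \<tau> kK len(1) by (auto simp: raisings_def nth_list_update intro: le_SucI)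
    moreover have "\<pi>1 = \<pi>[l := \<pi> ! l + Suc x]" unfolding inv(2) l' using l(1) by simp
    ultimately show ?case using p by blast
  qed
  note sub = this
  show "fibre (\<sigma>, \<pi>) (sum_list \<sigma> + x) \<subseteq> (\<lambda>\<tau>. (\<tau>, \<pi>[l := \<pi> ! l + x])) ` raisings \<sigma> K x"
  proof
    fix p assume p: "p \<in> fibre (\<sigma>, \<pi>) (sum_list \<sigma> + x)"
    then obtain \<tau> y where "p = (\<tau>, \<pi>[l := \<pi> ! l + y])" "\<tau> \<in> raisings \<sigma> K y" using sub[of p] by (auto simp: fibre_def)
    moreover have "y = x" using p calculation by (simp add: fibre_def raisings_def)
    ultimately show "p \<in> (\<lambda>\<tau>. (\<tau>, \<pi>[l := \<pi> ! l + x])) ` raisings \<sigma> K x" by blast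
  qed
  have sum_\<pi>: "sum_list (\<pi>[l := \<pi> ! l + x]) = sum_list \<sigma> + x" for x
    using q(1) l(1) elem_le_sum_list[OF l(1)] by (simp add: balanced_def sum_list_update)
  have "reduces\<^sup>*\<^sup>* (\<tau>, \<pi>[l := \<pi> ! l + x]) (\<sigma>, \<pi>)" if "\<tau> \<in> raisings \<sigma> K x" for \<tau>
    using that
  proof (induction x arbitrary: \<tau>)
    case 0
    have "\<tau> = \<sigma>"
    proof (rule nth_equalityI)
      fix i assume i: "i < length \<tau>"
      have le: "\<And>k. k < length \<sigma> \<Longrightarrow> \<sigma> ! k \<le> \<tau> ! k" and len: "length \<tau> = length \<sigma>" and s: "sum_list \<tau> = sum_list \<sigma>"
        using 0 by (auto simp: raisings_def)
      have "(\<Sum>k\<in>{0..<length \<sigma>} - {i}. \<sigma> ! k) \<le> (\<Sum>k\<in>{0..<length \<sigma>} - {i}. \<tau> ! k)" using le by (intro sum_mono) auto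
      then show "\<tau> ! i = \<sigma> ! i" using s len i le[of i] by (simp add: sum_list_sum_nth sum.remove[of _ i])
    qed (use 0 in \<open>auto simp: raisings_def\<close>)
    then show ?case by simp
  next
    case (Suc x)
    have \<tau>: "length \<tau> = length \<sigma>" "sum_list \<tau> = sum_list \<sigma> + Suc x" "\<And>k. k < length \<sigma> \<Longrightarrow> \<sigma> ! k \<le> \<tau> ! k"
      "\<And>k. k < length \<sigma> \<Longrightarrow> k \<notin> K \<Longrightarrow> \<tau> ! k = \<sigma> ! k" using Suc.prems by (auto simp: raisings_def)
    \<comment> \<open>A row with a surplus lies in \<open>K\<close>, and it can be lowered: its
      entry and that of column \<open>l\<close> have grown by at least \<open>x + 2\<close>
      together, the degree by \<open>x + 1\<close>.\<close>
    have "\<exists>k<length \<sigma>. \<sigma> ! k < \<tau> ! k"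
    proof (rule ccontr)
      assume "\<not> (\<exists>k<length \<sigma>. \<sigma> ! k < \<tau> ! k)"
      then have "\<tau> ! k \<le> \<sigma> ! k" if "k < length \<sigma>" for k using that by (meson not_le)
      then have "sum_list \<tau> \<le> sum_list \<sigma>" using \<tau>(1) by (auto simp: sum_list_sum_nth intro: sum_mono)
      then show False using \<tau>(2) by simp
    qed
    then obtain k where k: "k < length \<sigma>" "\<sigma> ! k < \<tau> ! k" by blast
    then have kK: "k \<in> K" using \<tau>(4)[of k] by fastforce
    let ?\<tau> = "\<tau>[k := \<tau> ! k - 1]"
    have "Suc (sum_list ?\<tau>) = sum_list \<tau>" using sum_list_dec[of k \<tau>] k \<tau>(1) by simp
    then have "?\<tau> \<in> raisings \<sigma> K x" using \<tau> kK k by (auto simp: raisings_def nth_list_update)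
    then have IH: "reduces\<^sup>*\<^sup>* (?\<tau>, \<pi>[l := \<pi> ! l + x]) (\<sigma>, \<pi>)" by (rule Suc.IH)
    have "reduces (\<tau>, \<pi>[l := \<pi> ! l + Suc x]) (?\<tau>, \<pi>[l := \<pi> ! l + x])"
      unfolding reduces_def using k kK \<tau>(1,2) l(1) by (intro exI[of _ k] conjI exI[of _ l]) (auto simp: K_def)
    then show ?case using IH by (rule converse_rtranclp_into_rtranclp)
  qed
  then show "(\<lambda>\<tau>. (\<tau>, \<pi>[l := \<pi> ! l + x])) ` raisings \<sigma> K x \<subseteq> fibre (\<sigma>, \<pi>) (sum_list \<sigma> + x)"
    using sum_\<pi> by (auto simp: fibre_def balanced_def raisings_def)
qed

lemma card_fibre_column:
  assumes q: "balanced (\<sigma>, \<pi>)" "terminal (\<sigma>, \<pi>)" and l: "l < length \<pi>" "\<And>k l'. (k, l') \<in> corners (\<sigma>, \<pi>) \<Longrightarrow> l' = l"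
  defines "g \<equiv> card (corners (\<sigma>, \<pi>))"
  shows "card (fibre (\<sigma>, \<pi>) (sum_list \<sigma> + x)) = (if g = 0 then of_bool (x = 0) else (x + (g - 1)) choose (g - 1))"
proof -
  let ?K = "{k. k < length \<sigma> \<and> \<sigma> ! k + \<pi> ! l = sum_list \<sigma>}"
  have "corners (\<sigma>, \<pi>) = (\<lambda>k. (k, l)) ` ?K" using l by (auto simp: corners_def)
  then have g: "g = card ?K" unfolding g_def by (simp add: card_image inj_on_def)
  have "card (fibre (\<sigma>, \<pi>) (sum_list \<sigma> + x)) = card (raisings \<sigma> ?K x)"
  proof -
    have "fibre (\<sigma>, \<pi>) (sum_list \<sigma> + x) = (\<lambda>\<tau>. (\<tau>, \<pi>[l := \<pi> ! l + x])) ` raisings \<sigma> ?K x"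
      by (rule fibre_column[OF q l(1)]) (rule l(2))
    then show ?thesis by (simp add: card_image inj_on_def)
  qed
  also have "\<dots> = (if ?K = {} then of_bool (x = 0) else (x + (card ?K - 1)) choose (card ?K - 1))"
    by (rule card_raisings) auto
  also have "\<dots> = (if g = 0 then of_bool (x = 0) else (x + (g - 1)) choose (g - 1))" unfolding g by simp
  finally show ?thesis .
qed

lemma corners_swap: "balanced q \<Longrightarrow> corners (prod.swap q) = prod.swap ` corners q"
  by (auto simp: corners_def balanced_def image_iff add.commute)

text \<open>The entries at two corners sum to twice the degree. In different rows and columns this
  is impossible, since two entries of \<sigma> sum to at most the degree, and two out of three or
  more positive entries of \<pi> to less. So any two corners share a line, and then all of them lie
  in one.\<close>

lemma corners_line:
  assumes q: "balanced (\<sigma>, \<pi>)" "nontrivial (\<sigma>, \<pi>)" "3 \<le> length \<pi>"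
  shows "(\<exists>l<length \<pi>. \<forall>(k, l')\<in>corners (\<sigma>, \<pi>). l' = l) \<or> (\<exists>k<length \<sigma>. \<forall>(k', l)\<in>corners (\<sigma>, \<pi>). k' = k)"
proof -
  have share: "k = k' \<or> l = l'" if "(k, l) \<in> corners (\<sigma>, \<pi>)" "(k', l') \<in> corners (\<sigma>, \<pi>)" for k l k' l'
  proof (rule ccontr)
    assume "\<not> (k = k' \<or> l = l')"
    then show False using that two_le_sum_list[of k \<sigma> k'] three_le_sum_list[of l \<pi> l'] q
      by (auto simp: corners_def balanced_def nontrivial_def)
  qed
  have len: "0 < length \<pi>" by (rule less_le_trans[OF _ q(3)]) simp
  show ?thesis
  proof (cases "\<exists>l<length \<pi>. \<forall>(k, l')\<in>corners (\<sigma>, \<pi>). l' = l")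
    case False
    then have "\<exists>(k, l')\<in>corners (\<sigma>, \<pi>). l' \<noteq> 0" using len by blast
    then obtain k l1 where 1: "(k, l1) \<in> corners (\<sigma>, \<pi>)" by blast
    then have "l1 < length \<pi>" by (simp add: corners_def)
    then obtain k2 l2 where 2: "(k2, l2) \<in> corners (\<sigma>, \<pi>)" "l2 \<noteq> l1" using False by blast
    then have "k2 = k" using share[OF 1 2(1)] by auto
    have "\<forall>(k', l)\<in>corners (\<sigma>, \<pi>). k' = k"
    proof (rule ballI, clarify)
      fix k' l assume "(k', l) \<in> corners (\<sigma>, \<pi>)"
      then show "k' = k" using share[OF 1, of k' l] share[OF 2(1), of k' l] 2 \<open>k2 = k\<close> by auto
    qed
    moreover have "k < length \<sigma>" using 1 by (simp add: corners_def)
    ultimately show ?thesis by blast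
  qed blast
qed

lemma card_fibre_3:
  assumes q: "balanced (\<sigma>, \<pi>)" "terminal (\<sigma>, \<pi>)" "nontrivial (\<sigma>, \<pi>)" "3 \<le> length \<pi>" "sum_list \<sigma> \<le> d"
  shows "card (fibre (\<sigma>, \<pi>) d) = (if 1 \<le> gnum \<sigma> \<pi> then ((d - sum_list \<sigma>) + (gnum \<sigma> \<pi> - 1)) choose (gnum \<sigma> \<pi> - 1) else of_bool (d = sum_list \<sigma>))"
proof -
  define x where "x = d - sum_list \<sigma>"
  have d: "d = sum_list \<sigma> + x" using q(5) by (simp add: x_def)
  have g: "gnum \<sigma> \<pi> = card (corners (\<sigma>, \<pi>))" by (simp add: gnum_def corners_def)
  have "card (fibre (\<sigma>, \<pi>) d) = (if gnum \<sigma> \<pi> = 0 then of_bool (x = 0) else (x + (gnum \<sigma> \<pi> - 1)) choose (gnum \<sigma> \<pi> - 1))"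
    using corners_line[OF q(1,3,4)]
  proof
    assume "\<exists>l<length \<pi>. \<forall>(k, l')\<in>corners (\<sigma>, \<pi>). l' = l"
    then obtain l where "l < length \<pi>" "\<And>k l'. (k, l') \<in> corners (\<sigma>, \<pi>) \<Longrightarrow> l' = l" by blast
    then show ?thesis unfolding d g by (rule card_fibre_column[OF q(1,2)])
  next
    assume "\<exists>k<length \<sigma>. \<forall>(k', l)\<in>corners (\<sigma>, \<pi>). k' = k"
    then obtain k where k: "k < length \<sigma>" "\<And>k' l. (k', l) \<in> corners (\<sigma>, \<pi>) \<Longrightarrow> k' = k" by blast
    have b: "balanced (\<pi>, \<sigma>)" "terminal (\<pi>, \<sigma>)" and s: "sum_list \<pi> = sum_list \<sigma>"
      using q(1,2) by (auto simp: balanced_def terminal_def add.commute)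
    have c: "corners (\<pi>, \<sigma>) = prod.swap ` corners (\<sigma>, \<pi>)" using corners_swap[OF q(1)] by simp
    then have cc: "card (corners (\<pi>, \<sigma>)) = card (corners (\<sigma>, \<pi>))" by (simp add: card_image)
    have "card (fibre (\<pi>, \<sigma>) (sum_list \<pi> + x)) = (if card (corners (\<pi>, \<sigma>)) = 0 then of_bool (x = 0) else (x + (card (corners (\<pi>, \<sigma>)) - 1)) choose (card (corners (\<pi>, \<sigma>)) - 1))"
      by (rule card_fibre_column[OF b k(1)]) (use k(2) c in auto)
    then show ?thesis unfolding g cc d s using fibre_swap[of "(\<sigma>, \<pi>)" "sum_list \<sigma> + x"] by simp
  qed
  then show ?thesis using q(5) by (auto simp: x_def)
qed


text \<open>With two rows and two columns a terminal pair has all entries equal. The smallest entry, being invariant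
  under reduction, identifies the terminal pair.\<close>

definition min_entry :: "wpair \<Rightarrow> nat" where
  "min_entry p = min (min (fst p ! 0) (fst p ! 1)) (min (snd p ! 0) (snd p ! 1))"

lemma length_2: "length xs = 2 \<Longrightarrow> \<exists>a b. xs = [a, b]"
  by (cases xs; cases "tl xs") auto

text \<open>If \<open>a + c\<close> exceeds the common sum \<open>a + b = c + e\<close>, then
  \<open>e < a\<close> and \<open>b < c\<close>. Each lowered entry is still at least as large as
  one that stays, so the minimum does not change.\<close>

lemma min4_dec:
  fixes a b c e :: nat
  assumes "e < a" "b < c" shows "min (min (a - 1) b) (min (c - 1) e) = min (min a b) (min c e)"
proof -
  have "min (min (a - 1) b) (min (c - 1) e) = min b e" using assms by linarith
  moreover have "min (min a b) (min c e) = min b e" using assms by linarith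
  ultimately show ?thesis by simp
qed

lemma reduces_min_entry:
  assumes "balanced p" "length (fst p) = 2" "length (snd p) = 2" "reduces p q"
  shows "min_entry q = min_entry p"
proof -
  obtain a b c e where p: "p = ([a, b], [c, e])" using length_2[OF assms(2)] length_2[OF assms(3)] by (metis prod.collapse)
  have bal: "a + b = c + e" using assms(1) by (simp add: balanced_def p)
  obtain k l where kl: "k < length (fst p)" "l < length (snd p)" "sum_list (fst p) < fst p ! k + snd p ! l"
    "q = ((fst p)[k := fst p ! k - 1], (snd p)[l := snd p ! l - 1])" using assms(4) unfolding reduces_def by blast
  then consider "k = 0" "l = 0" | "k = 0" "l = 1" | "k = 1" "l = 0" | "k = 1" "l = 1" unfolding assms(2,3) by (auto simp: less_2_cases_iff)
  then show ?thesis
  proof cases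
    case 1
    then show ?thesis using kl(3,4) bal min4_dec[of e a b c] by (simp add: min_entry_def p ac_simps)
  next
    case 2
    then show ?thesis using kl(3,4) bal min4_dec[of c a b e] by (simp add: min_entry_def p ac_simps)
  next
    case 3
    then show ?thesis using kl(3,4) bal min4_dec[of e b a c] by (simp add: min_entry_def p ac_simps)
  next
    case 4
    then show ?thesis using kl(3,4) bal min4_dec[of c b a e] by (simp add: min_entry_def p ac_simps)
  qed
qed

lemma reduces_rtrancl_min_entry:
  "reduces\<^sup>*\<^sup>* p q \<Longrightarrow> balanced p \<Longrightarrow> length (fst p) = 2 \<Longrightarrow> length (snd p) = 2 \<Longrightarrow> min_entry q = min_entry p"
proof (induction rule: rtranclp_induct)
  case (step q r)
  then show ?case using reduces_min_entry[of q r] reduces_rtrancl(1,3,4)[of p q] by simp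
qed simp

lemma terminal_2:
  assumes "balanced p" "length (fst p) = 2" "length (snd p) = 2" "terminal p"
  shows "p = ([min_entry p, min_entry p], [min_entry p, min_entry p])"
proof -
  obtain a b c e where p: "p = ([a, b], [c, e])" using length_2[OF assms(2)] length_2[OF assms(3)] by (metis prod.collapse)
  have "a + b = c + e" using assms(1) by (simp add: balanced_def p)
  moreover have "a + c \<le> a + b" "a + e \<le> a + b" "b + c \<le> a + b" "b + e \<le> a + b"
    using assms(4) by (auto simp: terminal_def p less_2_cases_iff numeral_2_eq_2 All_less_Suc2)
  ultimately have "a = b" "c = b" "e = b" by linarith+
  then show ?thesis by (simp add: p min_entry_def)
qed

text \<open>The smallest entry is invariant and determines the terminal pair, so membership in the
  fibre is a condition on the minimum alone. A pair of degree \<open>d\<close> is given by its two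
  first entries.\<close>

lemma fibre_2:
  "fibre ([h, h], [h, h]) d = (\<lambda>(a, c). ([a, d - a], [c, d - c])) ` {(a, c). a \<le> d \<and> c \<le> d \<and> min (min a (d - a)) (min c (d - c)) = h}"
proof
  show "fibre ([h, h], [h, h]) d \<subseteq> (\<lambda>(a, c). ([a, d - a], [c, d - c])) ` {(a, c). a \<le> d \<and> c \<le> d \<and> min (min a (d - a)) (min c (d - c)) = h}"
  proof
    fix p assume p: "p \<in> fibre ([h, h], [h, h]) d"
    then have r: "reduces\<^sup>*\<^sup>* p ([h, h], [h, h])" "balanced p" "sum_list (fst p) = d" by (auto simp: fibre_def)
    have len: "length (fst p) = 2" "length (snd p) = 2" using reduces_rtrancl(3,4)[OF r(1,2)] by simp_all
    have s: "min_entry p = h" using reduces_rtrancl_min_entry[OF r(1,2) len] by (simp add: min_entry_def)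
    obtain a b c e where pe: "p = ([a, b], [c, e])" using length_2[OF len(1)] length_2[OF len(2)] by (metis prod.collapse)
    have "a + b = d" "c + e = d" using r by (simp_all add: balanced_def pe)
    then have "b = d - a" "e = d - c" "a \<le> d" "c \<le> d" by auto
    then show "p \<in> (\<lambda>(a, c). ([a, d - a], [c, d - c])) ` {(a, c). a \<le> d \<and> c \<le> d \<and> min (min a (d - a)) (min c (d - c)) = h}"
      using s by (intro image_eqI[of _ _ "(a, c)"]) (simp_all add: pe min_entry_def)
  qed
  show "(\<lambda>(a, c). ([a, d - a], [c, d - c])) ` {(a, c). a \<le> d \<and> c \<le> d \<and> min (min a (d - a)) (min c (d - c)) = h} \<subseteq> fibre ([h, h], [h, h]) d"
  proof (rule image_subsetI, clarify)
    fix a c assume ac: "a \<le> d" "c \<le> d" "h = min (min a (d - a)) (min c (d - c))"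
    let ?p = "([a, d - a], [c, d - c])"
    have b: "balanced ?p" using ac by (simp add: balanced_def)
    obtain q where q: "reduces\<^sup>*\<^sup>* ?p q" "terminal q" using nf_exists[OF b] by blast
    have "balanced q" "length (fst q) = 2" "length (snd q) = 2" using reduces_rtrancl(1,3,4)[OF q(1) b] by simp_all
    then have "q = ([min_entry q, min_entry q], [min_entry q, min_entry q])" using q(2) by (rule terminal_2)
    moreover have "min_entry q = h" using reduces_rtrancl_min_entry[OF q(1) b] ac(3) by (simp add: min_entry_def)
    ultimately have "reduces\<^sup>*\<^sup>* ?p ([h, h], [h, h])" using q(1) by simp
    then show "([a, d - a], [c, d - c]) \<in> fibre ([min (min a (d - a)) (min c (d - c)), min (min a (d - a)) (min c (d - c))],
      [min (min a (d - a)) (min c (d - c)), min (min a (d - a)) (min c (d - c))]) d"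
      using b ac by (simp add: fibre_def)
  qed
qed

text \<open>The first entries \<open>(a, c)\<close> with minimum \<open>h\<close> are the lattice
  points on the boundary of a square of side \<open>x\<close>, which degenerates to a point if
  \<open>x = 0\<close>.\<close>

lemma card_fibre_2: "card (fibre ([h, h], [h, h]) (2 * h + x)) = 4 * x + of_bool (x = 0)"
proof -
  let ?d = "2 * h + x"
  have "{(a, c). a \<le> ?d \<and> c \<le> ?d \<and> min (min a (?d - a)) (min c (?d - c)) = h} =
    {h..h + x} \<times> {h..h + x} - {Suc h..<h + x} \<times> {Suc h..<h + x}"
    by (auto simp: min_def split: if_splits)
  moreover have "card ({h..h + x} \<times> {h..h + x} - {Suc h..<h + x} \<times> {Suc h..<h + x}) = Suc x * Suc x - (x - 1) * (x - 1)"
    by (subst card_Diff_subset) (auto simp: card_cartesian_product)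
  \<comment> \<open>For \<open>x = 0\<close> truncation turns \<open>x - 1\<close> into 0, which
    accounts for the extra 1.\<close>
  moreover have "Suc x * Suc x - (x - 1) * (x - 1) = 4 * x + of_bool (x = 0)"
    by (cases x) (simp_all add: algebra_simps)
  moreover have "inj_on (\<lambda>(a, c). ([a, ?d - a], [c, ?d - c])) A" for A :: "(nat \<times> nat) set"
    by (auto simp: inj_on_def)
  ultimately show ?thesis unfolding fibre_2 by (simp add: card_image)
qed

lemma card_fibre:
  assumes q: "balanced (\<sigma>, \<pi>)" "terminal (\<sigma>, \<pi>)" "nontrivial (\<sigma>, \<pi>)" "length \<sigma> \<le> length \<pi>" "sum_list \<sigma> \<le> d"
  shows "card (fibre (\<sigma>, \<pi>) d) = A_num \<sigma> \<pi> d"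
proof (cases "3 \<le> length \<pi>")
  case True
  then show ?thesis using card_fibre_3[OF q(1-3) True q(5)] by (simp add: A_num_def Let_def)
next
  case False
  then have len: "length \<sigma> = 2" "length \<pi> = 2" using q(3,4) by (auto simp: nontrivial_def)
  define h where "h = min_entry (\<sigma>, \<pi>)"
  have e: "\<sigma> = [h, h]" "\<pi> = [h, h]" using terminal_2[OF q(1) _ _ q(2)] len by (auto simp: h_def)
  define x where "x = d - 2 * h"
  have d: "d = 2 * h + x" using q(5) by (simp add: x_def e)
  show ?thesis using card_fibre_2[of h x] by (simp add: A_num_def Let_def e d)
qed

section \<open>The product formula\<close>

definition positive_pairs :: "nat \<Rightarrow> wpair set" where
  "positive_pairs d = {(\<tau>, \<upsilon>). 0 \<notin> set \<tau> \<and> 0 \<notin> set \<upsilon> \<and> sum_list \<tau> = d \<and> sum_list \<upsilon> = d}"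

abbreviation pair_det :: "wpair \<Rightarrow> complex" where
  "pair_det p \<equiv> det_RSK_weight (fst p) (snd p)"

lemma sum_list_strip: "sum_list (strip \<sigma>) = sum_list \<sigma>"
  by (induction \<sigma>) auto

text \<open>A list in this set is given by the positions of its nonzero entries. The binomials of
  \<open>N_num\<close> originate here; the induction is Pascal's rule, according to whether the
  first entry is zero.\<close>

lemma card_strip:
  assumes "0 \<notin> set \<tau>"
  shows "finite {\<sigma>. length \<sigma> = m \<and> strip \<sigma> = \<tau>} \<and> card {\<sigma>. length \<sigma> = m \<and> strip \<sigma> = \<tau>} = m choose length \<tau>"
  using assms
proof (induction m arbitrary: \<tau>)
  case 0
  have "{\<sigma>. length \<sigma> = 0 \<and> strip \<sigma> = \<tau>} = (if \<tau> = [] then {[]} else {})" by auto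
  then show ?case by (cases \<tau>) auto
next
  case (Suc m)
  let ?S = "\<lambda>m \<tau>. {\<sigma>. length \<sigma> = m \<and> strip \<sigma> = \<tau>}"
  have inj: "inj_on (Cons a) A" for a :: nat and A by (simp add: inj_on_def)
  show ?case
  proof (cases \<tau>)
    case Nil
    have "?S (Suc m) \<tau> = Cons 0 ` ?S m \<tau>" by (auto simp: Nil length_Suc_conv split: if_splits)
    then show ?thesis using Suc by (simp add: card_image[OF inj] Nil)
  next
    case (Cons a \<tau>')
    have e: "?S (Suc m) \<tau> = Cons 0 ` ?S m \<tau> \<union> Cons a ` ?S m \<tau>'"
      using Suc.prems by (auto simp: Cons length_Suc_conv split: if_splits)
    have "Cons 0 ` ?S m \<tau> \<inter> Cons a ` ?S m \<tau>' = {}" using Suc.prems by (auto simp: Cons)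
    then show ?thesis unfolding e using Suc.IH[of \<tau>] Suc.IH[of \<tau>'] Suc.prems
      by (subst card_Un_disjoint) (auto simp: card_image[OF inj] Cons)
  qed
qed

lemma length_le_sum_list: "0 \<notin> set \<tau> \<Longrightarrow> length \<tau> \<le> sum_list (\<tau> :: nat list)"
  by (induction \<tau>) auto

lemma finite_positive_pairs: "finite (positive_pairs d)"
proof -
  let ?L = "{\<tau>. set \<tau> \<subseteq> {..d} \<and> length \<tau> \<le> d}"
  have "finite ?L" by (rule finite_lists_length_le) simp
  moreover have "positive_pairs d \<subseteq> ?L \<times> ?L"
  proof
    fix p assume "p \<in> positive_pairs d"
    then have "fst p \<in> ?L" "snd p \<in> ?L"
      using length_le_sum_list[of "fst p"] length_le_sum_list[of "snd p"] by (auto simp: positive_pairs_def dest: member_le_sum_list)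
    then show "p \<in> ?L \<times> ?L" by (simp add: mem_Times_iff)
  qed
  ultimately show ?thesis by (meson finite_SigmaI finite_subset)
qed

text \<open>The determinant of a weight depends only on its nonzero entries, so the weights are
  grouped by these, with multiplicities from \<open>card_strip\<close>.\<close>

lemma det_RSK_degree_positive_pairs:
  "det_RSK_degree m n d = (\<Prod>p\<in>positive_pairs d. pair_det p ^ ((m choose length (fst p)) * (n choose length (snd p))))"
proof -
  let ?h = "\<lambda>p. (strip (fst p), strip (snd p))"
  have "(\<Prod>p\<in>weight_pairs m n d. pair_det p) = (\<Prod>y\<in>positive_pairs d. \<Prod>p\<in>{p \<in> weight_pairs m n d. ?h p = y}. pair_det p)"
  proof (rule prod.group[symmetric])
    show "?h ` weight_pairs m n d \<subseteq> positive_pairs d"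
    proof (rule image_subsetI)
      fix p assume "p \<in> weight_pairs m n d"
      then have "sum_list (strip (fst p)) = d" "sum_list (strip (snd p)) = d"
        unfolding sum_list_strip by (auto simp: weight_pairs_def)
      then show "?h p \<in> positive_pairs d" unfolding positive_pairs_def by simp
    qed
  qed (rule finite_weight_pairs finite_positive_pairs)+
  also have "\<dots> = (\<Prod>p\<in>positive_pairs d. pair_det p ^ ((m choose length (fst p)) * (n choose length (snd p))))"
  proof (rule prod.cong[OF refl])
    fix y assume y: "y \<in> positive_pairs d"
    have "{p \<in> weight_pairs m n d. ?h p = y} = {\<sigma>. length \<sigma> = m \<and> strip \<sigma> = fst y} \<times> {\<pi>. length \<pi> = n \<and> strip \<pi> = snd y}"
    proof -
      obtain a b where prod_entry: "y = (a, b)" "sum_list a = d" "sum_list b = d" using y by (auto simp: positive_pairs_def)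
      have *: "sum_list \<sigma> = d" if "strip \<sigma> = a \<or> strip \<sigma> = b" for \<sigma>
        using that prod_entry sum_list_strip[of \<sigma>] by metis
      show ?thesis
      proof (rule Set.set_eqI)
        fix p
        show "p \<in> {p \<in> weight_pairs m n d. ?h p = y} \<longleftrightarrow> p \<in> {\<sigma>. length \<sigma> = m \<and> strip \<sigma> = fst y} \<times> {\<pi>. length \<pi> = n \<and> strip \<pi> = snd y}"
          using *[of "fst p"] *[of "snd p"] unfolding prod_entry(1) by (cases p) (simp add: weight_pairs_def; blast)
      qed
    qed
    then have "card {p \<in> weight_pairs m n d. ?h p = y} = card ({\<sigma>. length \<sigma> = m \<and> strip \<sigma> = fst y} \<times> {\<pi>. length \<pi> = n \<and> strip \<pi> = snd y})" by (simp only:)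
    also have "\<dots> = (m choose length (fst y)) * (n choose length (snd y))"
      using card_strip[of "fst y" m] card_strip[of "snd y" n] y by (auto simp: card_cartesian_product positive_pairs_def)
    finally have card: "card {p \<in> weight_pairs m n d. ?h p = y} = (m choose length (fst y)) * (n choose length (snd y))" .
    have "(\<Prod>p\<in>{p \<in> weight_pairs m n d. ?h p = y}. pair_det p) = (\<Prod>p\<in>{p \<in> weight_pairs m n d. ?h p = y}. pair_det y)"
    proof (intro prod.cong refl)
      fix p assume "p \<in> {p \<in> weight_pairs m n d. ?h p = y}"
      then have "y = ?h p" by auto
      then show "pair_det p = pair_det y" using det_RSK_weight_strip[of "fst p" "snd p"] by simp
    qed
    also have "\<dots> = pair_det y ^ ((m choose length (fst y)) * (n choose length (snd y)))" unfolding card[symmetric] by (rule prod_constant)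
    finally show "(\<Prod>p\<in>{p \<in> weight_pairs m n d. ?h p = y}. pair_det p) = pair_det y ^ ((m choose length (fst y)) * (n choose length (snd y)))" .
  qed
  finally show ?thesis by (simp add: det_RSK_degree_prod case_prod_beta)
qed

lemma det_RSK_weight_0: "sum_list \<sigma> = 0 \<Longrightarrow> sum_list \<pi> = 0 \<Longrightarrow> det_RSK_weight \<sigma> \<pi> = 1"
proof -
  assume "sum_list \<sigma> = 0" "sum_list \<pi> = 0"
  then have "strip \<sigma> = []" "strip \<pi> = []" by (auto simp: filter_empty_conv)
  then have "det_RSK_weight \<sigma> \<pi> = det_RSK_weight [] []" using det_RSK_weight_strip[of \<sigma> \<pi>] by simp
  also have "\<dots> = ldet [0] (rsk_poly 0 0)"
  proof -
    have "weight_exps [] [] = {0}" by (auto simp: weight_exps_def nat_matrices_def)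
    then show ?thesis using det_RSK_weight_ldet[of "[0]" "[]" "[]"] by simp
  qed
  also have "\<dots> = 1" by (simp add: ldet_def det_single bidet_def)
  finally show ?thesis .
qed

text \<open>With a single row the condition for lowering holds at every positive entry of \<pi>, so
  the degree can be brought down to 0.\<close>

lemma det_RSK_weight_singleton: "sum_list \<pi> = d \<Longrightarrow> det_RSK_weight [d] \<pi> = 1"
proof (induction d arbitrary: \<pi>)
  case 0
  then show ?case by (intro det_RSK_weight_0) simp_all
next
  case (Suc d)
  have "\<exists>l<length \<pi>. 0 < \<pi> ! l"
  proof (rule ccontr)
    assume "\<not> (\<exists>l<length \<pi>. 0 < \<pi> ! l)"
    then have "sum_list \<pi> = 0" by (simp add: sum_list_sum_nth)
    then show False using Suc.prems by simp
  qed
  then obtain l where l: "l < length \<pi>" "0 < \<pi> ! l" by blast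
  let ?\<pi> = "\<pi>[l := \<pi> ! l - 1]"
  have s: "sum_list ?\<pi> = d" using sum_list_dec[OF l] Suc.prems by simp
  have "det_RSK_weight ([d][0 := Suc ([d] ! 0)]) (?\<pi>[l := Suc (?\<pi> ! l)]) = det_RSK_weight [d] ?\<pi>"
    by (rule det_RSK_weight_corner) (use s l in auto)
  then show ?case using Suc.IH[OF s] l by simp
qed

lemma pair_det_not_nontrivial:
  assumes "p \<in> positive_pairs d" "\<not> nontrivial p" shows "pair_det p = 1"
proof -
  have 1: "det_RSK_weight \<sigma> \<pi> = 1" if "length \<sigma> < 2" "sum_list \<sigma> = sum_list \<pi>" for \<sigma> \<pi>
  proof (cases \<sigma>)
    case Nil
    then show ?thesis using that by (intro det_RSK_weight_0) auto
  next
    case (Cons a \<sigma>')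
    then show ?thesis using that by (intro det_RSK_weight_singleton[of \<pi> a, THEN trans[rotated]]) auto
  qed
  obtain \<sigma> \<pi> where p: "p = (\<sigma>, \<pi>)" by (cases p)
  have "length \<sigma> < 2 \<or> length \<pi> < 2" "sum_list \<sigma> = sum_list \<pi>" using assms by (auto simp: positive_pairs_def nontrivial_def p)
  then show ?thesis using 1[of \<sigma> \<pi>] 1[of \<pi> \<sigma>] by (auto simp: p det_RSK_weight_flip[of \<sigma> \<pi>])
qed

definition reduced_pairs :: "nat \<Rightarrow> wpair set" where
  "reduced_pairs d = {q. nontrivial q \<and> balanced q \<and> terminal q \<and> sum_list (fst q) \<le> d}"

lemma finite_reduced_pairs: "finite (reduced_pairs d)"
proof -
  have "reduced_pairs d \<subseteq> (\<Union>d'\<le>d. positive_pairs d')"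
  proof
    fix q assume "q \<in> reduced_pairs d"
    then have "q \<in> positive_pairs (sum_list (fst q))" "sum_list (fst q) \<le> d"
      by (cases q; simp add: reduced_pairs_def positive_pairs_def nontrivial_def balanced_def)+
    then show "q \<in> (\<Union>d'\<le>d. positive_pairs d')" by blast
  qed
  then show ?thesis using finite_positive_pairs by (meson finite_UN finite_atMost finite_subset)
qed

text \<open>\<open>fibre\<close> does not ask for nontrivial members; this supplies the property for
  the fibres over nontrivial pairs.\<close>

lemma reduces_nontrivial_back: "reduces p q \<Longrightarrow> nontrivial q \<Longrightarrow> nontrivial p"
proof -
  assume "reduces p q" "nontrivial q"
  then obtain k l where kl: "k < length (fst p)" "l < length (snd p)"
    "q = ((fst p)[k := fst p ! k - 1], (snd p)[l := snd p ! l - 1])" unfolding reduces_def by blast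
  have *: "0 \<notin> set xs" if "0 \<notin> set (xs[k := xs ! k - 1])" "k < length xs" for xs :: "nat list" and k
  proof
    assume "0 \<in> set xs"
    then obtain i where "i < length xs" "xs ! i = 0" by (auto simp: in_set_conv_nth)
    then have "i < length (xs[k := xs ! k - 1])" "xs[k := xs ! k - 1] ! i = 0" using that(2) by (auto simp: nth_list_update)
    then show False using that(1) by (metis nth_mem)
  qed
  show "nontrivial p" using \<open>nontrivial q\<close> kl *[of "fst p" k] *[of "snd p" l] by (auto simp: nontrivial_def)
qed

lemma reduces_rtrancl_nontrivial_back: "reduces\<^sup>*\<^sup>* p q \<Longrightarrow> nontrivial q \<Longrightarrow> nontrivial p"
  by (induction rule: converse_rtranclp_induct) (auto intro: reduces_nontrivial_back)

text \<open>Grouping by normal form: uniqueness identifies each group with a \<open>fibre\<close>,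
  along which the determinant and the lengths, hence also the binomials, are constant.\<close>

lemma det_RSK_degree_reduced_pairs:
  "det_RSK_degree m n d = (\<Prod>q\<in>reduced_pairs d. pair_det q ^ (card (fibre q d) * ((m choose length (fst q)) * (n choose length (snd q)))))"
proof -
  let ?c = "\<lambda>p. (m choose length (fst p)) * (n choose length (snd p))"
  let ?P = "{p \<in> positive_pairs d. nontrivial p}"
  define nf where "nf p = (SOME q. reduces\<^sup>*\<^sup>* p q \<and> terminal q)" for p
  have nf: "reduces\<^sup>*\<^sup>* p (nf p) \<and> terminal (nf p)" if "balanced p" for p
    unfolding nf_def by (rule someI_ex) (rule nf_exists[OF that])
  have bal: "balanced p" if "p \<in> positive_pairs d" for p using that by (auto simp: positive_pairs_def balanced_def)
  have sub: "nf ` ?P \<subseteq> reduced_pairs d"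
  proof (rule image_subsetI)
    fix p assume p: "p \<in> ?P"
    then have b: "balanced p" "nontrivial p" "sum_list (fst p) = d" using bal by (auto simp: positive_pairs_def)
    note n = nf[OF b(1)]
    show "nf p \<in> reduced_pairs d"
      using reduces_rtrancl(1,2)[of p "nf p"] reduces_rtrancl_nontrivial[of p "nf p"] n b by (simp add: reduced_pairs_def)
  qed
  have "det_RSK_degree m n d = (\<Prod>p\<in>?P. pair_det p ^ ?c p)"
    unfolding det_RSK_degree_positive_pairs
  proof (rule prod.mono_neutral_right)
    show "\<forall>p\<in>positive_pairs d - ?P. pair_det p ^ ?c p = 1"
    proof
      fix p assume "p \<in> positive_pairs d - ?P"
      then show "pair_det p ^ ?c p = 1" using pair_det_not_nontrivial[of p d] by simp
    qed
  qed (auto intro: finite_positive_pairs)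
  also have "\<dots> = (\<Prod>q\<in>reduced_pairs d. \<Prod>p\<in>{p \<in> ?P. nf p = q}. pair_det p ^ ?c p)"
    by (rule prod.group[symmetric]) (use sub finite_reduced_pairs in \<open>auto simp: finite_positive_pairs\<close>)
  also have "\<dots> = (\<Prod>q\<in>reduced_pairs d. pair_det q ^ (card (fibre q d) * ?c q))"
  proof (intro prod.cong refl)
    fix q assume q: "q \<in> reduced_pairs d"
    have e: "{p \<in> ?P. nf p = q} = fibre q d"
    proof
      show "{p \<in> ?P. nf p = q} \<subseteq> fibre q d"
      proof
        fix p assume p: "p \<in> {p \<in> ?P. nf p = q}"
        then have "balanced p" "sum_list (fst p) = d" using bal by (auto simp: positive_pairs_def)
        then show "p \<in> fibre q d" using nf[of p] p by (simp add: fibre_def)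
      qed
      show "fibre q d \<subseteq> {p \<in> ?P. nf p = q}"
      proof
        fix p assume p: "p \<in> fibre q d"
        then have "nontrivial p" using reduces_rtrancl_nontrivial_back[of p q] q by (auto simp: fibre_def reduced_pairs_def)
        moreover have "nf p = q" using nf_unique[of p "nf p" q] nf[of p] p q by (auto simp: fibre_def reduced_pairs_def)
        ultimately show "p \<in> {p \<in> ?P. nf p = q}" using p by (cases p) (auto simp: fibre_def positive_pairs_def nontrivial_def balanced_def)
      qed
    qed
    have "(\<Prod>p\<in>fibre q d. pair_det p ^ ?c p) = (\<Prod>p\<in>fibre q d. pair_det q ^ ?c q)"
    proof (intro prod.cong refl)
      fix p assume "p \<in> fibre q d"
      then show "pair_det p ^ ?c p = pair_det q ^ ?c q" using reduces_rtrancl(3,4,5)[of p q] by (simp add: fibre_def)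
    qed
    then show "(\<Prod>p\<in>{p \<in> ?P. nf p = q}. pair_det p ^ ?c p) = pair_det q ^ (card (fibre q d) * ?c q)"
      unfolding e by (simp add: power_mult[symmetric] mult.commute)
  qed
  finally show ?thesis .
qed

section \<open>From reduced pairs to normalized ones\<close>

definition normalized_reduced_pairs :: "nat \<Rightarrow> wpair set" where
  "normalized_reduced_pairs d = {(\<sigma>, \<pi>). \<exists>d'. 0 < d' \<and> d' \<le> d \<and> weight_pair d' \<sigma> \<pi> \<and> normalized \<sigma> \<pi> \<and> reduced \<sigma> \<pi>}"

text \<open>With \<open>normalized_antisym\<close>: of the two orders of a pair of positive tuples
  the normalization selects exactly one, unless the tuples coincide.\<close>

lemma normalized_total:
  assumes "0 \<notin> set \<sigma>" "0 \<notin> set \<pi>" shows "normalized \<sigma> \<pi> \<or> normalized \<pi> \<sigma>"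
proof (cases "length \<sigma> = length \<pi> \<and> \<sigma> \<noteq> \<pi>")
  case True
  define i where "i = (LEAST i. i < length \<sigma> \<and> \<sigma> ! i \<noteq> \<pi> ! i)"
  have "\<exists>i. i < length \<sigma> \<and> \<sigma> ! i \<noteq> \<pi> ! i" using True nth_equalityI by metis
  then have i: "i < length \<sigma> \<and> \<sigma> ! i \<noteq> \<pi> ! i" unfolding i_def by (rule LeastI_ex)
  have eq: "\<sigma> ! k = \<pi> ! k" if "k < i" for k
    using not_less_Least[of k "\<lambda>i. i < length \<sigma> \<and> \<sigma> ! i \<noteq> \<pi> ! i"] that i by (auto simp: i_def)
  show ?thesis
  proof (cases "\<sigma> ! i > \<pi> ! i")
    case *: True
    have "\<exists>i<length \<sigma>. \<sigma> ! i > \<pi> ! i \<and> (\<forall>k<i. \<sigma> ! k = \<pi> ! k)" using * i eq by blast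
    then show ?thesis using assms True by (simp add: normalized_def)
  next
    case False
    then have "\<pi> ! i > \<sigma> ! i" using i by simp
    then have "\<exists>i<length \<pi>. \<pi> ! i > \<sigma> ! i \<and> (\<forall>k<i. \<pi> ! k = \<sigma> ! k)" using i eq True by metis
    then show ?thesis using assms True by (simp add: normalized_def)
  qed
next
  case False
  then show ?thesis using assms by (auto simp: normalized_def)
qed

lemma normalized_antisym: "normalized \<sigma> \<pi> \<Longrightarrow> normalized \<pi> \<sigma> \<Longrightarrow> \<sigma> = \<pi>"
  unfolding normalized_def by (metis le_antisym linorder_neqE_nat order_less_asym)

lemma terminal_reduced:
  assumes "balanced (\<sigma>, \<pi>)" "\<sigma> \<noteq> []" "\<pi> \<noteq> []" shows "terminal (\<sigma>, \<pi>) \<longleftrightarrow> reduced \<sigma> \<pi>"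
proof
  assume r: "terminal (\<sigma>, \<pi>)"
  have "Max (set \<sigma>) \<in> set \<sigma>" "Max (set \<pi>) \<in> set \<pi>" using assms by auto
  then obtain k l where kl: "k < length \<sigma>" "\<sigma> ! k = Max (set \<sigma>)" "l < length \<pi>" "\<pi> ! l = Max (set \<pi>)"
    unfolding in_set_conv_nth by blast
  have "\<sigma> ! k + \<pi> ! l \<le> sum_list \<sigma>" using r kl(1,3) unfolding terminal_def by simp
  then show "reduced \<sigma> \<pi>" using kl by (simp add: reduced_def)
next
  assume r: "reduced \<sigma> \<pi>"
  show "terminal (\<sigma>, \<pi>)" unfolding terminal_def fst_conv snd_conv
  proof (intro allI impI)
    fix k l assume "k < length \<sigma>" "l < length \<pi>"
    then have "\<sigma> ! k + \<pi> ! l \<le> Max (set \<sigma>) + Max (set \<pi>)" by (intro add_mono Max_ge) auto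
    then show "\<sigma> ! k + \<pi> ! l \<le> sum_list \<sigma>" using r by (simp add: reduced_def)
  qed
qed

lemma terminal_swap: "balanced q \<Longrightarrow> terminal (prod.swap q) \<longleftrightarrow> terminal q"
  by (auto simp: terminal_def balanced_def add.commute)

text \<open>A tuple with one entry has the degree as its maximum, which leaves no room for a
  positive maximum of the other.\<close>

lemma reduced_length:
  assumes "weight_pair d' \<sigma> \<pi>" "0 < d'" "0 \<notin> set \<sigma>" "0 \<notin> set \<pi>" "reduced \<sigma> \<pi>"
  shows "2 \<le> length \<sigma>" "2 \<le> length \<pi>"
proof -
  have s: "sum_list \<sigma> = d'" "sum_list \<pi> = d'" using assms(1) by (auto simp: weight_pair_def)
  have "\<sigma> \<noteq> []" using s(1) assms(2) by auto
  moreover have "\<pi> \<noteq> []" using s(2) assms(2) by auto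
  ultimately have ne: "\<sigma> \<noteq> []" "\<pi> \<noteq> []" by auto
  then have "Max (set \<sigma>) \<in> set \<sigma>" "Max (set \<pi>) \<in> set \<pi>" by auto
  then have p: "0 < Max (set \<sigma>)" "0 < Max (set \<pi>)" using assms(3,4) by (metis gr0I)+
  have r: "Max (set \<sigma>) + Max (set \<pi>) \<le> d'" using assms(5) s by (simp add: reduced_def)
  show "2 \<le> length \<sigma>"
  proof (rule ccontr)
    assume "\<not> 2 \<le> length \<sigma>"
    then have "length \<sigma> = Suc 0" using ne(1) by (simp add: not_le less_2_cases_iff)
    then obtain a where "\<sigma> = [a]" by (auto simp: length_Suc_conv)
    then show False using r p s by simp
  qed
  show "2 \<le> length \<pi>"
  proof (rule ccontr)
    assume "\<not> 2 \<le> length \<pi>"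
    then have "length \<pi> = Suc 0" using ne(2) by (simp add: not_le less_2_cases_iff)
    then obtain a where "\<pi> = [a]" by (auto simp: length_Suc_conv)
    then show False using r p s by simp
  qed
qed

lemma normalized_reduced_pairs_iff: "(\<sigma>, \<pi>) \<in> normalized_reduced_pairs d \<longleftrightarrow> (\<sigma>, \<pi>) \<in> reduced_pairs d \<and> normalized \<sigma> \<pi>"
proof
  assume "(\<sigma>, \<pi>) \<in> normalized_reduced_pairs d"
  then obtain d' where d': "0 < d'" "d' \<le> d" "weight_pair d' \<sigma> \<pi>" "normalized \<sigma> \<pi>" "reduced \<sigma> \<pi>" by (auto simp: normalized_reduced_pairs_def)
  have z: "0 \<notin> set \<sigma>" "0 \<notin> set \<pi>" using d' by (auto simp: normalized_def)
  note l = reduced_length[OF d'(3,1) z d'(5)]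
  have b: "balanced (\<sigma>, \<pi>)" "sum_list \<sigma> = d'" using d' by (auto simp: balanced_def weight_pair_def)
  have "\<sigma> \<noteq> []" "\<pi> \<noteq> []" using l by auto
  then show "(\<sigma>, \<pi>) \<in> reduced_pairs d \<and> normalized \<sigma> \<pi>" using d' z l b terminal_reduced[OF b(1)] by (simp add: reduced_pairs_def nontrivial_def)
next
  assume *: "(\<sigma>, \<pi>) \<in> reduced_pairs d \<and> normalized \<sigma> \<pi>"
  then have q: "nontrivial (\<sigma>, \<pi>)" "balanced (\<sigma>, \<pi>)" "terminal (\<sigma>, \<pi>)" "sum_list \<sigma> \<le> d" by (auto simp: reduced_pairs_def)
  then have ne: "\<sigma> \<noteq> []" "\<pi> \<noteq> []" by (auto simp: nontrivial_def)
  have "length \<sigma> \<le> sum_list \<sigma>" using q by (auto simp: nontrivial_def intro: length_le_sum_list)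
  then have "0 < sum_list \<sigma>" using q(1) by (simp add: nontrivial_def)
  then show "(\<sigma>, \<pi>) \<in> normalized_reduced_pairs d" using * q terminal_reduced[OF q(2) ne]
    by (auto simp: normalized_reduced_pairs_def weight_pair_def balanced_def)
qed

text \<open>The two products of binomials in \<open>N_num\<close> belong to a normalized pair and to
  its swap, which has the same determinant and a fibre of the same size.\<close>

lemma det_RSK_degree_normalized_reduced_pairs: "det_RSK_degree m n d = (\<Prod>(\<sigma>, \<pi>)\<in>normalized_reduced_pairs d. det_RSK_weight \<sigma> \<pi> ^ N_num \<sigma> \<pi> m n d)"
proof -
  let ?f = "\<lambda>q. pair_det q ^ (card (fibre q d) * ((m choose length (fst q)) * (n choose length (snd q))))"
  let ?N = "{q \<in> normalized_reduced_pairs d. fst q \<noteq> snd q}"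
  have fin: "finite (normalized_reduced_pairs d)" by (rule finite_subset[OF _ finite_reduced_pairs[of d]]) (auto simp: normalized_reduced_pairs_iff)
  have swap_reduced_pairs: "prod.swap q \<in> reduced_pairs d" if "q \<in> reduced_pairs d" for q
    using that terminal_swap[of q] by (auto simp: reduced_pairs_def nontrivial_def balanced_def)
  have un: "reduced_pairs d = normalized_reduced_pairs d \<union> prod.swap ` ?N"
  proof
    show "reduced_pairs d \<subseteq> normalized_reduced_pairs d \<union> prod.swap ` ?N"
    proof
      fix q assume q: "q \<in> reduced_pairs d"
      obtain \<sigma> \<pi> where e: "q = (\<sigma>, \<pi>)" by (cases q)
      have z: "0 \<notin> set \<sigma>" "0 \<notin> set \<pi>" using q by (auto simp: reduced_pairs_def nontrivial_def e)
      show "q \<in> normalized_reduced_pairs d \<union> prod.swap ` ?N"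
      proof (cases "normalized \<sigma> \<pi>")
        case False
        then have "(\<pi>, \<sigma>) \<in> ?N" using normalized_total[OF z] swap_reduced_pairs[OF q] by (auto simp: normalized_reduced_pairs_iff e)
        then show ?thesis by (intro UnI2 image_eqI[of _ _ "(\<pi>, \<sigma>)"]) (simp_all add: e)
      qed (use q e normalized_reduced_pairs_iff in auto)
    qed
    show "normalized_reduced_pairs d \<union> prod.swap ` ?N \<subseteq> reduced_pairs d" using swap_reduced_pairs by (force simp: normalized_reduced_pairs_iff)
  qed
  have "normalized_reduced_pairs d \<inter> prod.swap ` ?N = {}" using normalized_antisym by (auto simp: normalized_reduced_pairs_iff)
  then have "(\<Prod>q\<in>reduced_pairs d. ?f q) = (\<Prod>q\<in>normalized_reduced_pairs d. ?f q) * (\<Prod>q\<in>prod.swap ` ?N. ?f q)"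
    unfolding un using fin by (intro prod.union_disjoint) auto
  also have "(\<Prod>q\<in>prod.swap ` ?N. ?f q) = (\<Prod>q\<in>?N. ?f (prod.swap q))" by (subst prod.reindex) auto
  also have "\<dots> = (\<Prod>q\<in>normalized_reduced_pairs d. if fst q \<noteq> snd q then ?f (prod.swap q) else 1)" by (rule prod.inter_filter[OF fin])
  also have "(\<Prod>q\<in>normalized_reduced_pairs d. ?f q) * \<dots> = (\<Prod>q\<in>normalized_reduced_pairs d. ?f q * (if fst q \<noteq> snd q then ?f (prod.swap q) else 1))"
    by (rule prod.distrib[symmetric])
  also have "\<dots> = (\<Prod>(\<sigma>, \<pi>)\<in>normalized_reduced_pairs d. det_RSK_weight \<sigma> \<pi> ^ N_num \<sigma> \<pi> m n d)"
  proof (intro prod.cong refl)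
    fix q assume q: "q \<in> normalized_reduced_pairs d"
    obtain \<sigma> \<pi> where e: "q = (\<sigma>, \<pi>)" by (cases q)
    have "card (fibre (\<sigma>, \<pi>) d) = A_num \<sigma> \<pi> d"
      by (rule card_fibre) (use q in \<open>auto simp: e normalized_reduced_pairs_iff reduced_pairs_def normalized_def\<close>)
    moreover have "card (fibre (\<pi>, \<sigma>) d) = card (fibre (\<sigma>, \<pi>) d)" using fibre_swap[of "(\<sigma>, \<pi>)" d] by simp
    ultimately show "?f q * (if fst q \<noteq> snd q then ?f (prod.swap q) else 1) = (case q of (\<sigma>, \<pi>) \<Rightarrow> det_RSK_weight \<sigma> \<pi> ^ N_num \<sigma> \<pi> m n d)"
      by (simp add: e N_num_def det_RSK_weight_flip[of \<sigma> \<pi>] power_add[symmetric] distrib_left mult.commute mult.left_commute add.commute)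
  qed
  finally show ?thesis by (simp add: det_RSK_degree_reduced_pairs)
qed

lemma unimodular_power: "x \<in> {1, -1 :: complex} \<Longrightarrow> x ^ k = (if odd k then x else 1)"
  by auto

text \<open>As the determinants are 1 or -1, only parities of exponents matter. For equal side
  lengths the exponent is even if \<sigma> and \<pi> differ; if they agree, the squared binomial has
  the parity of the binomial.\<close>

lemma det_RSK_degree_square:
  "det_RSK_degree m m d = (\<Prod>\<sigma>\<in>{\<sigma>. (\<sigma>, \<sigma>) \<in> normalized_reduced_pairs d \<and> odd (A_num \<sigma> \<sigma> d * (m choose length \<sigma>))}. det_RSK_weight \<sigma> \<sigma>)"
proof -
  have fin: "finite (normalized_reduced_pairs d)" by (rule finite_subset[OF _ finite_reduced_pairs[of d]]) (auto simp: normalized_reduced_pairs_iff)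
  let ?g = "\<lambda>q. if fst q = snd q \<and> odd (A_num (fst q) (fst q) d * (m choose length (fst q))) then pair_det q else 1"
  have "det_RSK_degree m m d = (\<Prod>q\<in>normalized_reduced_pairs d. ?g q)"
    unfolding det_RSK_degree_normalized_reduced_pairs
  proof (intro prod.cong refl)
    fix q assume "q \<in> normalized_reduced_pairs d"
    obtain \<sigma> \<pi> where e: "q = (\<sigma>, \<pi>)" by (cases q)
    show "(case q of (\<sigma>, \<pi>) \<Rightarrow> det_RSK_weight \<sigma> \<pi> ^ N_num \<sigma> \<pi> m m d) = ?g q"
      unfolding e prod.case unimodular_power[OF det_RSK_weight_unimodular] by (auto simp: N_num_def)
  qed
  also have "\<dots> = (\<Prod>q\<in>{q \<in> normalized_reduced_pairs d. fst q = snd q \<and> odd (A_num (fst q) (fst q) d * (m choose length (fst q)))}. pair_det q)"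
    by (rule prod.inter_filter[OF fin, symmetric])
  also have "\<dots> = (\<Prod>\<sigma>\<in>{\<sigma>. (\<sigma>, \<sigma>) \<in> normalized_reduced_pairs d \<and> odd (A_num \<sigma> \<sigma> d * (m choose length \<sigma>))}. det_RSK_weight \<sigma> \<sigma>)"
    by (rule prod.reindex_bij_witness[of _ "\<lambda>\<sigma>. (\<sigma>, \<sigma>)" fst]) auto
  finally show ?thesis .
qed

theorem theorem7p1:
  fixes m n d :: nat
  shows "det_RSK_degree m n d =
      (\<Prod>(\<sigma>, \<pi>)\<in>{(\<sigma>, \<pi>). \<exists>d'. 0 < d' \<and> d' \<le> d \<and> weight_pair d' \<sigma> \<pi> \<and>
                       normalized \<sigma> \<pi> \<and> reduced \<sigma> \<pi>}.
         det_RSK_weight \<sigma> \<pi> ^ N_num \<sigma> \<pi> m n d)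
    \<and> (m = n \<longrightarrow>
        det_RSK_degree m m d =
          (\<Prod>\<sigma>\<in>{\<sigma>. \<exists>d'. 0 < d' \<and> d' \<le> d \<and> weight_pair d' \<sigma> \<sigma> \<and> 0 \<notin> set \<sigma> \<and>
                    reduced \<sigma> \<sigma> \<and> odd (A_num \<sigma> \<sigma> d * (m choose length \<sigma>))}.
             det_RSK_weight \<sigma> \<sigma>))"
proof -
  have "normalized \<sigma> \<sigma> \<longleftrightarrow> 0 \<notin> set \<sigma>" for \<sigma> by (simp add: normalized_def)
  then have "{\<sigma>. (\<sigma>, \<sigma>) \<in> normalized_reduced_pairs d \<and> odd (A_num \<sigma> \<sigma> d * (m choose length \<sigma>))} =
    {\<sigma>. \<exists>d'. 0 < d' \<and> d' \<le> d \<and> weight_pair d' \<sigma> \<sigma> \<and> 0 \<notin> set \<sigma> \<and>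
      reduced \<sigma> \<sigma> \<and> odd (A_num \<sigma> \<sigma> d * (m choose length \<sigma>))}"
    by (auto simp: normalized_reduced_pairs_def)
  then show ?thesis
    using det_RSK_degree_normalized_reduced_pairs[of m n d, unfolded normalized_reduced_pairs_def] det_RSK_degree_square[of m d] by metis
qed

end
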